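(* Let $X$ be a complex Banach space, $I=[0,1]$, and let $A(t): D\subset X\to X$ ($t\in I$) be densely defined closed linear operators with common ($t$-independent) domain $D$ such that the family $A$ is $(M,0)$-stable for some $M\in[1,\infty)$ and such that $t\mapsto A(t)$ belongs to $W^{1,\infty}_*(I,L(Y,X))$, where $Y$ is $D$ endowed with the graph norm of $A(0)$. Suppose that $\sigma(t)$ is a compact subset of $\sigma(A(t))$ for every $t\in I$, that $\sigma(\cdot)$ at no point of $I$ falls into $\sigma(A(\cdot))\setminus\sigma(\cdot)$, and that $t\mapsto\sigma(t)$ is continuous. For every $t\in I$ let $P(t)$ be the projection associated with $A(t)$ and $\sigma(t)$, and suppose that $t\mapsto P(t)$ is in $W^{2,\infty}_*(I,L(X))$. Then $$\sup_{t\in I}\|U_\varepsilon(t)-V_\varepsilon(t)\| = O(\varepsilon)\qquad(\varepsilon\searrow 0),$$ where, for $\varepsilon\in(0,\infty)$, $U_\varepsilon$ is the evolution system for $\frac1\varepsilon A$ on $D$ and $V_\varepsilon$ is the evolution system for $\frac1\varepsilon A+[P',P]$ on $D$.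
   Context: $L(X,Y)$ is the space of bounded linear operators, $L(X)=L(X,X)$; $[B,C]=BC-CB$. $W^{m,\infty}_*$: for a compact interval $J$, $B:J\to L(X,Y)$ is in $L^\infty_*(J,L(X,Y))=W^{0,\infty}_*(J,L(X,Y))$ if $t\mapsto B(t)x$ is (Bochner-)measurable for every $x\in X$ and $t\mapsto\|B(t)\|$ is essentially bounded. $A:J\to L(X,Y)$ is in $W^{1,\infty}_*(J,L(X,Y))$ if there is $B\in L^\infty_*(J,L(X,Y))$ (a $W^{1,\infty}_*$-derivative of $A$) such that $A(t)x=A(t_0)x+\int_{t_0}^tB(\tau)x\,d\tau$ for all $t,t_0\in J$, $x\in X$. $W^{m,\infty}_*$ is defined recursively (there is a $W^{1,\infty}_*$-derivative in $W^{m-1,\infty}_*$). For $P\in W^{2,\infty}_*$, $P'$ denotes the derivative lying in $W^{1,\infty}_*$. $(M,\omega)$-stability: each $A(t)$ generates a strongly continuous semigroup and $\|e^{A(t_n)s_n}\cdots e^{A(t_1)s_1}\|\le Me^{\omega(s_1+\dots+s_n)}$ for all $n\in\mathbb N$, $s_i\ge0$, $t_1\le\dots\le t_n$. Evolution system for a family $A$ of linear operators $A(t)$ ($t\in I$) on the spaces $D(A(t))$: bounded operators $U(t,s)$, $0\le s\le t\le1$, such that (i) for every $s\in[0,1)$ and $y\in D(A(s))$, $[s,1]\ni t\mapsto U(t,s)y$ is a continuously differentiable solution of $x'=A(t)x$, $x(s)=y$; (ii) $U(t,s)U(s,r)=U(t,r)$ for $r\le s\le t$ and $(s,t)\mapsto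 U(t,s)x$ is continuous for all $x\in X$. It is unique if it exists; $U(t):=U(t,0)$. If the $A(t):D\subset X\to X$ ($t\in I$) are densely defined closed linear operators with common domain $D$ such that the family $A$ is $(M,0)$-stable and $t\mapsto A(t)$ is in $W^{1,\infty}_*(I,L(Y,X))$ (with $Y$ being $D$ endowed with the graph norm of $A(0)$), and if $t\mapsto P(t)$ is in $W^{2,\infty}_*(I,L(X))$, then $U_\varepsilon$ and $V_\varepsilon$ exist by a theorem of Kato. Associated projection: for a densely defined closed $A$ with $\rho(A)\ne\emptyset$ and a nonempty compact subset $\sigma$ isolated in $\sigma(A)$, a bounded projection $P$ is associated with $A$ and $\sigma$ if $PA\subset AP$, $PD(A)=PX$, $\sigma(A|_{PD(A)})=\sigma$ and $\sigma(A|_{(1-P)D(A)})=\sigma(A)\setminus\sigma$. It exists and is unique (the Riesz projection). $\sigma(\cdot)$ falls into $\sigma(A(\cdot))\setminus\sigma(\cdot)$ at $t_0$ if there is a sequence $t_n\to t_0$ in $I$ with $\operatorname{dist}(\sigma(t_n),\sigma(A(t_n))\setminus\sigma(t_n))\to0$ (distance to the empty set is $\infty$). $t\mapsto\sigma(t)$ is continuous if it is upper and lower semicontinuous: for every $t_0$ and $r>0$, $\sigma(t)$ lies in the open $r$-neighbourhood of $\sigma(t_0)$ and $\sigma(t_0)$ in that of $\sigma(t)$ for all $t$ close enough to $t_0$. *)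

theory Defs
  imports "HOL-Analysis.Analysis" "HOL-Library.Landau_Symbols"
begin

subsection \<open>Complex Banach spaces and linear operators\<close>

class scaleC =
  fixes scaleC :: "complex \<Rightarrow> 'a \<Rightarrow> 'a" (infixr \<open>*\<^sub>C\<close> 75)

class complex_banach = banach + scaleC +
  assumes scaleC_add_right: "a *\<^sub>C (x + y) = a *\<^sub>C x + a *\<^sub>C y"
    and scaleC_add_left: "(a + b) *\<^sub>C x = a *\<^sub>C x + b *\<^sub>C x"
    and scaleC_scaleC: "a *\<^sub>C (b *\<^sub>C x) = (a * b) *\<^sub>C x"
    and scaleC_of_real: "of_real r *\<^sub>C x = r *\<^sub>R x"
    and norm_scaleC: "norm (a *\<^sub>C x) = cmod a * norm x"

definition bounded_clinear :: "('a::complex_banach \<Rightarrow> 'a) \<Rightarrow> bool" where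
  "bounded_clinear T \<longleftrightarrow> bounded_linear T \<and> (\<forall>c x. T (c *\<^sub>C x) = c *\<^sub>C T x)"

definition csubspace :: "'a::complex_banach set \<Rightarrow> bool" where
  "csubspace D \<longleftrightarrow> 0 \<in> D \<and> (\<forall>x\<in>D. \<forall>y\<in>D. x + y \<in> D) \<and> (\<forall>c. \<forall>x\<in>D. c *\<^sub>C x \<in> D)"

text \<open>An operator with domain \<open>D\<close> is a total function together with the set \<open>D\<close>;
  its values outside \<open>D\<close> never matter.\<close>

definition clinear_on :: "'a::complex_banach set \<Rightarrow> ('a \<Rightarrow> 'a) \<Rightarrow> bool" where
  "clinear_on D A \<longleftrightarrow> csubspace D \<and> (\<forall>x\<in>D. \<forall>y\<in>D. A (x + y) = A x + A y)
     \<and> (\<forall>c. \<forall>x\<in>D. A (c *\<^sub>C x) = c *\<^sub>C A x)"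

definition densely_defined_closed :: "'a::complex_banach set \<Rightarrow> ('a \<Rightarrow> 'a) \<Rightarrow> bool" where
  "densely_defined_closed D A \<longleftrightarrow>
     clinear_on D A \<and> closure D = UNIV \<and> closed {(x, A x) |x. x \<in> D}"


subsection \<open>Strong measurability and the Bochner integral\<close>

text \<open>The library's \<^const>\<open>has_bochner_integral\<close> is restricted to second countable (hence
  separable) spaces. The following is the same notion with Borel measurability replaced by
  strong measurability, i.e. approximability by simple functions almost everywhere.\<close>

definition strongly_measurable :: "'m measure \<Rightarrow> ('m \<Rightarrow> 'b::real_normed_vector) \<Rightarrow> bool" where
  "strongly_measurable M f \<longleftrightarrow>
     (\<exists>s. (\<forall>i::nat. simple_function M (s i)) \<and> (AE x in M. (\<lambda>i. s i x) \<longlonglongrightarrow> f x))"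

definition has_strong_bochner_integral ::
    "'m measure \<Rightarrow> ('m \<Rightarrow> 'b::real_normed_vector) \<Rightarrow> 'b \<Rightarrow> bool" where
  "has_strong_bochner_integral M f y \<longleftrightarrow> strongly_measurable M f \<and>
     (\<exists>s. (\<forall>i::nat. Bochner_Integration.simple_bochner_integrable M (s i)) \<and>
        (\<lambda>i. \<integral>\<^sup>+x. ennreal (norm (f x - s i x)) \<partial>M) \<longlonglongrightarrow> 0 \<and>
        (\<lambda>i. Bochner_Integration.simple_bochner_integral M (s i)) \<longlonglongrightarrow> y)"

definition has_oriented_integral ::
    "(real \<Rightarrow> 'b::real_normed_vector) \<Rightarrow> 'b \<Rightarrow> real \<Rightarrow> real \<Rightarrow> bool" where
  "has_oriented_integral f y a b \<longleftrightarrow>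
     (if a \<le> b then has_strong_bochner_integral (lebesgue_on {a..b}) f y
      else has_strong_bochner_integral (lebesgue_on {b..a}) f (- y))"


subsection \<open>The spaces \<open>W\<^sup>m\<^sup>,\<^sup>\<infinity>\<^sub>*(J, L(Y, X))\<close>\<close>

text \<open>\<open>Y\<close> is a subspace \<open>D\<close> of \<open>X\<close> carrying its own norm \<open>N\<close>; the case \<open>L(X)\<close> is
  \<open>D = UNIV\<close>, \<open>N = norm\<close>.\<close>

definition bounded_op :: "'a::complex_banach set \<Rightarrow> ('a \<Rightarrow> real) \<Rightarrow> ('a \<Rightarrow> 'a) \<Rightarrow> bool" where
  "bounded_op D N B \<longleftrightarrow> clinear_on D B \<and> (\<exists>K. \<forall>x\<in>D. norm (B x) \<le> K * N x)"

definition op_norm :: "'a::complex_banach set \<Rightarrow> ('a \<Rightarrow> real) \<Rightarrow> ('a \<Rightarrow> 'a) \<Rightarrow> real" where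
  "op_norm D N B = Inf {K. 0 \<le> K \<and> (\<forall>x\<in>D. norm (B x) \<le> K * N x)}"

definition graph_norm :: "('a::complex_banach \<Rightarrow> 'a) \<Rightarrow> 'a \<Rightarrow> real" where
  "graph_norm A x = norm x + norm (A x)"

definition Linf_star ::
    "real set \<Rightarrow> 'a::complex_banach set \<Rightarrow> ('a \<Rightarrow> real) \<Rightarrow> (real \<Rightarrow> 'a \<Rightarrow> 'a) \<Rightarrow> bool" where
  "Linf_star J D N B \<longleftrightarrow> (\<forall>t\<in>J. bounded_op D N (B t)) \<and>
     (\<forall>x\<in>D. strongly_measurable (lebesgue_on J) (\<lambda>t. B t x)) \<and>
     (\<exists>C. AE t in lebesgue_on J. op_norm D N (B t) \<le> C)"

definition W_deriv ::
    "real set \<Rightarrow> 'a::complex_banach set \<Rightarrow> ('a \<Rightarrow> real) \<Rightarrow>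
     (real \<Rightarrow> 'a \<Rightarrow> 'a) \<Rightarrow> (real \<Rightarrow> 'a \<Rightarrow> 'a) \<Rightarrow> bool" where
  "W_deriv J D N A B \<longleftrightarrow> Linf_star J D N B \<and>
     (\<forall>t0\<in>J. \<forall>t\<in>J. \<forall>x\<in>D. has_oriented_integral (\<lambda>\<tau>. B \<tau> x) (A t x - A t0 x) t0 t)"

primrec W_star ::
    "nat \<Rightarrow> real set \<Rightarrow> 'a::complex_banach set \<Rightarrow> ('a \<Rightarrow> real) \<Rightarrow>
     (real \<Rightarrow> 'a \<Rightarrow> 'a) \<Rightarrow> bool" where
  "W_star 0 J D N A \<longleftrightarrow> Linf_star J D N A"
| "W_star (Suc m) J D N A \<longleftrightarrow> (\<forall>t\<in>J. bounded_op D N (A t)) \<and>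
     (\<exists>B. W_deriv J D N A B \<and> W_star m J D N B)"


subsection \<open>Semigroups and \<open>(M, \<omega>)\<close>-stability\<close>

definition C0_semigroup :: "(real \<Rightarrow> 'a::complex_banach \<Rightarrow> 'a) \<Rightarrow> bool" where
  "C0_semigroup T \<longleftrightarrow> (\<forall>s\<ge>0. bounded_clinear (T s)) \<and> T 0 = id \<and>
     (\<forall>r\<ge>0. \<forall>s\<ge>0. T (r + s) = T r \<circ> T s) \<and> (\<forall>x. continuous_on {0..} (\<lambda>s. T s x))"

definition generates ::
    "'a::complex_banach set \<Rightarrow> ('a \<Rightarrow> 'a) \<Rightarrow> (real \<Rightarrow> 'a \<Rightarrow> 'a) \<Rightarrow> bool" where
  "generates D A T \<longleftrightarrow> C0_semigroup T \<and>
     (\<forall>x y. (x \<in> D \<and> A x = y) \<longleftrightarrow>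
        ((\<lambda>h. (T h x - x) /\<^sub>R h) \<longlongrightarrow> y) (at_right 0))"

text \<open>\<open>op_prod F n = F (n - 1) \<circ> \<dots> \<circ> F 0\<close>\<close>

primrec op_prod :: "(nat \<Rightarrow> 'a \<Rightarrow> 'a) \<Rightarrow> nat \<Rightarrow> 'a \<Rightarrow> 'a" where
  "op_prod F 0 = id"
| "op_prod F (Suc n) = F n \<circ> op_prod F n"

text \<open>A generator determines its semigroup on \<open>{0..}\<close>, so the existentially quantified \<open>T t s\<close>
  is \<open>exp (A(t) s)\<close>.\<close>

definition stable_family ::
    "real set \<Rightarrow> (real \<Rightarrow> 'a::complex_banach set) \<Rightarrow> (real \<Rightarrow> 'a \<Rightarrow> 'a) \<Rightarrow>
     real \<Rightarrow> real \<Rightarrow> bool" where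
  "stable_family J Dom A M \<omega> \<longleftrightarrow>
     (\<exists>T. (\<forall>t\<in>J. generates (Dom t) (A t) (T t)) \<and>
        (\<forall>n t s. (\<forall>i<n. t i \<in> J \<and> 0 \<le> s i) \<and> mono_on {..<n} t \<longrightarrow>
           onorm (op_prod (\<lambda>i. T (t i) (s i)) n) \<le> M * exp (\<omega> * (\<Sum>i<n. s i))))"


subsection \<open>Evolution systems\<close>

definition evolution_system ::
    "(real \<Rightarrow> 'a::complex_banach set) \<Rightarrow> (real \<Rightarrow> 'a \<Rightarrow> 'a) \<Rightarrow>
     (real \<Rightarrow> real \<Rightarrow> 'a \<Rightarrow> 'a) \<Rightarrow> bool" where
  "evolution_system Dom A U \<longleftrightarrow>
     (\<forall>s t. 0 \<le> s \<and> s \<le> t \<and> t \<le> 1 \<longrightarrow> bounded_clinear (U t s)) \<and>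
     (\<forall>s\<in>{0..<1}. \<forall>y\<in>Dom s.
        U s s y = y \<and>
        (\<forall>t\<in>{s..1}. U t s y \<in> Dom t \<and>
           ((\<lambda>t. U t s y) has_vector_derivative A t (U t s y)) (at t within {s..1})) \<and>
        continuous_on {s..1} (\<lambda>t. A t (U t s y))) \<and>
     (\<forall>r s t. 0 \<le> r \<and> r \<le> s \<and> s \<le> t \<and> t \<le> 1 \<longrightarrow> U t s \<circ> U s r = U t r) \<and>
     (\<forall>x. continuous_on {(s, t). 0 \<le> s \<and> s \<le> t \<and> t \<le> 1} (\<lambda>(s, t). U t s x))"

definition commutator :: "('a::complex_banach \<Rightarrow> 'a) \<Rightarrow> ('a \<Rightarrow> 'a) \<Rightarrow> 'a \<Rightarrow> 'a" where
  "commutator B C x = B (C x) - C (B x)"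


subsection \<open>Spectra and associated projections\<close>

text \<open>Spectrum of an operator with domain \<open>D\<close> acting in the subspace \<open>E\<close>; the second conjunct
  is boundedness of the inverse \<open>E \<rightarrow> D\<close>.\<close>

definition resolvent_set ::
    "'a::complex_banach set \<Rightarrow> 'a set \<Rightarrow> ('a \<Rightarrow> 'a) \<Rightarrow> complex set" where
  "resolvent_set E D A = {z. bij_betw (\<lambda>x. A x - z *\<^sub>C x) D E \<and>
     (\<exists>K. \<forall>x\<in>D. norm x \<le> K * norm (A x - z *\<^sub>C x))}"

definition spectrum ::
    "'a::complex_banach set \<Rightarrow> 'a set \<Rightarrow> ('a \<Rightarrow> 'a) \<Rightarrow> complex set" where
  "spectrum E D A = - resolvent_set E D A"

definition isolated_part :: "complex set \<Rightarrow> complex set \<Rightarrow> bool" where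
  "isolated_part \<sigma> S \<longleftrightarrow> \<sigma> \<subseteq> S \<and> (\<exists>V. open V \<and> V \<inter> S = \<sigma>)"

definition associated_projection ::
    "'a::complex_banach set \<Rightarrow> ('a \<Rightarrow> 'a) \<Rightarrow> complex set \<Rightarrow> ('a \<Rightarrow> 'a) \<Rightarrow> bool" where
  "associated_projection D A \<sigma> P \<longleftrightarrow>
     densely_defined_closed D A \<and> resolvent_set UNIV D A \<noteq> {} \<and>
     compact \<sigma> \<and> \<sigma> \<noteq> {} \<and> isolated_part \<sigma> (spectrum UNIV D A) \<and>
     bounded_clinear P \<and> P \<circ> P = P \<and>
     (\<forall>x\<in>D. P x \<in> D \<and> P (A x) = A (P x)) \<and>
     P ` D = range P \<and>
     spectrum (range P) (P ` D) A = \<sigma> \<and>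
     spectrum (range (\<lambda>x. x - P x)) ((\<lambda>x. x - P x) ` D) A = spectrum UNIV D A - \<sigma>"


subsection \<open>Set-valued maps\<close>

text \<open>Unlike \<^const>\<open>setdist\<close>, this is \<open>\<infinity>\<close> if one of the sets is empty.\<close>

definition edist_sets :: "complex set \<Rightarrow> complex set \<Rightarrow> ereal" where
  "edist_sets S T = (INF x\<in>S. INF y\<in>T. ereal (dist x y))"

definition falls_into_at ::
    "real set \<Rightarrow> (real \<Rightarrow> complex set) \<Rightarrow> (real \<Rightarrow> complex set) \<Rightarrow> real \<Rightarrow> bool" where
  "falls_into_at J \<sigma> \<tau> t0 \<longleftrightarrow>
     (\<exists>t. (\<forall>n::nat. t n \<in> J) \<and> t \<longlonglongrightarrow> t0 \<and> (\<lambda>n. edist_sets (\<sigma> (t n)) (\<tau> (t n))) \<longlonglongrightarrow> 0)"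

definition set_continuous_on :: "real set \<Rightarrow> (real \<Rightarrow> complex set) \<Rightarrow> bool" where
  "set_continuous_on J \<sigma> \<longleftrightarrow>
     (\<forall>t0\<in>J. \<forall>r>0. \<forall>\<^sub>F t in at t0 within J.
        \<sigma> t \<subseteq> (\<Union>z\<in>\<sigma> t0. ball z r) \<and> \<sigma> t0 \<subseteq> (\<Union>z\<in>\<sigma> t. ball z r))"

end

theory Submission
  imports Defs
begin

text \<open>Write \<open>Y = [P', P]\<close>. Since \<open>P\<close> is idempotent, \<open>Y\<close> is off-diagonal with respect to \<open>P\<close>, and
  because the two diagonal blocks of \<open>A\<close> have disjoint spectra, the commutator equation
  \<open>B A - A B = Y\<close> has a bounded solution \<open>B(t)\<close>, locally Lipschitz in \<open>t\<close>. Along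
  \<open>v = V(\<cdot>, s) y\<close>, the function \<open>w(\<tau>) = U(t, \<tau>) (v - \<epsilon> B v)\<close> satisfies
  \<open>w' = - \<epsilon> U(t, \<tau>) (B' + B Y) v\<close>, so \<open>w\<close> changes by \<open>O(\<epsilon>)\<close> only, while \<open>w(t) - w(s)\<close> differs from
  \<open>(V(t, s) - U(t, s)) y\<close> by \<open>O(\<epsilon>)\<close>. As \<open>B\<close> is merely Lipschitz, derivatives are replaced by
  right increments.

  The commutator equation is solved with the resolvent \<open>G\<close> of \<open>A\<close> in the form \<open>G B - B G = G Y G\<close>.
  Blockwise it is inverted by Rosenblum's theorem: commuting \<open>a\<close>, \<open>b\<close> with disjoint spectra have an
  invertible difference, with inverse a multiple of the area integral of \<open>\<phi>(z) (z - a)\<^sup>-\<^sup>1 (z - b)\<^sup>-\<^sup>1\<close>, where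
  \<open>\<phi>\<close> is the derivative of a \<open>C\<^sup>1\<close> cutoff separating the spectra with respect to the conjugate of \<open>z\<close>.
  This integral takes the place of a contour integral around \<open>\<sigma>\<close>.
  Invertibility and Lipschitz dependence persist for \<open>t\<close> near \<open>t\<^sub>0\<close>, and the local estimates are glued
  by compactness of \<open>[0, 1]\<close>.\<close>

text \<open>Passing to the bounded resolvent turns the commutator equation into one in a Banach
  algebra, but changes the spectral picture: the spectrum of \<open>G\<close> consists of the points
  1/(\<zeta> - \<mu>) and possibly 0, the image of infinity. The point 0 goes with the complementary
  block, because the range of \<open>P\<close> lies in \<open>D\<close>, so that \<open>A P\<close>
  is bounded and 0 is regular for the \<open>P\<close> block. Sylvester operators x -> a x - x b are
  differences of commuting elements of the algebra of operators on the algebra, which is why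
  Rosenblum's theorem is proved abstractly and applied one level up. An evolution system is
  differentiable only in its forward time variable. Right increments meet this obstacle too: U(t,
  \<tau>) = U(t, \<tau> + h) U(\<tau> + h, \<tau>) reduces everything to the forward derivative at
  \<tau> and a norm bound on U(t, \<tau> + h). That bound must be uniform in the scaling
  1/\<epsilon>; it comes from comparing \<open>U\<close> with products of frozen semigroups, for
  which stability gives \<open>M\<close> whatever the time steps are.\<close>

lemma closed_graph:
  fixes T :: "'a::banach \<Rightarrow> 'b::banach"
  assumes lin: "linear T" and cl: "\<And>x l y. x \<longlonglongrightarrow> l \<Longrightarrow> (\<lambda>n::nat. T (x n)) \<longlonglongrightarrow> y \<Longrightarrow> T l = y"
  shows "bounded_linear T"
proof -
  interpret linear T by (rule lin)
  \<comment> \<open>Baire category: the closed sets \<open>E n\<close> exhaust the space, so one of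
    them contains a ball, on which \<open>T\<close> is bounded up to closure.\<close>
  define E where "E n = closure {x. norm (T x) \<le> real n}" for n :: nat
  have "\<Union>(range E) = UNIV"
  proof -
    have "x \<in> E (nat \<lceil>norm (T x)\<rceil>)" for x
      unfolding E_def by (intro subsetD[OF closure_subset]) (simp add: of_nat_ceiling)
    then show ?thesis by blast
  qed
  then obtain n where "interior (E n) \<noteq> {}"
    using Baire_category_alt[of "euclidean :: 'a topology" "range E"] completely_metrizable_space_euclidean
    unfolding E_def by fastforce
  then obtain a r where r: "r > 0" "ball a r \<subseteq> E n"
    by (meson ex_in_conv mem_interior)
  \<comment> \<open>Subtracting the approximations of a + x/s and a - x/s cancels the unknown centre
    \<open>a\<close>; this moves the ball to the origin and scales it by \<open>s\<close>.\<close>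
  have dense: "\<exists>y. norm (T y) \<le> real n * s \<and> norm (x - y) < e" if "norm x < r * s" "e > 0" "s > 0" for x e s
  proof -
    let ?e = "e / s"
    have e: "?e > 0" using that by simp
    have 1: "a + x /\<^sub>R s \<in> E n" "a - x /\<^sub>R s \<in> E n"
      using r that by (auto intro!: subsetD[OF r(2)] simp: dist_norm field_simps)
    obtain u where u: "norm (T u) \<le> n" "dist u (a + x /\<^sub>R s) < ?e"
      using 1(1) e unfolding E_def closure_approachable by blast
    obtain v where v: "norm (T v) \<le> n" "dist v (a - x /\<^sub>R s) < ?e"
      using 1(2) e unfolding E_def closure_approachable by blast
    define y where "y = (s / 2) *\<^sub>R (u - v)"
    have "norm (T y) = (s / 2) * norm (T u - T v)"
      using that by (simp add: y_def scale diff)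
    also have "\<dots> \<le> (s / 2) * (n + n)"
      using that u v by (intro mult_left_mono norm_triangle_le_diff) auto
    finally have "norm (T y) \<le> real n * s" by (simp add: mult.commute)
    moreover have "x - y = (s / 2) *\<^sub>R ((v - (a - x /\<^sub>R s)) - (u - (a + x /\<^sub>R s)))"
      using that by (simp add: y_def algebra_simps flip: scaleR_add_left)
    then have "norm (x - y) \<le> (s / 2) * (norm (v - (a - x /\<^sub>R s)) + norm (u - (a + x /\<^sub>R s)))"
      using that by (simp only: norm_scaleR) (intro mult_mono norm_triangle_ineq4, auto)
    moreover have "\<dots> < (s / 2) * (?e + ?e)"
      using that u v by (intro mult_strict_left_mono add_strict_mono) (auto simp: dist_norm)
    ultimately show ?thesis using that by (intro exI[of _ y]) auto
  qed
  have bnd: "norm (T x) \<le> 2 * real n" if x: "norm x < r" for x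
  proof -
    \<comment> \<open>Iterated approximation: each \<open>pick\<close> leaves a remainder within
      half the previous radius, while the bounds on the images form a geometric series with sum 2n.
      The closed graph identifies \<open>T x\<close> with the sum of the images.\<close>
    define pick where "pick z k = (SOME y. norm (T y) \<le> real n * (1/2)^k \<and> norm (z - y) < r * (1/2)^Suc k)" for z k
    have pick: "norm (T (pick z k)) \<le> real n * (1/2)^k \<and> norm (z - pick z k) < r * (1/2)^Suc k"
      if "norm z < r * (1/2)^k" for z k
      unfolding pick_def by (rule someI_ex, rule dense) (use that r in auto)
    define z where "z = rec_nat x (\<lambda>k z. z - pick z k)"
    have z0: "z 0 = x" and zS: "z (Suc k) = z k - pick (z k) k" for k by (simp_all add: z_def)
    have zb: "norm (z k) < r * (1/2)^k" for k
    proof (induction k)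
      case 0 then show ?case using x by (simp add: z0)
    next
      case (Suc k) then show ?case using pick[OF Suc] by (simp add: zS)
    qed
    define y where "y k = pick (z k) k" for k
    have Ty: "norm (T (y k)) \<le> real n * (1/2)^k" for k
      using pick[OF zb] by (simp add: y_def)
    have part: "(\<Sum>k<m. y k) = x - z m" for m
      by (induction m) (auto simp: z0 zS y_def)
    have "z \<longlonglongrightarrow> 0"
    proof (rule Lim_null_comparison)
      show "(\<lambda>k. r * (1/2)^k) \<longlonglongrightarrow> (0::real)"
        by (rule tendsto_mult_right_zero) (simp add: LIMSEQ_realpow_zero)
      show "\<forall>\<^sub>F k in sequentially. norm (z k) \<le> r * (1/2)^k"
        using zb by (intro always_eventually allI less_imp_le)
    qed
    then have "(\<lambda>m. x - z m) \<longlonglongrightarrow> x" using tendsto_diff[OF tendsto_const[of x]] by fastforce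
    then have lim1: "(\<lambda>m. \<Sum>k<m. y k) \<longlonglongrightarrow> x" by (simp add: part)
    have sg: "summable (\<lambda>k. real n * (1/2)^k)" by (intro summable_mult summable_geometric) simp
    then have sT: "summable (\<lambda>k. norm (T (y k)))"
      by (rule summable_comparison_test[rotated]) (use Ty in auto)
    then have "(\<lambda>m. \<Sum>k<m. T (y k)) \<longlonglongrightarrow> (\<Sum>k. T (y k))"
      by (rule summable_LIMSEQ[OF summable_norm_cancel])
    then have "(\<lambda>m. T (\<Sum>k<m. y k)) \<longlonglongrightarrow> (\<Sum>k. T (y k))" by (simp add: sum)
    from cl[OF lim1 this] have "norm (T x) \<le> (\<Sum>k. norm (T (y k)))"
      using summable_norm[OF sT] by simp
    also have "\<dots> \<le> (\<Sum>k. real n * (1/2)^k)" by (rule suminf_le[OF Ty sT sg])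
    also have "\<dots> = 2 * real n" by (simp add: suminf_mult suminf_geometric summable_geometric)
    finally show ?thesis .
  qed
  show ?thesis
  proof (rule bounded_linear_intro[where K="4 * real n / r"])
    fix x
    show "norm (T x) \<le> norm x * (4 * real n / r)"
    proof (cases "x = 0")
      case False
      let ?c = "r / (2 * norm x)"
      have c: "?c > 0" using False r by simp
      have "norm (T (?c *\<^sub>R x)) \<le> 2 * real n" using False r by (intro bnd) auto
      then have "?c * norm (T x) \<le> 2 * real n" using c r by (simp add: scale del: times_divide_eq_left)
      then show ?thesis using False r by (simp add: field_simps)
    qed (simp add: zero)
  qed (auto simp: add scale)
qed

text \<open>A mean value inequality that needs no derivative. The set of points where the bound from
  \<open>a\<close> holds with slope c + e is closed by continuity, and below \<open>b\<close> its
  supremum could be moved to the right. The slack \<open>e\<close> absorbs the o(h) terms of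
  difference quotients.\<close>

lemma right_increment_bound:
  fixes f :: "real \<Rightarrow> 'b::real_normed_vector"
  assumes ab: "a \<le> b" and cont: "continuous_on {a..b} f"
    and inc: "\<And>t e. a \<le> t \<Longrightarrow> t < b \<Longrightarrow> e > 0 \<Longrightarrow> \<forall>\<^sub>F h in at_right 0. norm (f (t + h) - f t) \<le> h * (c + e)"
  shows "norm (f b - f a) \<le> c * (b - a)"
proof -
  have key: "norm (f b - f a) \<le> (c + e) * (b - a)" if e: "e > 0" for e
  proof -
    define S where "S = {t \<in> {a..b}. norm (f t - f a) - (c + e) * (t - a) \<le> 0}"
    have "closed S"
      unfolding S_def by (intro continuous_closed_preimage_constant[unfolded vimage_def] continuous_on_closed_Collect_le closed_atLeastAtMost continuous_intros cont) 
    define s where "s = Sup S"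
    have aS: "a \<in> S" using ab by (simp add: S_def)
    have bdd: "bdd_above S" by (auto simp: S_def bdd_above_def)
    have sS: "s \<in> S" unfolding s_def using closed_contains_Sup aS bdd \<open>closed S\<close> by blast
    have "s = b"
    proof (rule ccontr)
      assume "s \<noteq> b"
      then have sb: "a \<le> s" "s < b" using sS by (auto simp: S_def)
      have "\<forall>\<^sub>F h in at_right 0. h < b - s" using sb eventually_at_right_real[of 0 "b - s"] by (auto elim: eventually_mono)
      then have "\<forall>\<^sub>F h in at_right 0. norm (f (s + h) - f s) \<le> h * (c + e) \<and> h < b - s \<and> h > 0"
        using inc[OF sb e] eventually_at_right_less[of 0] by eventually_elim auto
      then obtain h where h: "norm (f (s + h) - f s) \<le> h * (c + e)" "h < b - s" "h > 0"
        using eventually_happens'[OF trivial_limit_at_right_real] by blast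
      have "norm (f (s + h) - f a) \<le> norm (f (s + h) - f s) + norm (f s - f a)"
        using norm_triangle_ineq[of "f (s + h) - f s" "f s - f a"] by simp
      also have "\<dots> \<le> h * (c + e) + (c + e) * (s - a)" using h sS by (simp add: S_def)
      finally have "s + h \<in> S" using h sb by (simp add: S_def algebra_simps)
      then show False using cSup_upper[OF _ bdd] h(3) by (fastforce simp: s_def)
    qed
    then show ?thesis using sS by (simp add: S_def)
  qed
  show ?thesis
  proof (rule field_le_epsilon)
    fix d :: real assume d: "d > 0"
    show "norm (f b - f a) \<le> c * (b - a) + d"
    proof -
      have "d / (b - a + 1) * (b - a) \<le> d" using ab d by (simp add: field_simps)
      then show ?thesis using key[of "d / (b - a + 1)"] ab d by (simp add: distrib_right)
    qed
  qed
qed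

subsection \<open>Complex Banach algebras\<close>

text \<open>The unit is only required to have norm at most 1, so that the operators on the zero
  space, where the identity has norm 0, form an instance as well.\<close>

class complex_banach_algebra = complex_banach + real_normed_algebra + monoid_mult +
  assumes scaleC_mult_left: "(c *\<^sub>C x) * y = c *\<^sub>C (x * y)"
    and scaleC_mult_right: "x * (c *\<^sub>C y) = c *\<^sub>C (x * y)"
    and norm_one_le: "norm 1 \<le> 1"

lemma bounded_bilinear_scaleC: "bounded_bilinear ((*\<^sub>C) :: complex \<Rightarrow> 'a::complex_banach \<Rightarrow> 'a)"
proof
  fix c c' :: complex and x y :: 'a and r :: real
  show "(r *\<^sub>R c) *\<^sub>C x = r *\<^sub>R c *\<^sub>C x"
    by (simp add: scaleC_scaleC scaleR_conv_of_real flip: scaleC_of_real)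
  show "c *\<^sub>C r *\<^sub>R x = r *\<^sub>R c *\<^sub>C x"
    by (simp add: scaleC_scaleC mult.commute flip: scaleC_of_real)
  show "\<exists>K. \<forall>a (b::'a). norm (a *\<^sub>C b) \<le> norm a * norm b * K"
    by (intro exI[of _ 1]) (simp add: norm_scaleC)
qed (simp_all add: scaleC_add_left scaleC_add_right)

interpretation scaleC: bounded_bilinear "(*\<^sub>C) :: complex \<Rightarrow> 'a::complex_banach \<Rightarrow> 'a"
  by (rule bounded_bilinear_scaleC)

lemma scaleC_one [simp]: "1 *\<^sub>C x = (x :: 'a::complex_banach)"
  using scaleC_of_real[of 1 x] by simp

lemma scaleC_zero [simp]: "0 *\<^sub>C x = (0 :: 'a::complex_banach)" "c *\<^sub>C 0 = (0 :: 'a)"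
  by (rule scaleC.zero_left, rule scaleC.zero_right)

declare scaleC.continuous_on [continuous_intros] scaleC.tendsto [tendsto_intros]

definition ainvertible :: "'a::complex_banach_algebra \<Rightarrow> bool" where
  "ainvertible x \<longleftrightarrow> (\<exists>y. x * y = 1 \<and> y * x = 1)"

definition ainv :: "'a::complex_banach_algebra \<Rightarrow> 'a" where
  "ainv x = (SOME y. x * y = 1 \<and> y * x = 1)"

lemma ainv: "ainvertible x \<Longrightarrow> x * ainv x = 1" "ainvertible x \<Longrightarrow> ainv x * x = 1"
  unfolding ainvertible_def ainv_def by (metis (mono_tags, lifting) someI_ex)+

lemma ainv_cancel: "ainvertible x \<Longrightarrow> x * (ainv x * y) = y" "ainvertible x \<Longrightarrow> ainv x * (x * y) = y"
  by (simp_all add: ainv flip: mult.assoc)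

lemma ainvertibleI: "x * y = 1 \<Longrightarrow> z * x = 1 \<Longrightarrow> ainvertible x"
  unfolding ainvertible_def by (metis mult.assoc mult_1_left mult_1_right)

lemma ainv_commute:
  assumes "ainvertible x" "x * y = y * x" shows "ainv x * y = y * ainv x"
proof -
  have "ainv x * y = ainv x * (y * x) * ainv x"
    using assms(1) by (simp add: mult.assoc ainv)
  also have "\<dots> = y * ainv x"
    by (simp flip: assms(2)) (simp add: mult.assoc ainv_cancel assms(1))
  finally show ?thesis .
qed

lemma ainvertible_mult:
  assumes "ainvertible x" "ainvertible y" shows "ainvertible (x * y)"
  by (rule ainvertibleI[of _ "ainv y * ainv x" "ainv y * ainv x"])
    (simp_all add: assms ainv ainv_cancel mult.assoc)

text \<open>The right and left inverses are the fixed points of the contractions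
  \<open>y \<mapsto> 1 - x y\<close> and \<open>y \<mapsto> 1 - y x\<close>.\<close>

lemma ainvertible_one_plus:
  fixes x :: "'a::complex_banach_algebra"
  assumes "norm x < 1" shows "ainvertible (1 + x)"
proof -
  have "dist (1 - x * y) (1 - x * z) \<le> norm x * dist y z" for y z
    using norm_mult_ineq[of x "z - y"] by (simp add: dist_norm right_diff_distrib norm_minus_commute)
  then have "\<exists>!y. 1 - x * y = y"
    using assms by (intro banach_fix_type[of "norm x"]) auto
  then obtain y where "1 - x * y = y" by blast
  then have y: "(1 + x) * y = 1" by (simp add: algebra_simps)
  have "dist (1 - y * x) (1 - z * x) \<le> norm x * dist y z" for y z
    using norm_mult_ineq[of "z - y" x] by (simp add: dist_norm left_diff_distrib norm_minus_commute mult.commute)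
  then have "\<exists>!y. 1 - y * x = y"
    using assms by (intro banach_fix_type[of "norm x"]) auto
  then obtain z where "1 - z * x = z" by blast
  then have "z * (1 + x) = 1" by (simp add: algebra_simps)
  with y show ?thesis by (rule ainvertibleI)
qed

lemma norm_mult3_le: "norm (x * y * z) \<le> norm x * norm y * norm (z::'a::real_normed_algebra)"
  by (meson norm_mult_ineq mult_right_mono norm_ge_zero order_trans)

text \<open>Everything follows from the identity for the difference of two inverses: smallness of
  \<open>h\<close> lets half of the norm of the new inverse be absorbed, whence the factor
  2.\<close>

lemma ainv_perturb:
  fixes u h :: "'a::complex_banach_algebra"
  assumes u: "ainvertible u" and h: "norm h * norm (ainv u) \<le> 1/2"
  shows "ainvertible (u + h)"
    and "norm (ainv (u + h)) \<le> 2 * norm (ainv u)"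
    and "ainv (u + h) - ainv u = - (ainv (u + h) * h * ainv u)"
    and "norm (ainv (u + h) - ainv u) \<le> 2 * (norm (ainv u))\<^sup>2 * norm h"
proof -
  let ?r = "ainv u" and ?r' = "ainv (u + h)"
  have "norm (?r * h) < 1" using h norm_mult_ineq[of ?r h] by (simp add: mult.commute)
  then have "ainvertible (u * (1 + ?r * h))"
    by (intro ainvertible_mult u ainvertible_one_plus)
  then show inv: "ainvertible (u + h)" using u by (simp add: algebra_simps ainv_cancel)
  have "?r' * (u - (u + h)) * ?r = ?r' * (u * ?r) - (?r' * (u + h)) * ?r"
    by (simp add: algebra_simps)
  also have "\<dots> = ?r' - ?r" by (simp only: ainv u inv mult_1_left mult_1_right)
  finally have "?r' - ?r = ?r' * (u - (u + h)) * ?r" ..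
  then show eq: "?r' - ?r = - (?r' * h * ?r)" by simp
  have le: "norm (?r' - ?r) \<le> norm ?r' * norm h * norm ?r"
    unfolding eq norm_minus_cancel by (rule norm_mult3_le)
  also have "\<dots> \<le> norm ?r' * (1/2)"
    using mult_left_mono[OF h, of "norm ?r'"] by (simp add: mult.assoc)
  finally show le2: "norm ?r' \<le> 2 * norm ?r" using norm_triangle_sub[of ?r' ?r] by linarith
  note le
  also have "norm ?r' * norm h * norm ?r \<le> 2 * norm ?r * norm h * norm ?r"
    using le2 by (intro mult_right_mono) auto
  finally show "norm (?r' - ?r) \<le> 2 * (norm ?r)\<^sup>2 * norm h"
    by (simp add: power2_eq_square mult_ac)
qed

lemma ainv_perturb_radius:
  fixes u :: "'a::complex_banach_algebra"
  obtains d where "d > 0" "\<And>h::'a. norm h < d \<Longrightarrow> norm h * norm (ainv u) \<le> 1/2"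
proof
  have "norm (ainv u) + 1 > 0" by (rule add_nonneg_pos) auto
  then show "0 < 1 / (2 * (norm (ainv u) + 1))" by simp
  fix h :: 'a assume "norm h < 1 / (2 * (norm (ainv u) + 1))"
  then have "norm h * (norm (ainv u) + 1) \<le> 1/2"
    by (simp add: field_simps add_pos_nonneg)
  then show "norm h * norm (ainv u) \<le> 1/2"
    using norm_ge_zero[of h] unfolding distrib_left by linarith
qed

lemma open_ainvertible: "open {u :: 'a::complex_banach_algebra. ainvertible u}"
  unfolding open_dist
proof safe
  fix u :: 'a assume u: "ainvertible u"
  obtain d where d: "d > 0" "\<And>h::'a. norm h < d \<Longrightarrow> norm h * norm (ainv u) \<le> 1/2"
    using ainv_perturb_radius[of u] by blast
  have "ainvertible y" if "dist y u < d" for y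
    using ainv_perturb(1)[OF u d(2)[of "y - u"]] that by (simp add: dist_norm)
  with d(1) show "\<exists>e>0. \<forall>y. dist y u < e \<longrightarrow> y \<in> {u. ainvertible u}" by blast
qed

lemma has_derivative_ainv:
  fixes u :: "'a::complex_banach_algebra"
  assumes u: "ainvertible u"
  shows "(ainv has_derivative (\<lambda>h. - (ainv u * h * ainv u))) (at u)"
proof -
  obtain d where d: "d > 0" "\<And>h::'a. norm h < d \<Longrightarrow> norm h * norm (ainv u) \<le> 1/2"
    using ainv_perturb_radius[of u] by blast
  let ?r = "ainv u"
  show ?thesis
  proof (rule has_derivativeI_sandwich)
    show "0 < d" by fact
    show "bounded_linear (\<lambda>h. - (?r * h * ?r))"
      by (intro bounded_linear_minus bounded_linear_mult_const bounded_linear_const_mult bounded_linear_ident)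
    show "((\<lambda>y. 2 * norm ?r ^ 3 * norm (y - u)) \<longlongrightarrow> 0) (at u)"
    proof -
      have "((\<lambda>y. 2 * norm ?r ^ 3 * norm (y - u)) \<longlongrightarrow> 2 * norm ?r ^ 3 * norm (u - u)) (at u)"
        by (intro tendsto_intros)
      then show ?thesis by simp
    qed
    fix y assume y: "y \<noteq> u" "dist y u < d"
    define h where "h = y - u"
    have hd: "norm h * norm ?r \<le> 1/2" using y d(2) by (simp add: h_def dist_norm)
    note p = ainv_perturb[OF u hd]
    let ?e = "ainv y - ?r"
    have yuh: "u + h = y" by (simp add: h_def)
    \<comment> \<open>Inserting the difference identity leaves a remainder that contains both
      \<open>?e\<close> and \<open>h\<close>, each of first order.\<close>
    have "ainv y - ?r - - (?r * h * ?r) = - (?e * h * ?r)"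
      using p(3) unfolding yuh by (simp add: algebra_simps)
    then have "norm (ainv y - ?r - - (?r * h * ?r)) \<le> norm ?e * norm h * norm ?r"
      using norm_mult3_le[of ?e h ?r] by simp
    also have "\<dots> \<le> (2 * (norm ?r)\<^sup>2 * norm h) * norm h * norm ?r"
      using p(4) unfolding yuh by (intro mult_right_mono) auto
    also have "\<dots> = 2 * norm ?r ^ 3 * norm h * norm h"
      by (simp add: power2_eq_square power3_eq_cube mult_ac)
    finally show "norm (ainv y - ainv u - - (?r * (y - u) * ?r)) / norm (y - u) \<le> 2 * norm ?r ^ 3 * norm (y - u)"
      using y by (simp add: divide_le_eq h_def)
  qed
qed

subsection \<open>The resolvent of an algebra element\<close>

definition res :: "'a::complex_banach_algebra \<Rightarrow> complex \<Rightarrow> 'a" where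
  "res a z = ainv (z *\<^sub>C 1 - a)"

definition rho :: "'a::complex_banach_algebra \<Rightarrow> complex set" where
  "rho a = {z. ainvertible (z *\<^sub>C 1 - a)}"

lemma open_rho: "open (rho a)"
proof -
  have "open ((\<lambda>z. z *\<^sub>C 1 - a) -` {u. ainvertible u})"
    by (intro open_vimage open_ainvertible continuous_intros)
  then show ?thesis by (simp add: rho_def vimage_def)
qed

lemma norm_less_in_rho:
  assumes "norm a < cmod z" shows "z \<in> rho a"
proof -
  have z: "z \<noteq> 0" using assms by auto
  have "ainvertible (1 + (- 1 / z) *\<^sub>C a)"
    using assms z by (intro ainvertible_one_plus) (simp add: norm_scaleC norm_divide field_simps)
  moreover have "ainvertible (z *\<^sub>C (1::'a))"
    using z by (intro ainvertibleI[of _ "(1/z) *\<^sub>C 1" "(1/z) *\<^sub>C 1"]) (simp_all add: scaleC_mult_left scaleC_scaleC)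
  ultimately have "ainvertible (z *\<^sub>C 1 * (1 + (- 1 / z) *\<^sub>C a))" by (rule ainvertible_mult[rotated])
  then show ?thesis
    using z by (simp add: rho_def scaleC_mult_left scaleC_add_right scaleC_scaleC scaleC.minus_left scaleC.diff_right)
qed

lemma res_mult:
  assumes "z \<in> rho a" shows "a * res a z = z *\<^sub>C res a z - 1" "res a z * a = z *\<^sub>C res a z - 1"
  using ainv[of "z *\<^sub>C 1 - a"] assms
  by (simp_all add: rho_def res_def left_diff_distrib right_diff_distrib scaleC_mult_left scaleC_mult_right algebra_simps)

lemma has_derivative_res:
  assumes "z \<in> rho a"
  shows "(res a has_derivative (\<lambda>w. w *\<^sub>C (- (res a z * res a z)))) (at z)"
proof -
  have "((\<lambda>z. z *\<^sub>C (1::'a) - a) has_derivative (\<lambda>w. w *\<^sub>C 1)) (at z)"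
    by (auto intro!: derivative_eq_intros scaleC.bounded_linear_left[THEN bounded_linear_imp_has_derivative])
  from has_derivative_compose[OF this has_derivative_ainv]
  show ?thesis using assms unfolding res_def[abs_def] rho_def
    by (simp add: scaleC_mult_left scaleC_mult_right scaleC.minus_right)
qed

lemma continuous_on_res: "continuous_on (rho a) (res a)"
  using has_derivative_res has_derivative_continuous has_derivative_at_withinI
  by (fastforce simp: continuous_on_eq_continuous_within)

lemma res_commute:
  assumes "z \<in> rho a" "a * b = b * a" shows "res a z * b = b * res a z"
  unfolding res_def using assms
  by (intro ainv_commute) (simp_all add: rho_def algebra_simps scaleC_mult_left scaleC_mult_right)

subsection \<open>Cutoff functions and the Cauchy--Pompeiu formula\<close>

definition plane_integral :: "(complex \<Rightarrow> 'b::banach) \<Rightarrow> 'b" where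
  "plane_integral f = integral UNIV (\<lambda>p :: real \<times> real. f (Complex (fst p) (snd p)))"

text \<open>Supports are confined to squares instead of discs because area integrals then are
  iterated integrals over fixed intervals, with the function vanishing at both endpoints.\<close>

definition vanishes_off_square :: "real \<Rightarrow> (complex \<Rightarrow> 'b::zero) \<Rightarrow> bool" where
  "vanishes_off_square L f \<longleftrightarrow> 0 < L \<and> (\<forall>z. L \<le> \<bar>Re z\<bar> \<or> L \<le> \<bar>Im z\<bar> \<longrightarrow> f z = 0)"

abbreviation square :: "real \<Rightarrow> (real \<times> real) set" where
  "square L \<equiv> cbox (- L, - L) (L, L)"

lemma continuous_on_Complex_pair:
  assumes "continuous_on UNIV f"
  shows "continuous_on S (\<lambda>p :: real \<times> real. f (Complex (fst p) (snd p)))"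
  by (rule continuous_on_compose2[OF assms]) (auto simp: Complex_eq intro!: continuous_intros)

lemma plane_integral_square:
  assumes "vanishes_off_square L f"
  shows "plane_integral f = integral (square L) (\<lambda>p. f (Complex (fst p) (snd p)))"
proof -
  have *: "(if p \<in> square L then f (Complex (fst p) (snd p)) else 0) = f (Complex (fst p) (snd p))" for p
    using assms by (cases p) (auto simp: vanishes_off_square_def cbox_Pair_eq abs_if; smt (verit))
  show ?thesis
    unfolding plane_integral_def
    using integral_restrict_UNIV[of "square L" "\<lambda>p. f (Complex (fst p) (snd p))"] unfolding * .
qed

lemma square_integrable:
  fixes f :: "complex \<Rightarrow> 'b::banach"
  assumes "continuous_on UNIV f"
  shows "(\<lambda>p. f (Complex (fst p) (snd p))) integrable_on square L"
  by (rule integrable_continuous) (rule continuous_on_Complex_pair[OF assms])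

lemma vanishes_off_square_mono:
  "vanishes_off_square L f \<Longrightarrow> L \<le> L' \<Longrightarrow> vanishes_off_square L' f"
  by (auto simp: vanishes_off_square_def)

lemma plane_integral_diff:
  fixes f g :: "complex \<Rightarrow> 'b::banach"
  assumes "continuous_on UNIV f" "vanishes_off_square L f" "continuous_on UNIV g" "vanishes_off_square L' g"
  shows "plane_integral (\<lambda>z. f z - g z) = plane_integral f - plane_integral g"
proof -
  define K where "K = max L L'"
  have f: "vanishes_off_square K f" and g: "vanishes_off_square K g"
    using assms(2,4) by (auto simp: K_def intro: vanishes_off_square_mono)
  then have "vanishes_off_square K (\<lambda>z. f z - g z)" by (simp add: vanishes_off_square_def)
  with f g show ?thesis
    by (simp add: plane_integral_square integral_diff square_integrable assms)
qed

lemma plane_integral_bounded_linear: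
  fixes f :: "complex \<Rightarrow> 'b::banach" and h :: "'b \<Rightarrow> 'c::banach"
  assumes "continuous_on UNIV f" "vanishes_off_square L f" "bounded_linear h"
  shows "plane_integral (\<lambda>z. h (f z)) = h (plane_integral f)"
proof -
  interpret h: bounded_linear h by fact
  have "vanishes_off_square L (\<lambda>z. h (f z))" using assms by (simp add: vanishes_off_square_def h.zero)
  then show ?thesis
    using integral_linear[OF square_integrable[OF assms(1)] assms(3)] assms(2)
    by (simp add: plane_integral_square o_def)
qed

lemma norm_plane_integral_le:
  fixes f :: "complex \<Rightarrow> 'b::banach"
  assumes "continuous_on UNIV f" "vanishes_off_square L f" "\<And>z. norm (f z) \<le> B"
  shows "norm (plane_integral f) \<le> B * (2 * L)\<^sup>2"
proof -
  have L: "L > 0" using assms by (simp add: vanishes_off_square_def)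
  have "B \<ge> 0" using assms(3)[of 0] norm_ge_zero order_trans by blast
  then have "norm (integral (square L) (\<lambda>p. f (Complex (fst p) (snd p)))) \<le> B * measure lborel (square L)"
    using assms(3) by (intro has_integral_bound[OF _ integrable_integral[OF square_integrable[OF assms(1)]]])
  also have "measure lborel (square L) = (2 * L)\<^sup>2"
    using L by (simp add: content_Pair power2_eq_square)
  finally show ?thesis using assms(2) by (simp add: plane_integral_square)
qed

text \<open>By Fubini one may integrate first along the direction of differentiation, where the
  fundamental theorem leaves only endpoint values, which are 0.\<close>

lemma plane_integral_derivative:
  fixes f :: "complex \<Rightarrow> 'b::banach"
  assumes der: "\<And>z. (f has_derivative f' z) (at z)"
    and cont: "continuous_on UNIV (\<lambda>z. f' z 1)" "continuous_on UNIV (\<lambda>z. f' z \<i>)"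
    and van: "vanishes_off_square L f"
  shows "plane_integral (\<lambda>z. f' z 1) = 0" and "plane_integral (\<lambda>z. f' z \<i>) = 0"
    and "vanishes_off_square (L + 1) (\<lambda>z. f' z w)"
proof -
  have L: "L > 0" using van by (simp add: vanishes_off_square_def)
  \<comment> \<open>Vanishing of \<open>f\<close> yields vanishing of the derivative only on the
    open exterior of the square; the enlargement to L + 1 avoids the boundary.\<close>
  have f'0: "f' z w = 0" if "L < \<bar>Re z\<bar> \<or> L < \<bar>Im z\<bar>" for z w
  proof -
    let ?S = "{z. L < \<bar>Re z\<bar>} \<union> {z. L < \<bar>Im z\<bar>}"
    have "open ?S" by (intro open_Un open_Collect_less continuous_intros)
    moreover have "z \<in> ?S" using that by simp
    moreover have "f x = 0" if "x \<in> ?S" for x using van that by (auto simp: vanishes_off_square_def)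
    ultimately have "((\<lambda>_. 0) has_derivative f' z) (at z)"
      by (intro has_derivative_transform_within_open[OF der[of z], of ?S])
    from has_derivative_unique[OF this has_derivative_const] show ?thesis by simp
  qed
  have van': "vanishes_off_square (L + 1) (\<lambda>z. f' z w)" for w
    using L by (auto simp: vanishes_off_square_def intro!: f'0)
  then show "vanishes_off_square (L + 1) (\<lambda>z. f' z w)" .
  let ?L = "L + 1"
  have dx: "((\<lambda>x. f (Complex x y)) has_vector_derivative f' (Complex x y) 1) (at x within S)" for x y S
  proof -
    have "((\<lambda>x. of_real x + \<i> * of_real y) has_derivative (\<lambda>x. of_real x)) (at x within S)"
      by (auto intro!: derivative_eq_intros)
    from has_derivative_compose[OF this der]
    have "((\<lambda>x. f (Complex x y)) has_derivative (\<lambda>h. f' (Complex x y) (of_real h))) (at x within S)"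
      by (simp add: Complex_eq)
    moreover have "f' (Complex x y) (of_real h) = h *\<^sub>R f' (Complex x y) 1" for h
      using linear_scale[OF has_derivative_linear[OF der], of "Complex x y" h 1] by (simp add: scaleR_conv_of_real)
    ultimately show ?thesis by (simp add: has_vector_derivative_def)
  qed
  have dy: "((\<lambda>y. f (Complex x y)) has_vector_derivative f' (Complex x y) \<i>) (at y within S)" for x y S
  proof -
    have "((\<lambda>y. of_real x + \<i> * of_real y) has_derivative (\<lambda>y. \<i> * of_real y)) (at y within S)"
      by (auto intro!: derivative_eq_intros)
    from has_derivative_compose[OF this der]
    have "((\<lambda>y. f (Complex x y)) has_derivative (\<lambda>h. f' (Complex x y) (\<i> * of_real h))) (at y within S)"
      by (simp add: Complex_eq)
    moreover have "f' (Complex x y) (\<i> * of_real h) = h *\<^sub>R f' (Complex x y) \<i>" for h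
      using linear_scale[OF has_derivative_linear[OF der], of "Complex x y" h \<i>]
      by (simp add: scaleR_conv_of_real mult.commute)
    ultimately show ?thesis by (simp add: has_vector_derivative_def)
  qed
  have ix: "integral {-?L..?L} (\<lambda>x. f' (Complex x y) 1) = 0" for y
    using fundamental_theorem_of_calculus[OF _ dx, of "-?L" ?L y] L van
    by (auto simp: vanishes_off_square_def dest!: integral_unique)
  have iy: "integral {-?L..?L} (\<lambda>y. f' (Complex x y) \<i>) = 0" for x
    using fundamental_theorem_of_calculus[OF _ dy, of "-?L" ?L x] L van
    by (auto simp: vanishes_off_square_def dest!: integral_unique)
  have "plane_integral (\<lambda>z. f' z 1) = integral (cbox (-?L) ?L) (\<lambda>x. integral (cbox (-?L) ?L) (\<lambda>y. f' (Complex x y) 1))"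
    using integral_prod_continuous[OF continuous_on_Complex_pair[OF cont(1)]]
    by (simp add: plane_integral_square[OF van'])
  also have "\<dots> = integral (cbox (-?L) ?L) (\<lambda>y. integral (cbox (-?L) ?L) (\<lambda>x. f' (Complex x y) 1))"
    using integral_swap_continuous[of "-?L" "-?L" ?L ?L "\<lambda>x y. f' (Complex x y) 1"]
      continuous_on_Complex_pair[OF cont(1)] by (simp add: case_prod_unfold)
  finally show "plane_integral (\<lambda>z. f' z 1) = 0" using ix by simp
  have "plane_integral (\<lambda>z. f' z \<i>) = integral (cbox (-?L) ?L) (\<lambda>x. integral (cbox (-?L) ?L) (\<lambda>y. f' (Complex x y) \<i>))"
    using integral_prod_continuous[OF continuous_on_Complex_pair[OF cont(2)]]
    by (simp add: plane_integral_square[OF van'])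
  then show "plane_integral (\<lambda>z. f' z \<i>) = 0" using iy by simp
qed

text \<open>\<open>\<phi>\<close> is twice the derivative of \<open>\<eta>\<close> with respect to the complex conjugate of \<open>z\<close>.\<close>

definition cutoff :: "(complex \<Rightarrow> real) \<Rightarrow> (complex \<Rightarrow> complex) \<Rightarrow> bool" where
  "cutoff \<eta> \<phi> \<longleftrightarrow> (\<exists>\<eta>' L. (\<forall>z. (\<eta> has_derivative \<eta>' z) (at z)) \<and>
     continuous_on UNIV (\<lambda>z. \<eta>' z 1) \<and> continuous_on UNIV (\<lambda>z. \<eta>' z \<i>) \<and>
     vanishes_off_square L \<eta> \<and> \<phi> = (\<lambda>z. Complex (\<eta>' z 1) (\<eta>' z \<i>)))"

lemma continuous_on_Complex [continuous_intros]:
  "continuous_on S f \<Longrightarrow> continuous_on S g \<Longrightarrow> continuous_on S (\<lambda>x. Complex (f x) (g x))"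
  by (auto simp: Complex_eq intro!: continuous_intros)

lemma cutoff_continuous: "cutoff \<eta> \<phi> \<Longrightarrow> continuous_on UNIV \<phi>"
  by (auto simp: cutoff_def intro!: continuous_intros)

lemma cutoff_vanishes:
  assumes "cutoff \<eta> \<phi>" obtains L where "vanishes_off_square L \<phi>"
proof -
  obtain \<eta>' L where *: "\<And>z. (\<eta> has_derivative \<eta>' z) (at z)" "continuous_on UNIV (\<lambda>z. \<eta>' z 1)"
    "continuous_on UNIV (\<lambda>z. \<eta>' z \<i>)" "vanishes_off_square L \<eta>" "\<phi> = (\<lambda>z. Complex (\<eta>' z 1) (\<eta>' z \<i>))"
    using assms unfolding cutoff_def by blast
  have "vanishes_off_square (L + 1) \<phi>"
    using plane_integral_derivative(3)[OF *(1-4)] unfolding *(5) vanishes_off_square_def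
    by (auto simp: Complex_eq_0)
  then show ?thesis by (rule that)
qed

lemma has_derivative_locally_const:
  assumes "(f has_derivative f') (at z)" "open S" "z \<in> S" "\<And>x. x \<in> S \<Longrightarrow> f x = c"
  shows "f' = (\<lambda>_. 0)"
proof -
  have "((\<lambda>_. c) has_derivative f') (at z)"
    by (rule has_derivative_transform_within_open[OF assms(1-3)]) (use assms(4) in auto)
  from has_derivative_unique[OF this has_derivative_const] show ?thesis .
qed

lemma cutoff_locally_const:
  assumes "cutoff \<eta> \<phi>" "open S" "\<And>z. z \<in> S \<Longrightarrow> \<eta> z = c" "z \<in> S"
  shows "\<phi> z = 0"
proof -
  obtain \<eta>' where *: "(\<eta> has_derivative \<eta>' z) (at z)" "\<phi> = (\<lambda>z. Complex (\<eta>' z 1) (\<eta>' z \<i>))"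
    using assms(1) unfolding cutoff_def by blast
  have "\<eta>' z = (\<lambda>_. 0)" by (rule has_derivative_locally_const[OF *(1) assms(2,4,3)])
  then show ?thesis by (simp add: *(2) Complex_eq_0)
qed

lemma cutoff_diff:
  assumes "cutoff \<eta>\<^sub>1 \<phi>\<^sub>1" "cutoff \<eta>\<^sub>2 \<phi>\<^sub>2"
  shows "cutoff (\<lambda>z. \<eta>\<^sub>1 z - \<eta>\<^sub>2 z) (\<lambda>z. \<phi>\<^sub>1 z - \<phi>\<^sub>2 z)"
proof -
  obtain \<eta>' L where 1: "\<And>z. (\<eta>\<^sub>1 has_derivative \<eta>' z) (at z)" "continuous_on UNIV (\<lambda>z. \<eta>' z 1)"
    "continuous_on UNIV (\<lambda>z. \<eta>' z \<i>)" "vanishes_off_square L \<eta>\<^sub>1" "\<phi>\<^sub>1 = (\<lambda>z. Complex (\<eta>' z 1) (\<eta>' z \<i>))"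
    using assms(1) unfolding cutoff_def by blast
  obtain \<psi>' K where 2: "\<And>z. (\<eta>\<^sub>2 has_derivative \<psi>' z) (at z)" "continuous_on UNIV (\<lambda>z. \<psi>' z 1)"
    "continuous_on UNIV (\<lambda>z. \<psi>' z \<i>)" "vanishes_off_square K \<eta>\<^sub>2" "\<phi>\<^sub>2 = (\<lambda>z. Complex (\<psi>' z 1) (\<psi>' z \<i>))"
    using assms(2) unfolding cutoff_def by blast
  show ?thesis
    unfolding cutoff_def
  proof (intro exI[of _ "\<lambda>z w. \<eta>' z w - \<psi>' z w"] exI[of _ "max L K"] conjI allI)
    show "vanishes_off_square (max L K) (\<lambda>z. \<eta>\<^sub>1 z - \<eta>\<^sub>2 z)"
      using 1(4) 2(4) by (auto simp: vanishes_off_square_def)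
  qed (auto intro!: continuous_intros has_derivative_diff 1(1-3) 2(1-3) simp: 1(5) 2(5) fun_eq_iff complex_eq_iff)
qed

text \<open>Meant for resolvents, which have unspecified values on the spectrum:
  \<open>\<phi>\<close> vanishes on an open set containing it, so the product is continuous
  everywhere.\<close>

lemma continuous_on_cutoff_scaleC:
  fixes F :: "complex \<Rightarrow> 'b::complex_banach"
  assumes "open \<Omega>" "open \<Omega>'" "\<Omega> \<union> \<Omega>' = UNIV" "continuous_on UNIV \<phi>" "\<And>z. z \<in> \<Omega>' \<Longrightarrow> \<phi> z = 0"
    "continuous_on \<Omega> F"
  shows "continuous_on UNIV (\<lambda>z. \<phi> z *\<^sub>C F z)"
proof -
  have "continuous_on (\<Omega> \<union> \<Omega>') (\<lambda>z. \<phi> z *\<^sub>C F z)"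
  proof (rule continuous_on_open_Un[OF assms(1,2)])
    show "continuous_on \<Omega> (\<lambda>z. \<phi> z *\<^sub>C F z)"
      by (intro continuous_intros assms continuous_on_subset[OF assms(4)]) auto
    show "continuous_on \<Omega>' (\<lambda>z. \<phi> z *\<^sub>C F z)"
      by (subst continuous_on_cong[OF refl, of _ _ "\<lambda>_. 0"]) (auto simp: assms(5))
  qed
  then show ?thesis by (simp only: assms(3))
qed

text \<open>Since \<open>F\<close> is holomorphic, \<open>\<phi> F\<close> is the d/dx + i d/dy
  derivative of \<open>\<eta> F\<close>, which is continuously differentiable with compact support;
  such derivatives integrate to 0. Cauchy's theorem thus takes the form of a freedom to change
  \<eta> where \<open>F\<close> is holomorphic.\<close>

lemma plane_integral_cutoff_holomorphic:
  fixes F :: "complex \<Rightarrow> 'b::complex_banach"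
  assumes \<eta>: "cutoff \<eta> \<phi>"
    and \<Omega>: "open \<Omega>" "open \<Omega>'" "\<Omega> \<union> \<Omega>' = UNIV"
    and \<eta>0: "\<And>z. z \<in> \<Omega>' \<Longrightarrow> \<eta> z = 0"
    and F: "\<And>z. z \<in> \<Omega> \<Longrightarrow> (F has_derivative (\<lambda>w. w *\<^sub>C F' z)) (at z)" "continuous_on \<Omega> F'"
  shows "plane_integral (\<lambda>z. \<phi> z *\<^sub>C F z) = 0"
proof -
  obtain \<eta>' L where *: "\<And>z. (\<eta> has_derivative \<eta>' z) (at z)" "continuous_on UNIV (\<lambda>z. \<eta>' z 1)"
    "continuous_on UNIV (\<lambda>z. \<eta>' z \<i>)" "vanishes_off_square L \<eta>" "\<phi> = (\<lambda>z. Complex (\<eta>' z 1) (\<eta>' z \<i>))"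
    using assms unfolding cutoff_def by blast
  have cF: "continuous_on \<Omega> F"
    using F(1) has_derivative_continuous has_derivative_at_withinI
    by (fastforce simp: continuous_on_eq_continuous_within)
  have c\<eta>: "continuous_on UNIV \<eta>"
    using *(1) has_derivative_continuous has_derivative_at_withinI
    by (fastforce simp: continuous_on_eq_continuous_within)
  have \<eta>'0: "\<eta>' z w = 0" if "z \<in> \<Omega>'" for z w
    using has_derivative_locally_const[OF *(1) \<Omega>(2) that \<eta>0] by simp
  define f where "f z = complex_of_real (\<eta> z) *\<^sub>C F z" for z
  define f' where "f' z w = complex_of_real (\<eta>' z w) *\<^sub>C F z + complex_of_real (\<eta> z) *\<^sub>C (w *\<^sub>C F' z)" for z w
  have der: "(f has_derivative f' z) (at z)" for z
  proof (cases "z \<in> \<Omega>")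
    case True
    have "((\<lambda>z. complex_of_real (\<eta> z)) has_derivative (\<lambda>w. complex_of_real (\<eta>' z w))) (at z)"
      by (intro has_derivative_of_real *)
    from scaleC.FDERIV[OF this F(1)[OF True]] show ?thesis
      unfolding f_def f'_def by (simp add: add.commute)
  next
    case False
    then have z: "z \<in> \<Omega>'" using \<Omega> by blast
    have "(f has_derivative (\<lambda>_. 0)) (at z)"
      by (rule has_derivative_transform_within_open[OF has_derivative_const[of 0] \<Omega>(2) z]) (simp add: f_def \<eta>0)
    moreover have "f' z = (\<lambda>_. 0)" by (simp add: f'_def \<eta>0 \<eta>'0 z fun_eq_iff)
    ultimately show ?thesis by simp
  qed
  have cont: "continuous_on UNIV (\<lambda>z. f' z w)" if "continuous_on UNIV (\<lambda>z. \<eta>' z w)" for w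
    unfolding f'_def
    by (intro continuous_on_add continuous_on_cutoff_scaleC[OF \<Omega>] continuous_intros that c\<eta> cF F(2)) (simp_all add: \<eta>0 \<eta>'0)
  have van: "vanishes_off_square L f" using *(4) by (auto simp: f_def vanishes_off_square_def)
  note d = plane_integral_derivative[OF der cont[OF *(2)] cont[OF *(3)] van]
  \<comment> \<open>The derivative of \<open>F\<close> drops out, as it contributes F' + i i F' =
    0.\<close>
  have "\<phi> z *\<^sub>C F z = f' z 1 - (- \<i>) *\<^sub>C f' z \<i>" for z
  proof -
    have "f' z 1 - (- \<i>) *\<^sub>C f' z \<i> = (complex_of_real (\<eta>' z 1) + \<i> * complex_of_real (\<eta>' z \<i>)) *\<^sub>C F z"
      by (simp add: f'_def scaleC.add_right scaleC.add_left scaleC.minus_left scaleC_scaleC algebra_simps)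
    then show ?thesis by (simp add: *(5) Complex_eq)
  qed
  then have "plane_integral (\<lambda>z. \<phi> z *\<^sub>C F z) = plane_integral (\<lambda>z. f' z 1 - (- \<i>) *\<^sub>C f' z \<i>)"
    by simp
  also have "\<dots> = plane_integral (\<lambda>z. f' z 1) - plane_integral (\<lambda>z. (- \<i>) *\<^sub>C f' z \<i>)"
  proof (rule plane_integral_diff[of _ "L + 1" _ "L + 1"])
    show "continuous_on UNIV (\<lambda>z. (- \<i>) *\<^sub>C f' z \<i>)"
      by (intro scaleC.continuous_on continuous_on_const cont *)
    show "vanishes_off_square (L + 1) (\<lambda>z. (- \<i>) *\<^sub>C f' z \<i>)"
      using d(3)[of \<i>] by (simp add: vanishes_off_square_def)
  qed (intro cont * d)+
  also have "plane_integral (\<lambda>z. (- \<i>) *\<^sub>C f' z \<i>) = (- \<i>) *\<^sub>C plane_integral (\<lambda>z. f' z \<i>)"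
    by (intro plane_integral_bounded_linear[OF cont[OF *(3)] d(3)] scaleC.bounded_linear_right)
  finally show ?thesis by (simp add: d(1,2))
qed

section \<open>Explicit continuously differentiable cutoffs\<close>

lemma DERIV_pos_part_square: "((\<lambda>u::real. (max 0 u)\<^sup>2) has_real_derivative 2 * max 0 u) (at u)"
proof (cases u "0::real" rule: linorder_cases)
  case less
  have "((\<lambda>u::real. 0) has_real_derivative 0) (at u)" by simp
  then have "((\<lambda>u::real. (max 0 u)\<^sup>2) has_real_derivative 0) (at u)"
    by (rule has_field_derivative_transform_within_open[of _ _ _ "{..<0}"]) (use less in auto)
  then show ?thesis using less by simp
next
  case greater
  have "((\<lambda>u::real. u\<^sup>2) has_real_derivative 2 * u) (at u)" by (auto intro!: derivative_eq_intros)
  then have "((\<lambda>u::real. (max 0 u)\<^sup>2) has_real_derivative 2 * u) (at u)"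
    by (rule has_field_derivative_transform_within_open[of _ _ _ "{0<..}"]) (use greater in auto)
  then show ?thesis using greater by simp
next
  case equal
  have "((\<lambda>h::real. (max 0 h)\<^sup>2 / h) \<longlongrightarrow> 0) (at 0)"
  proof (rule Lim_null_comparison)
    show "\<forall>\<^sub>F h in at 0. norm ((max 0 h)\<^sup>2 / h) \<le> \<bar>h::real\<bar>"
      by (intro always_eventually allI) (auto simp: max_def power2_eq_square)
  qed (rule tendsto_rabs_zero, rule tendsto_ident_at)
  then show ?thesis using equal by (simp add: DERIV_def)
qed

text \<open>The inner squares are bumps of radius \<open>r\<close> around the points of
  \<open>W\<close>; the outer expression sends a bump sum 0 to 0 and every sum of at least
  \<open>c\<close> to 1. Both layers use the squared positive part, which is continuously
  differentiable.\<close>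

definition plateau :: "complex set \<Rightarrow> real \<Rightarrow> real \<Rightarrow> complex \<Rightarrow> real" where
  "plateau W r c z = 1 - (max 0 (1 - (\<Sum>w\<in>W. (max 0 (r\<^sup>2 - (cmod (z - w))\<^sup>2))\<^sup>2) / c))\<^sup>2"

text \<open>The gradient of \<open>plateau\<close>, read as a complex number: the bump at
  \<open>w\<close> has gradient -4 max(0, r^2 - |z - w|^2) (z - w).\<close>

definition dbar_plateau :: "complex set \<Rightarrow> real \<Rightarrow> real \<Rightarrow> complex \<Rightarrow> complex" where
  "dbar_plateau W r c z =
     - of_real (2 * max 0 (1 - (\<Sum>w\<in>W. (max 0 (r\<^sup>2 - (cmod (z - w))\<^sup>2))\<^sup>2) / c) / c) *
       (\<Sum>w\<in>W. of_real (4 * max 0 (r\<^sup>2 - (cmod (z - w))\<^sup>2)) * (z - w))"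

lemma plateau_eq_0:
  assumes "\<And>w. w \<in> W \<Longrightarrow> r \<le> cmod (z - w)" "r > 0"
  shows "plateau W r c z = 0"
proof -
  have "max 0 (r\<^sup>2 - (cmod (z - w))\<^sup>2) = 0" if "w \<in> W" for w
    using assms(1)[OF that] assms(2) by (simp add: max_def power_mono)
  then show ?thesis by (simp add: plateau_def)
qed

lemma plateau_eq_1:
  assumes "finite W" "w \<in> W" "c > 0" "c \<le> (max 0 (r\<^sup>2 - (cmod (z - w))\<^sup>2))\<^sup>2"
  shows "plateau W r c z = 1"
proof -
  have "c \<le> (\<Sum>w\<in>W. (max 0 (r\<^sup>2 - (cmod (z - w))\<^sup>2))\<^sup>2)"
    using assms by (intro order_trans[OF assms(4)] member_le_sum) auto
  then show ?thesis using assms(3) by (simp add: plateau_def max_def)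
qed

lemma cutoff_plateau:
  assumes W: "finite W" and "r > 0" "c > 0"
  shows "cutoff (plateau W r c) (dbar_plateau W r c)"
proof -
  define s where "s z = (\<Sum>w\<in>W. (max 0 (r\<^sup>2 - (cmod (z - w))\<^sup>2))\<^sup>2)" for z
  define s' where "s' z h = (\<Sum>w\<in>W. 2 * max 0 (r\<^sup>2 - (cmod (z - w))\<^sup>2) * (- (2 * ((z - w) \<bullet> h))))" for z h
  define \<eta>' where "\<eta>' z h = (2 * max 0 (1 - s z / c) / c) * s' z h" for z h
  note chain = DERIV_pos_part_square[THEN has_field_derivative_imp_has_derivative, THEN has_derivative_compose[rotated]]
  have "((\<lambda>z. r\<^sup>2 - (cmod (z - w))\<^sup>2) has_derivative (\<lambda>h. - (2 * ((z - w) \<bullet> h)))) (at z)" for w z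
    unfolding power2_norm_eq_inner by (auto intro!: derivative_eq_intros simp: inner_commute)
  from chain[OF this] have "((\<lambda>z. (max 0 (r\<^sup>2 - (cmod (z - w))\<^sup>2))\<^sup>2) has_derivative
      (\<lambda>h. 2 * max 0 (r\<^sup>2 - (cmod (z - w))\<^sup>2) * (- (2 * ((z - w) \<bullet> h))))) (at z)" for w z
    by simp
  then have s: "(s has_derivative s' z) (at z)" for z
    unfolding s_def[abs_def] s'_def[abs_def] by (intro has_derivative_sum)
  then have "((\<lambda>z. 1 - s z / c) has_derivative (\<lambda>h. - (s' z h / c))) (at z)" for z
    using assms by (auto intro!: derivative_eq_intros)
  from chain[OF this] have "((\<lambda>z. (max 0 (1 - s z / c))\<^sup>2) has_derivative (\<lambda>h. 2 * max 0 (1 - s z / c) * (- (s' z h / c)))) (at z)" for z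
    by simp
  from has_derivative_diff[OF has_derivative_const[of 1] this]
  have der: "(plateau W r c has_derivative \<eta>' z) (at z)" for z
    unfolding plateau_def[abs_def] \<eta>'_def[abs_def] s_def by simp
  have cs: "continuous_on UNIV s" "continuous_on UNIV (\<lambda>z. s' z h)" for h
    unfolding s_def s'_def by (auto intro!: continuous_intros)
  have cont: "continuous_on UNIV (\<lambda>z. \<eta>' z h)" for h
    unfolding \<eta>'_def using assms cs by (auto intro!: continuous_intros)
  obtain R where R: "\<And>w. w \<in> W \<Longrightarrow> cmod w \<le> R"
    using finite_imp_bounded[OF W] bounded_iff by metis
  have "vanishes_off_square (r + \<bar>R\<bar>) (plateau W r c)"
    unfolding vanishes_off_square_def
  proof (intro conjI allI impI)
    fix z assume z: "r + \<bar>R\<bar> \<le> \<bar>Re z\<bar> \<or> r + \<bar>R\<bar> \<le> \<bar>Im z\<bar>"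
    show "plateau W r c z = 0"
    proof (rule plateau_eq_0)
      fix w assume "w \<in> W"
      then show "r \<le> cmod (z - w)"
        using R[of w] z norm_triangle_ineq2[of z w] abs_Re_le_cmod[of z] abs_Im_le_cmod[of z] by linarith
    qed fact
  qed (use assms in auto)
  moreover have "dbar_plateau W r c z = Complex (\<eta>' z 1) (\<eta>' z \<i>)" for z
    by (simp add: complex_eq_iff dbar_plateau_def \<eta>'_def s'_def s_def inner_complex_def sum_distrib_left sum_negf algebra_simps)
  ultimately show ?thesis unfolding cutoff_def using der cont by (intro exI[of _ \<eta>'] exI[of _ "r + \<bar>R\<bar>"]) auto
qed

lemma cutoff_separating:
  assumes K: "compact K" and F: "closed F" and disj: "K \<inter> F = {}"
  obtains \<eta> \<phi> S T where "cutoff \<eta> \<phi>" "open S" "K \<subseteq> S" "\<And>z. z \<in> S \<Longrightarrow> \<eta> z = 1"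
    "open T" "F \<subseteq> T" "\<And>z. z \<in> T \<Longrightarrow> \<eta> z = 0"
proof -
  obtain d where d: "d > 0" "\<And>x y. x \<in> K \<Longrightarrow> y \<in> F \<Longrightarrow> d \<le> dist x y"
    using separate_compact_closed[OF K F disj] by blast
  \<comment> \<open>As r < d, closed discs of radius \<open>r\<close> around points of
    \<open>K\<close> still miss \<open>F\<close>; discs of half that radius will cover
    \<open>K\<close>.\<close>
  define r where "r = d / 2"
  have r: "r > 0" "r < d" using d by (auto simp: r_def)
  have "K \<subseteq> (\<Union>w\<in>K. ball w (r / 2))" using r by force
  then obtain W where W: "W \<subseteq> K" "finite W" "K \<subseteq> (\<Union>w\<in>W. ball w (r / 2))"
    using compactE_image[OF K, of K "\<lambda>w. ball w (r / 2)"] by blast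
  \<comment> \<open>A single bump has the value (r^2 - r^2/4)^2 at distance r/2 from its centre, so
    \<open>plateau\<close> has reached 1 on the covering discs.\<close>
  define c where "c = (r\<^sup>2 * 3 / 4)\<^sup>2"
  have c: "c > 0" using r by (simp add: c_def)
  show ?thesis
  proof (rule that[OF cutoff_plateau[OF W(2) r(1) c]])
    show "K \<subseteq> (\<Union>w\<in>W. ball w (r / 2))" by fact
    show "plateau W r c z = 1" if "z \<in> (\<Union>w\<in>W. ball w (r / 2))" for z
    proof -
      from that obtain w where w: "w \<in> W" "cmod (z - w) < r / 2" by (auto simp: dist_norm norm_minus_commute)
      then have "(cmod (z - w))\<^sup>2 \<le> (r / 2)\<^sup>2" by (intro power_mono) auto
      then have "r\<^sup>2 * 3 / 4 \<le> r\<^sup>2 - (cmod (z - w))\<^sup>2" by (simp add: power_divide)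
      then have "c \<le> (max 0 (r\<^sup>2 - (cmod (z - w))\<^sup>2))\<^sup>2" unfolding c_def by (intro power_mono order_trans[OF _ max.cobounded2]) auto
      with w show ?thesis by (intro plateau_eq_1[OF W(2) _ c]) auto
    qed
    show "open (- (\<Union>w\<in>W. cball w r))" using W(2) by (intro open_Compl closed_UN) auto
    show "F \<subseteq> - (\<Union>w\<in>W. cball w r)" using W(1) d(2) r(2) by fastforce
    show "plateau W r c z = 0" if "z \<in> - (\<Union>w\<in>W. cball w r)" for z
      using that r by (intro plateau_eq_0) (force simp: dist_norm norm_minus_commute)+
  qed auto
qed

subsection \<open>Differences of commuting elements with disjoint spectra\<close>

text \<open>The constant 9 \<rho>^4 is the value at radius \<rho> of the bump of radius 2 \<rho>, so
  the transition takes place in the annulus between \<rho> and 2 \<rho>. The decay of the gradient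
  like 1/\<rho> helps to beat the growing area as \<rho> tends to infinity.\<close>

lemma plateau_radial:
  assumes "\<rho> > 0"
  shows "cutoff (plateau {0} (2 * \<rho>) (9 * \<rho> ^ 4)) (dbar_plateau {0} (2 * \<rho>) (9 * \<rho> ^ 4))"
    and "cmod z \<le> \<rho> \<Longrightarrow> plateau {0} (2 * \<rho>) (9 * \<rho> ^ 4) z = 1"
    and "cmod z < \<rho> \<Longrightarrow> dbar_plateau {0} (2 * \<rho>) (9 * \<rho> ^ 4) z = 0"
    and "2 * \<rho> \<le> cmod z \<Longrightarrow> dbar_plateau {0} (2 * \<rho>) (9 * \<rho> ^ 4) z = 0"
    and "cmod (dbar_plateau {0} (2 * \<rho>) (9 * \<rho> ^ 4) z) \<le> 8 / \<rho>"
proof -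
  let ?\<eta> = "plateau {0} (2 * \<rho>) (9 * \<rho> ^ 4)" and ?\<phi> = "dbar_plateau {0} (2 * \<rho>) (9 * \<rho> ^ 4)"
  show cut: "cutoff ?\<eta> ?\<phi>" using assms by (intro cutoff_plateau) auto
  show one: "?\<eta> z = 1" if "cmod z \<le> \<rho>" for z
  proof (rule plateau_eq_1[of _ 0])
    have "(cmod z)\<^sup>2 \<le> \<rho>\<^sup>2" using that by (intro power_mono) auto
    then have "(3 * \<rho>\<^sup>2)\<^sup>2 \<le> (max 0 ((2 * \<rho>)\<^sup>2 - (cmod (z - 0))\<^sup>2))\<^sup>2"
      by (intro power_mono order_trans[OF _ max.cobounded2]) (auto simp: power_mult_distrib)
    then show "9 * \<rho> ^ 4 \<le> (max 0 ((2 * \<rho>)\<^sup>2 - (cmod (z - 0))\<^sup>2))\<^sup>2"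
      by (simp add: power_mult_distrib flip: power_mult)
  qed (use assms in auto)
  show "?\<phi> z = 0" if "cmod z < \<rho>" for z
    using cutoff_locally_const[OF cut open_ball[of 0 \<rho>], of 1 z] one that by auto
  show zero: "?\<phi> z = 0" if "2 * \<rho> \<le> cmod z" for z
  proof -
    have "(2 * \<rho>)\<^sup>2 \<le> (cmod z)\<^sup>2" using that assms by (intro power_mono) auto
    then show ?thesis by (simp add: dbar_plateau_def max_def)
  qed
  show "cmod (?\<phi> z) \<le> 8 / \<rho>"
  proof (cases "2 * \<rho> \<le> cmod z")
    case True
    then show ?thesis using zero assms by simp
  next
    case False
    let ?u = "max 0 (1 - (max 0 ((2 * \<rho>)\<^sup>2 - (cmod z)\<^sup>2))\<^sup>2 / (9 * \<rho> ^ 4))"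
    let ?v = "max 0 ((2 * \<rho>)\<^sup>2 - (cmod z)\<^sup>2)"
    have u: "0 \<le> ?u" "?u \<le> 1" using assms by auto
    have v: "0 \<le> ?v" "?v \<le> 4 * \<rho>\<^sup>2" by (auto simp: power_mult_distrib)
    have "cmod (?\<phi> z) = (2 * ?u / (9 * \<rho> ^ 4)) * (4 * ?v * cmod z)"
      using assms u v by (simp add: dbar_plateau_def norm_mult norm_divide norm_power del: of_real_diff)
    also have "\<dots> \<le> (2 * 1 / (9 * \<rho> ^ 4)) * (4 * (4 * \<rho>\<^sup>2) * (2 * \<rho>))"
      using u v False assms by (intro mult_mono divide_right_mono) auto
    also have "\<dots> = 64 / (9 * \<rho>)" using assms by (simp add: field_simps power2_eq_square power4_eq_xxxx)
    also have "\<dots> \<le> 8 / \<rho>" using assms by (simp add: field_simps)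
    finally show ?thesis .
  qed
qed

text \<open>The value does not depend on \<rho>, since two radial cutoffs agree near the pole; at
  \<rho> = 1 the integrand is minus the nonnegative function \<open>q\<close>. Hence \<kappa> is
  minus the integral of \<open>q\<close>, and being nonzero is all that is asked of it.\<close>

lemma plane_integral_pole:
  obtains \<kappa> where "\<kappa> \<noteq> 0"
    "\<And>\<rho>. \<rho> > 0 \<Longrightarrow> plane_integral (\<lambda>z. dbar_plateau {0} (2 * \<rho>) (9 * \<rho> ^ 4) z *\<^sub>C ((1 / z) *\<^sub>C 1)) =
       \<kappa> *\<^sub>R (1::'b::complex_banach_algebra)"
proof -
  define q where "q z = (2 * max 0 (1 - (max 0 (4 - (cmod z)\<^sup>2))\<^sup>2 / 9) / 9) * (4 * max 0 (4 - (cmod z)\<^sup>2))" for z :: complex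
  have cq: "continuous_on UNIV q" unfolding q_def by (intro continuous_intros) auto
  have vq: "vanishes_off_square 2 q"
    unfolding vanishes_off_square_def
  proof (intro conjI allI impI)
    fix z assume "2 \<le> \<bar>Re z\<bar> \<or> 2 \<le> \<bar>Im z\<bar>"
    then have "2 \<le> cmod z" using abs_Re_le_cmod[of z] abs_Im_le_cmod[of z] by linarith
    then have "2\<^sup>2 \<le> (cmod z)\<^sup>2" by (intro power_mono) auto
    then show "q z = 0" by (simp add: q_def max_def)
  qed simp
  have q0: "q z \<ge> 0" for z by (simp add: q_def)
  have "plane_integral q \<noteq> 0"
  proof
    assume "plane_integral q = 0"
    then have 0: "((\<lambda>p. q (Complex (fst p) (snd p))) has_integral 0) (square 2)"
      using integrable_integral[OF square_integrable[OF cq, of 2]] plane_integral_square[OF vq] by simp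
    have box: "box (-2, -2) (2 :: real, 2 :: real) \<noteq> {}" by (auto simp: box_ne_empty Basis_prod_def)
    \<comment> \<open>The point 3/2 lies in the transition annulus between the radii 1 and 2, where
      \<open>q\<close> is positive.\<close>
    have "q (Complex (fst (3/2 :: real, 0 :: real)) (snd (3/2 :: real, 0 :: real))) = 0"
      by (rule has_integral_0_cbox_imp_0[OF continuous_on_Complex_pair[OF cq] _ 0 box])
        (auto simp: q0)
    then show False by (simp add: q_def cmod_def power2_eq_square)
  qed
  let ?\<phi> = "\<lambda>\<rho>. dbar_plateau {0} (2 * \<rho>) (9 * \<rho> ^ 4)"
  have one: "?\<phi> 1 z *\<^sub>C ((1 / z) *\<^sub>C 1) = - (q z *\<^sub>R (1::'b))" for z
  proof (cases "z = 0")
    case True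
    then show ?thesis by (simp add: q_def dbar_plateau_def max_def)
  next
    case False
    have "?\<phi> 1 z = - of_real (q z) * z" by (simp add: dbar_plateau_def q_def algebra_simps)
    with False show ?thesis by (simp add: scaleC_scaleC scaleC.minus_left scaleC_of_real)
  qed
  have c: "continuous_on UNIV (\<lambda>z. ?\<phi> \<rho> z *\<^sub>C ((1 / z) *\<^sub>C (1::'b)))" if "\<rho> > 0" for \<rho>
    using that
    by (intro continuous_on_cutoff_scaleC[of "- {0}" "ball 0 \<rho>"] cutoff_continuous[OF plateau_radial(1)] continuous_intros)
      (auto simp: plateau_radial(3))
  have "plane_integral (\<lambda>z. ?\<phi> \<rho> z *\<^sub>C ((1 / z) *\<^sub>C (1::'b))) = (- plane_integral q) *\<^sub>R 1" if \<rho>: "\<rho> > 0" for \<rho>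
  proof -
    obtain L1 where L1: "vanishes_off_square L1 (?\<phi> \<rho>)" by (rule cutoff_vanishes[OF plateau_radial(1)[OF \<rho>]])
    obtain L2 where L2: "vanishes_off_square L2 (?\<phi> 1)" using cutoff_vanishes[OF plateau_radial(1)[of 1]] by auto
    have "0 = plane_integral (\<lambda>z. (?\<phi> \<rho> z - ?\<phi> 1 z) *\<^sub>C ((1 / z) *\<^sub>C (1::'b)))"
    proof (rule sym, rule plane_integral_cutoff_holomorphic[OF cutoff_diff[OF plateau_radial(1)[OF \<rho>] plateau_radial(1)[of 1]]])
      show "((\<lambda>z. (1 / z) *\<^sub>C (1::'b)) has_derivative (\<lambda>w. w *\<^sub>C ((- 1 / z\<^sup>2) *\<^sub>C 1))) (at z)" if "z \<in> - {0}" for z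
      proof -
        have "((\<lambda>z. 1 / z) has_derivative (\<lambda>w. - w / z\<^sup>2)) (at z)"
          using that by (auto intro!: derivative_eq_intros simp: power2_eq_square field_simps)
        from bounded_linear.has_derivative[OF scaleC.bounded_linear_left this, of "1::'b"]
        show ?thesis by (simp add: scaleC_scaleC)
      qed
      show "plateau {0} (2 * \<rho>) (9 * \<rho> ^ 4) z - plateau {0} (2 * 1) (9 * 1 ^ 4) z = 0" if "z \<in> ball 0 (min \<rho> 1)" for z
        using that plateau_radial(2)[OF \<rho>, of z] plateau_radial(2)[of 1 z] by simp
      show "continuous_on (- {0}) (\<lambda>z. (- 1 / z\<^sup>2) *\<^sub>C (1::'b))" by (intro continuous_intros) auto
    qed (use \<rho> in auto)
    also have "\<dots> = plane_integral (\<lambda>z. ?\<phi> \<rho> z *\<^sub>C ((1 / z) *\<^sub>C (1::'b))) - plane_integral (\<lambda>z. ?\<phi> 1 z *\<^sub>C ((1 / z) *\<^sub>C (1::'b)))"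
      unfolding scaleC.diff_left
    proof (rule plane_integral_diff[of _ L1 _ L2])
      show "vanishes_off_square L1 (\<lambda>z. ?\<phi> \<rho> z *\<^sub>C ((1 / z) *\<^sub>C (1::'b)))"
        using L1 by (simp add: vanishes_off_square_def)
      show "vanishes_off_square L2 (\<lambda>z. ?\<phi> 1 z *\<^sub>C ((1 / z) *\<^sub>C (1::'b)))"
        using L2 by (simp add: vanishes_off_square_def)
    qed (intro c \<rho> zero_less_one)+
    also have "plane_integral (\<lambda>z. ?\<phi> 1 z *\<^sub>C ((1 / z) *\<^sub>C (1::'b))) = - (plane_integral q *\<^sub>R 1)"
      unfolding one
      by (intro plane_integral_bounded_linear[OF cq vq, of "\<lambda>x. - (x *\<^sub>R (1::'b))"] bounded_linear_minus bounded_linear_scaleR_left)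
    finally show ?thesis by (simp only: scaleR_minus_left eq_neg_iff_add_eq_0 diff_minus_eq_add)
  qed
  with \<open>plane_integral q \<noteq> 0\<close> show ?thesis by (intro that[of "- plane_integral q"]) auto
qed

lemma vanishes_scaleC:
  fixes F :: "complex \<Rightarrow> 'b::complex_banach"
  shows "vanishes_off_square L \<phi> \<Longrightarrow> vanishes_off_square L (\<lambda>z. \<phi> z *\<^sub>C F z)"
  by (simp add: vanishes_off_square_def)

lemma norm_res_le:
  fixes a :: "'b::complex_banach_algebra"
  assumes z: "2 * norm a \<le> cmod z" "norm a < cmod z"
  shows "norm (res a z) \<le> 2 / cmod z"
    and "norm (res a z - (1 / z) *\<^sub>C 1) \<le> 2 * norm a / (cmod z)\<^sup>2"
proof -
  have z0: "cmod z > 0" using z(2) norm_ge_zero[of a] by linarith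
  have eq: "res a z - (1 / z) *\<^sub>C 1 = (1 / z) *\<^sub>C (a * res a z)"
    using res_mult(1)[OF norm_less_in_rho[OF z(2)]] z0
    by (simp add: scaleC.diff_right scaleC_scaleC)
  then have le: "norm (res a z - (1 / z) *\<^sub>C 1) \<le> norm a * norm (res a z) / cmod z"
    using norm_mult_ineq[of a "res a z"] z0 by (simp add: norm_scaleC norm_divide divide_right_mono)
  also have "\<dots> \<le> norm (res a z) / 2"
    using mult_right_mono[OF z(1) norm_ge_zero[of "res a z"]] z0 by (simp add: field_simps)
  finally have "norm (res a z) \<le> norm ((1 / z) *\<^sub>C (1::'b)) + norm (res a z) / 2"
    using norm_triangle_ineq2[of "res a z" "(1 / z) *\<^sub>C 1"] by linarith
  also have "norm ((1 / z) *\<^sub>C (1::'b)) \<le> 1 / cmod z"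
    using divide_right_mono[OF norm_one_le, of "cmod z"] z0 by (simp add: norm_scaleC norm_divide)
  finally show *: "norm (res a z) \<le> 2 / cmod z" by simp
  note le
  also have "norm a * norm (res a z) / cmod z \<le> norm a * (2 / cmod z) / cmod z"
    using * z0 by (intro divide_right_mono mult_left_mono) auto
  finally show "norm (res a z - (1 / z) *\<^sub>C 1) \<le> 2 * norm a / (cmod z)\<^sup>2"
    by (simp add: power2_eq_square mult.commute)
qed

lemma compact_spectrum: "compact (- rho a)"
proof (rule compact_eq_bounded_closed[THEN iffD2], intro conjI)
  show "bounded (- rho a)"
    unfolding bounded_iff using norm_less_in_rho[of a] by (meson ComplD not_le)
  show "closed (- rho a)" using open_rho by (simp add: closed_def)
qed

text \<open>Deforming the cutoff to a large radial one, where the resolvent is \<open>1/z + O(1/z\<^sup>2)\<close>.\<close>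

lemma plane_integral_res:
  obtains \<kappa> where "\<kappa> \<noteq> 0"
    "\<And>(a::'b::complex_banach_algebra) \<eta> \<phi> S. cutoff \<eta> \<phi> \<Longrightarrow> open S \<Longrightarrow> - rho a \<subseteq> S \<Longrightarrow> (\<And>z. z \<in> S \<Longrightarrow> \<eta> z = 1) \<Longrightarrow>
       plane_integral (\<lambda>z. \<phi> z *\<^sub>C res a z) = \<kappa> *\<^sub>R 1"
proof -
  obtain \<kappa> where \<kappa>: "\<kappa> \<noteq> 0" "\<And>\<rho>. \<rho> > 0 \<Longrightarrow> plane_integral (\<lambda>z. dbar_plateau {0} (2 * \<rho>) (9 * \<rho> ^ 4) z *\<^sub>C ((1 / z) *\<^sub>C 1)) =
       \<kappa> *\<^sub>R (1::'b)"
    using plane_integral_pole by blast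
  have "plane_integral (\<lambda>z. \<phi> z *\<^sub>C res a z) = \<kappa> *\<^sub>R 1"
    if cut: "cutoff \<eta> \<phi>" and S: "open S" "- rho a \<subseteq> S" "\<And>z. z \<in> S \<Longrightarrow> \<eta> z = 1" for a :: 'b and \<eta> \<phi> S
  proof -
    define Q where "Q = plane_integral (\<lambda>z. \<phi> z *\<^sub>C res a z)"
    obtain L where L: "vanishes_off_square L \<phi>" by (rule cutoff_vanishes[OF cut])
    have cres: "continuous_on (rho a) (\<lambda>z. - (res a z * res a z))"
      by (intro continuous_intros continuous_on_res)
    \<comment> \<open>\<open>Q\<close> does not depend on \<rho>, so a bound that tends to 0 as
      \<rho> grows forces equality.\<close>
    have bound: "norm (Q - \<kappa> *\<^sub>R 1) \<le> 256 * norm a / \<rho>" if \<rho>: "\<rho> > 0" "\<rho> > 2 * norm a" for \<rho>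
    proof -
      let ?\<phi> = "dbar_plateau {0} (2 * \<rho>) (9 * \<rho> ^ 4)"
      have \<rho>a: "norm a < \<rho>" using \<rho> norm_ge_zero[of a] by linarith
      have cover: "rho a \<union> ball 0 \<rho> = UNIV"
      proof -
        have "z \<in> rho a" if "\<rho> \<le> cmod z" for z using norm_less_in_rho[of a z] that \<rho>a by simp
        then show ?thesis by force
      qed
      have van: "vanishes_off_square (2 * \<rho>) ?\<phi>"
        unfolding vanishes_off_square_def
      proof (intro conjI allI impI plateau_radial(4) \<rho>)
        fix z assume "2 * \<rho> \<le> \<bar>Re z\<bar> \<or> 2 * \<rho> \<le> \<bar>Im z\<bar>"
        then show "2 * \<rho> \<le> cmod z" using abs_Re_le_cmod[of z] abs_Im_le_cmod[of z] by linarith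
      qed (use \<rho> in auto)
      have c1: "continuous_on UNIV (\<lambda>z. \<phi> z *\<^sub>C res a z)"
        by (rule continuous_on_cutoff_scaleC[OF open_rho[of a] S(1)])
          (use S cutoff_locally_const[OF cut S(1,3)] in \<open>auto intro: continuous_on_res cutoff_continuous[OF cut]\<close>)
      have c2: "continuous_on UNIV (\<lambda>z. ?\<phi> z *\<^sub>C res a z)"
        by (rule continuous_on_cutoff_scaleC[OF open_rho[of a] open_ball cover])
          (simp_all add: continuous_on_res cutoff_continuous[OF plateau_radial(1)[OF \<rho>(1)]] plateau_radial(3) \<rho>)
      have c3: "continuous_on UNIV (\<lambda>z. ?\<phi> z *\<^sub>C ((1 / z) *\<^sub>C (1::'b)))"
        using \<rho> by (intro continuous_on_cutoff_scaleC[of "- {0}" "ball 0 \<rho>"] cutoff_continuous[OF plateau_radial(1)] continuous_intros)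
          (auto simp: plateau_radial(3))
      have "0 = plane_integral (\<lambda>z. (\<phi> z - ?\<phi> z) *\<^sub>C res a z)"
        by (rule sym, rule plane_integral_cutoff_holomorphic[OF cutoff_diff[OF cut plateau_radial(1)[OF \<rho>(1)]]
              open_rho open_Int[OF S(1) open_ball[of 0 \<rho>]] _ _ has_derivative_res cres])
          (use S cover plateau_radial(2)[OF \<rho>(1)] in auto)
      also have "\<dots> = Q - plane_integral (\<lambda>z. ?\<phi> z *\<^sub>C res a z)"
        unfolding scaleC.diff_left Q_def
        by (rule plane_integral_diff[OF c1 vanishes_scaleC[OF L] c2 vanishes_scaleC[OF van]])
      finally have "Q - \<kappa> *\<^sub>R 1 = plane_integral (\<lambda>z. ?\<phi> z *\<^sub>C res a z) - plane_integral (\<lambda>z. ?\<phi> z *\<^sub>C ((1 / z) *\<^sub>C 1))"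
        using \<kappa>(2)[OF \<rho>(1)] by simp
      also have "\<dots> = plane_integral (\<lambda>z. ?\<phi> z *\<^sub>C res a z - ?\<phi> z *\<^sub>C ((1 / z) *\<^sub>C 1))"
        by (rule plane_integral_diff[OF c2 vanishes_scaleC[OF van] c3 vanishes_scaleC[OF van], symmetric])
      finally have eq: "Q - \<kappa> *\<^sub>R 1 = plane_integral (\<lambda>z. ?\<phi> z *\<^sub>C (res a z - (1 / z) *\<^sub>C 1))"
        by (simp add: scaleC.diff_right)
      \<comment> \<open>The resolvent estimate is needed only where |z| is at least \<rho>, as
        \<open>?\<phi>\<close> vanishes further inside. Multiplied by the area (4 \<rho>)^2 of the
        supporting square, the bound gives 256 norm a / \<rho>.\<close>
      have "norm (?\<phi> z *\<^sub>C (res a z - (1 / z) *\<^sub>C 1)) \<le> (8 / \<rho>) * (2 * norm a / \<rho>\<^sup>2)" for z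
      proof (cases "cmod z < \<rho>")
        case True
        then show ?thesis using plateau_radial(3)[OF \<rho>(1) True] \<rho> by simp
      next
        case False
        have "norm (res a z - (1 / z) *\<^sub>C 1) \<le> 2 * norm a / (cmod z)\<^sup>2"
          using False \<rho> \<rho>a by (intro norm_res_le(2)) auto
        also have "\<dots> \<le> 2 * norm a / \<rho>\<^sup>2"
          using False \<rho> by (intro divide_left_mono power_mono mult_pos_pos) auto
        finally show ?thesis
          unfolding norm_scaleC using \<rho> by (intro mult_mono plateau_radial(5)) auto
      qed
      then have "norm (Q - \<kappa> *\<^sub>R 1) \<le> (8 / \<rho>) * (2 * norm a / \<rho>\<^sup>2) * (2 * (2 * \<rho>))\<^sup>2"
        unfolding eq
        by (intro norm_plane_integral_le vanishes_scaleC[OF van]) (simp_all add: scaleC.diff_right continuous_on_diff[OF c2 c3])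
      also have "\<dots> = 256 * norm a / \<rho>" using \<rho> by (simp add: field_simps power2_eq_square)
      finally show ?thesis .
    qed
    have "((\<lambda>\<rho>. 256 * norm a / \<rho>) \<longlongrightarrow> 0) at_top"
      by (rule real_tendsto_divide_at_top[OF tendsto_const filterlim_ident])
    moreover have "\<forall>\<^sub>F \<rho> in at_top. norm (Q - \<kappa> *\<^sub>R 1) \<le> 256 * norm a / \<rho>"
      using eventually_gt_at_top[of 0] eventually_gt_at_top[of "2 * norm a"] by eventually_elim (rule bound)
    ultimately have "norm (Q - \<kappa> *\<^sub>R 1) \<le> 0"
      by (rule tendsto_lowerbound) simp
    then show ?thesis by (simp add: Q_def)
  qed
  with \<kappa>(1) show ?thesis by (rule that)
qed

text \<open>The algebraic core is (a - b) r s = r - s for the resolvents r, s of \<open>a\<close>,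
  \<open>b\<close> at the same point, valid because they commute with both elements. Integrated
  against \<open>\<phi>\<close>, the first term gives \<kappa>, since \<eta> = 1 near the spectrum
  of \<open>a\<close>, and the second gives 0, since \<eta> = 0 near that of
  \<open>b\<close>.\<close>

theorem ainvertible_diff_of_disjoint_spectra:
  fixes a b :: "'b::complex_banach_algebra"
  assumes comm: "a * b = b * a" and disj: "rho a \<union> rho b = UNIV"
  shows "ainvertible (a - b)"
proof -
  obtain \<kappa> where \<kappa>: "\<kappa> \<noteq> 0" "\<And>(a::'b) \<eta> \<phi> S. cutoff \<eta> \<phi> \<Longrightarrow> open S \<Longrightarrow> - rho a \<subseteq> S \<Longrightarrow> (\<And>z. z \<in> S \<Longrightarrow> \<eta> z = 1) \<Longrightarrow>
       plane_integral (\<lambda>z. \<phi> z *\<^sub>C res a z) = \<kappa> *\<^sub>R 1"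
    using plane_integral_res by blast
  obtain \<eta> \<phi> S T where cut: "cutoff \<eta> \<phi>" and S: "open S" "- rho a \<subseteq> S" "\<And>z. z \<in> S \<Longrightarrow> \<eta> z = 1"
    and T: "open T" "- rho b \<subseteq> T" "\<And>z. z \<in> T \<Longrightarrow> \<eta> z = 0"
    using cutoff_separating[OF compact_spectrum[of a] compact_imp_closed[OF compact_spectrum[of b]]] disj
    by (metis Compl_UNIV_eq Compl_Un)
  obtain L where L: "vanishes_off_square L \<phi>" by (rule cutoff_vanishes[OF cut])
  have \<phi>0: "\<phi> z = 0" if "z \<in> S \<union> T" for z
    using cutoff_locally_const[OF cut S(1,3)] cutoff_locally_const[OF cut T(1,3)] that by blast
  have ca: "continuous_on UNIV (\<lambda>z. \<phi> z *\<^sub>C res a z)"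
    by (rule continuous_on_cutoff_scaleC[OF open_rho[of a] S(1)])
      (use S \<phi>0 in \<open>auto intro: continuous_on_res cutoff_continuous[OF cut]\<close>)
  have cb: "continuous_on UNIV (\<lambda>z. \<phi> z *\<^sub>C res b z)"
    by (rule continuous_on_cutoff_scaleC[OF open_rho[of b] T(1)])
      (use T \<phi>0 in \<open>auto intro: continuous_on_res cutoff_continuous[OF cut]\<close>)
  have cab: "continuous_on UNIV (\<lambda>z. \<phi> z *\<^sub>C (res a z * res b z))"
    by (rule continuous_on_cutoff_scaleC[of "rho a \<inter> rho b" "S \<union> T"])
      (use S T \<phi>0 open_rho[of a] open_rho[of b] in \<open>auto intro!: continuous_intros continuous_on_subset[OF continuous_on_res] cutoff_continuous[OF cut]\<close>)
  define G where "G = plane_integral (\<lambda>z. \<phi> z *\<^sub>C (res a z * res b z))"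
  have ib: "plane_integral (\<lambda>z. \<phi> z *\<^sub>C res b z) = 0"
    by (rule plane_integral_cutoff_holomorphic[OF cut open_rho T(1) _ T(3) has_derivative_res])
      (use T in \<open>auto intro!: continuous_intros continuous_on_res\<close>)
  have key: "\<phi> z *\<^sub>C ((a - b) * (res a z * res b z)) = \<phi> z *\<^sub>C res a z - \<phi> z *\<^sub>C res b z"
    "\<phi> z *\<^sub>C ((res a z * res b z) * (a - b)) = \<phi> z *\<^sub>C res a z - \<phi> z *\<^sub>C res b z" for z
  proof -
    have "(a - b) * (res a z * res b z) = res a z - res b z \<and> (res a z * res b z) * (a - b) = res a z - res b z"
      if z: "z \<in> rho a" "z \<in> rho b"
    proof
      have "(a - b) * (res a z * res b z) = (a * res a z) * res b z - (b * res a z) * res b z"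
        by (simp add: algebra_simps)
      also have "b * res a z = res a z * b" using res_commute[OF z(1) comm] by simp
      finally show "(a - b) * (res a z * res b z) = res a z - res b z"
        by (simp add: mult.assoc res_mult z algebra_simps scaleC_mult_left scaleC_mult_right)
      have "(res a z * res b z) * (a - b) = res a z * (res b z * a) - res a z * (res b z * b)"
        by (simp add: algebra_simps)
      also have "res b z * a = a * res b z" using res_commute[OF z(2) comm[symmetric]] by simp
      also have "res a z * (a * res b z) = (res a z * a) * res b z" by (simp add: mult.assoc)
      finally show "(res a z * res b z) * (a - b) = res a z - res b z"
        by (simp add: res_mult z algebra_simps scaleC_mult_left scaleC_mult_right)
    qed
    \<comment> \<open>On either spectrum one of the resolvent values is meaningless, but there
      \<open>\<phi>\<close> vanishes.\<close>
    moreover have "\<phi> z = 0" if "z \<notin> rho a \<or> z \<notin> rho b"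
      using that S(2) T(2) by (intro \<phi>0) auto
    ultimately show "\<phi> z *\<^sub>C ((a - b) * (res a z * res b z)) = \<phi> z *\<^sub>C res a z - \<phi> z *\<^sub>C res b z"
      "\<phi> z *\<^sub>C ((res a z * res b z) * (a - b)) = \<phi> z *\<^sub>C res a z - \<phi> z *\<^sub>C res b z"
      by (cases "z \<in> rho a \<and> z \<in> rho b"; auto simp: scaleC.diff_right)+
  qed
  have van: "vanishes_off_square L (\<lambda>z. \<phi> z *\<^sub>C F z)" for F :: "complex \<Rightarrow> 'b" by (rule vanishes_scaleC[OF L])
  have rhs: "plane_integral (\<lambda>z. \<phi> z *\<^sub>C res a z - \<phi> z *\<^sub>C res b z) = \<kappa> *\<^sub>R 1"
    using plane_integral_diff[OF ca van cb van] ib \<kappa>(2)[OF cut S] by simp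
  have l: "(a - b) * G = \<kappa> *\<^sub>R 1"
    unfolding G_def rhs[symmetric] key(1)[symmetric]
    by (subst plane_integral_bounded_linear[OF cab van bounded_linear_mult_right, symmetric]) (simp add: scaleC_mult_right)
  have r: "G * (a - b) = \<kappa> *\<^sub>R 1"
    unfolding G_def rhs[symmetric] key(2)[symmetric]
    by (subst plane_integral_bounded_linear[OF cab van bounded_linear_mult_left, symmetric]) (simp add: scaleC_mult_left)
  show ?thesis
    by (rule ainvertibleI[of _ "(1 / \<kappa>) *\<^sub>R G" "(1 / \<kappa>) *\<^sub>R G"]) (use l r \<kappa>(1) in auto)
qed

subsection \<open>The Banach algebra of bounded complex-linear operators\<close>

text \<open>A type of its own makes the operators an instance of
  \<open>complex_banach_algebra\<close>. As that class extends \<open>complex_banach\<close>, the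
  construction can be iterated: operators on the algebra itself form the type
  \<open>'a cop cop\<close>, where Sylvester operators live.\<close>

typedef (overloaded) 'a cop = "{f :: 'a::complex_banach \<Rightarrow>\<^sub>L 'a. \<forall>c x. f (c *\<^sub>C x) = c *\<^sub>C f x}"
  morphisms blinfun_of_cop Abs_cop
  by (rule exI[of _ 0]) simp

setup_lifting type_definition_cop

instantiation cop :: (complex_banach) "{real_normed_algebra, monoid_mult, scaleC}"
begin

lift_definition zero_cop :: "'a cop" is 0 by simp
lift_definition one_cop :: "'a cop" is id_blinfun by simp
lift_definition plus_cop :: "'a cop \<Rightarrow> 'a cop \<Rightarrow> 'a cop" is "(+)"
  by (simp add: blinfun.add_left scaleC_add_right)
lift_definition minus_cop :: "'a cop \<Rightarrow> 'a cop \<Rightarrow> 'a cop" is "(-)"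
  by (simp add: blinfun.diff_left scaleC.diff_right)
lift_definition uminus_cop :: "'a cop \<Rightarrow> 'a cop" is uminus
  by (simp add: blinfun.minus_left scaleC.minus_right)
lift_definition times_cop :: "'a cop \<Rightarrow> 'a cop \<Rightarrow> 'a cop" is "(o\<^sub>L)" by simp
lift_definition scaleR_cop :: "real \<Rightarrow> 'a cop \<Rightarrow> 'a cop" is "(*\<^sub>R)"
  by (simp add: blinfun.scaleR_left scaleC.scaleR_right)
lift_definition norm_cop :: "'a cop \<Rightarrow> real" is norm .

lemma Blinfun_scaleC_apply: "blinfun_apply (Blinfun ((*\<^sub>C) c)) x = c *\<^sub>C (x::'a)"
  by (simp add: bounded_linear_Blinfun_apply scaleC.bounded_linear_right)

lift_definition scaleC_cop :: "complex \<Rightarrow> 'a cop \<Rightarrow> 'a cop" is "\<lambda>c f. Blinfun ((*\<^sub>C) c) o\<^sub>L f"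
  by (simp add: Blinfun_scaleC_apply scaleC_scaleC mult.commute)

definition "dist (f::'a cop) g = norm (f - g)"
definition "sgn (f::'a cop) = scaleR (inverse (norm f)) f"
definition [code del]: "(uniformity :: ('a cop \<times> 'a cop) filter) = (INF e\<in>{0 <..}. principal {(x, y). dist x y < e})"
definition open_cop :: "'a cop set \<Rightarrow> bool"
  where [code del]: "open_cop S \<longleftrightarrow> (\<forall>x\<in>S. \<forall>\<^sub>F (x', y) in uniformity. x' = x \<longrightarrow> y \<in> S)"

instance
proof
  fix f g h :: "'a cop" and r s :: real and c d :: complex and S :: "'a cop set"
  note lins = blinfun.add_left blinfun.add_right blinfun.diff_left blinfun.diff_right blinfun.scaleR_left
    blinfun.scaleR_right blinfun.minus_left Blinfun_scaleC_apply
  show "f + g + h = f + (g + h)" by transfer simp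
  show "f + g = g + f" by transfer simp
  show "0 + f = f" by transfer simp
  show "- f + f = 0" by transfer simp
  show "f - g = f + - g" by transfer simp
  show "r *\<^sub>R (f + g) = r *\<^sub>R f + r *\<^sub>R g" by transfer (simp add: scaleR_add_right)
  show "(r + s) *\<^sub>R f = r *\<^sub>R f + s *\<^sub>R f" by transfer (simp add: scaleR_add_left)
  show "r *\<^sub>R s *\<^sub>R f = (r * s) *\<^sub>R f" by transfer simp
  show "1 *\<^sub>R f = f" by transfer simp
  show "f * g * h = f * (g * h)" by transfer (auto intro!: blinfun_eqI)
  show "(f + g) * h = f * h + g * h" by transfer (auto intro!: blinfun_eqI simp: lins)
  show "f * (g + h) = f * g + f * h" by transfer (auto intro!: blinfun_eqI simp: lins)
  show "1 * f = f" "f * 1 = f" by (transfer, auto intro!: blinfun_eqI)+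
  show "r *\<^sub>R f * g = r *\<^sub>R (f * g)" "f * r *\<^sub>R g = r *\<^sub>R (f * g)"
    by (transfer, auto intro!: blinfun_eqI simp: lins)+
  show "dist f g = norm (f - g)" by (rule dist_cop_def)
  show "sgn f = inverse (norm f) *\<^sub>R f" by (rule sgn_cop_def)
  show "(uniformity :: ('a cop \<times> 'a cop) filter) = (INF e\<in>{0 <..}. principal {(x, y). dist x y < e})"
    by (rule uniformity_cop_def)
  show "open S \<longleftrightarrow> (\<forall>x\<in>S. \<forall>\<^sub>F (x', y) in uniformity. x' = x \<longrightarrow> y \<in> S)" by (rule open_cop_def)
  show "norm f = 0 \<longleftrightarrow> f = 0" by transfer simp
  show "norm (f + g) \<le> norm f + norm g" by transfer (rule norm_triangle_ineq)
  show "norm (r *\<^sub>R f) = \<bar>r\<bar> * norm f" by transfer simp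
  show "norm (f * g) \<le> norm f * norm g" by transfer (rule norm_blinfun_compose)
qed

end

instance cop :: (complex_banach) complex_banach_algebra
proof
  fix f g h :: "'a cop" and r s :: real and c d :: complex
  note lins = blinfun.add_left blinfun.scaleR_left Blinfun_scaleC_apply
  show "norm (1 :: 'a cop) \<le> 1" by transfer (rule norm_blinfun_id_le)
  show "c *\<^sub>C (f + g) = c *\<^sub>C f + c *\<^sub>C g" "(c + d) *\<^sub>C f = c *\<^sub>C f + d *\<^sub>C f" "c *\<^sub>C d *\<^sub>C f = (c * d) *\<^sub>C f"
    by (transfer, auto intro!: blinfun_eqI simp: lins scaleC_add_right scaleC_add_left scaleC_scaleC)+
  show "of_real r *\<^sub>C f = r *\<^sub>R f" by transfer (auto intro!: blinfun_eqI simp: lins scaleC_of_real)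
  show "(c *\<^sub>C f) * g = c *\<^sub>C (f * g)" "f * (c *\<^sub>C g) = c *\<^sub>C (f * g)"
    by (transfer, auto intro!: blinfun_eqI simp: lins)+
  have le: "norm (c *\<^sub>C f) \<le> cmod c * norm f" for c and f :: "'a cop"
    by (transfer, intro norm_blinfun_bound)
      (auto simp: lins norm_scaleC mult.assoc intro!: mult_left_mono norm_blinfun)
  show "norm (c *\<^sub>C f) = cmod c * norm f"
  proof (rule antisym[OF le])
    show "cmod c * norm f \<le> norm (c *\<^sub>C f)"
    proof (cases "c = 0")
      case False
      have "inverse c *\<^sub>C c *\<^sub>C f = f"
        using False by (transfer, auto intro!: blinfun_eqI simp: lins scaleC_scaleC)
      then have "norm f \<le> cmod (inverse c) * norm (c *\<^sub>C f)" using le[of "inverse c" "c *\<^sub>C f"] by simp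
      then show ?thesis using False unfolding norm_inverse by (simp add: field_simps)
    next
      case True
      have "0 \<le> norm (c *\<^sub>C f)" by transfer simp
      with True show ?thesis by simp
    qed
  qed
next
  fix X :: "nat \<Rightarrow> 'a cop" assume X: "Cauchy X"
  have dist: "dist f g = dist (blinfun_of_cop f) (blinfun_of_cop g)" for f g :: "'a cop"
    unfolding dist_cop_def dist_norm by transfer simp
  have "Cauchy (\<lambda>n. blinfun_of_cop (X n))" using X unfolding Cauchy_def dist .
  then obtain l where l: "(\<lambda>n. blinfun_of_cop (X n)) \<longlonglongrightarrow> l" using Cauchy_convergent convergent_def by blast
  have ap: "(\<lambda>n. blinfun_of_cop (X n) x) \<longlonglongrightarrow> l x" for x by (intro tendsto_intros l)
  have "l (c *\<^sub>C x) = c *\<^sub>C l x" for c x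
  proof (rule LIMSEQ_unique)
    show "(\<lambda>n. blinfun_of_cop (X n) (c *\<^sub>C x)) \<longlonglongrightarrow> l (c *\<^sub>C x)" by (rule ap)
    have "blinfun_of_cop (X n) (c *\<^sub>C x) = c *\<^sub>C blinfun_of_cop (X n) x" for n
      using blinfun_of_cop[of "X n"] by simp
    then show "(\<lambda>n. blinfun_of_cop (X n) (c *\<^sub>C x)) \<longlonglongrightarrow> c *\<^sub>C l x"
      by (simp only:) (intro tendsto_intros ap)
  qed
  then have "blinfun_of_cop (Abs_cop l) = l" by (simp add: Abs_cop_inverse)
  then have "X \<longlonglongrightarrow> Abs_cop l" using l unfolding tendsto_iff dist by simp
  then show "convergent X" by (rule convergentI)
qed

lift_definition capp :: "'a::complex_banach cop \<Rightarrow> 'a \<Rightarrow> 'a" is blinfun_apply .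

definition cop_of :: "('a::complex_banach \<Rightarrow> 'a) \<Rightarrow> 'a cop" where
  "cop_of T = Abs_cop (Blinfun T)"

lemma capp_cop_of: "bounded_clinear T \<Longrightarrow> capp (cop_of T) = T"
  unfolding capp_def cop_of_def bounded_clinear_def
  by (simp add: Abs_cop_inverse bounded_linear_Blinfun_apply)

lemma bounded_clinear_capp: "bounded_clinear (capp f)"
  unfolding bounded_clinear_def by transfer (auto intro: blinfun.bounded_linear_right)

lemma cop_eqI: "(\<And>x. capp f x = capp g x) \<Longrightarrow> f = g"
  by transfer (rule blinfun_eqI)

lemma capp_simps:
  "capp (f + g) x = capp f x + capp g x" "capp (f - g) x = capp f x - capp g x"
  "capp (f * g) x = capp f (capp g x)" "capp 1 x = x" "capp 0 x = 0" "capp (- f) x = - capp f x"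
  "capp (r *\<^sub>R f) x = r *\<^sub>R capp f x"
  by (transfer, simp add: blinfun.add_left blinfun.diff_left blinfun.minus_left blinfun.scaleR_left)+

lemma capp_scaleC: "capp (c *\<^sub>C f) x = c *\<^sub>C capp f x"
  by transfer (simp add: Blinfun_scaleC_apply)

lemma norm_capp: "norm (capp f x) \<le> norm f * norm x"
  by transfer (rule norm_blinfun)

lemma norm_cop_le: "0 \<le> K \<Longrightarrow> (\<And>x. norm (capp f x) \<le> K * norm x) \<Longrightarrow> norm f \<le> K"
  by transfer (rule norm_blinfun_bound)

lemma bounded_linear_capp: "bounded_linear (capp f)"
  using bounded_clinear_capp unfolding bounded_clinear_def by blast

lemmas linear_capp = bounded_linear.linear[OF bounded_linear_capp]

lemma capp_scaleC_right: "capp f (c *\<^sub>C x) = c *\<^sub>C capp f x"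
  using bounded_clinear_capp unfolding bounded_clinear_def by blast

text \<open>Left and right multiplications commute with each other by associativity even in a
  noncommutative algebra; this supplies the commuting pair for a Sylvester operator.\<close>

definition left_mult_op :: "'b::complex_banach_algebra \<Rightarrow> 'b cop" where
  "left_mult_op a = cop_of (\<lambda>x. a * x)"

definition right_mult_op :: "'b::complex_banach_algebra \<Rightarrow> 'b cop" where
  "right_mult_op a = cop_of (\<lambda>x. x * a)"

lemma capp_mult_op [simp]: "capp (left_mult_op a) x = a * x" "capp (right_mult_op a) x = x * a"
  by (simp_all add: left_mult_op_def right_mult_op_def capp_cop_of bounded_clinear_def
      bounded_linear_mult_right bounded_linear_mult_left scaleC_mult_left scaleC_mult_right)

lemma norm_mult_op_diff:
  "norm (left_mult_op a - left_mult_op b) \<le> norm (a - b)"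
  "norm (right_mult_op a - right_mult_op b) \<le> norm (a - b)"
proof -
  show "norm (left_mult_op a - left_mult_op b) \<le> norm (a - b)"
  proof (rule norm_cop_le)
    show "norm (capp (left_mult_op a - left_mult_op b) x) \<le> norm (a - b) * norm x" for x
      using norm_mult_ineq[of "a - b" x] by (simp add: capp_simps left_diff_distrib)
  qed simp
  show "norm (right_mult_op a - right_mult_op b) \<le> norm (a - b)"
  proof (rule norm_cop_le)
    show "norm (capp (right_mult_op a - right_mult_op b) x) \<le> norm (a - b) * norm x" for x
      using norm_mult_ineq[of x "a - b"] by (simp add: capp_simps right_diff_distrib mult.commute)
  qed simp
qed

text \<open>Multiplication by the inverse of z - a, from the same side, inverts z minus the
  multiplication operator. Disjointness of spectra is thereby inherited.\<close>

lemma rho_mult_op: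
  "rho a \<subseteq> rho (left_mult_op a)" "rho a \<subseteq> rho (right_mult_op a)"
proof -
  have "ainvertible (z *\<^sub>C 1 - left_mult_op a) \<and> ainvertible (z *\<^sub>C 1 - right_mult_op a)"
    if "ainvertible (z *\<^sub>C 1 - a)" for z
  proof
    let ?r = "ainv (z *\<^sub>C 1 - a)"
    have eq: "z *\<^sub>C x - a * x = (z *\<^sub>C 1 - a) * x" "z *\<^sub>C x - x * a = x * (z *\<^sub>C 1 - a)" for x
      by (simp_all add: algebra_simps scaleC_mult_left scaleC_mult_right)
    show "ainvertible (z *\<^sub>C 1 - left_mult_op a)"
      by (rule ainvertibleI[of _ "left_mult_op ?r" "left_mult_op ?r"]; rule cop_eqI)
        (simp_all add: capp_simps capp_scaleC eq ainv_cancel that)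
    have "x * ?r * (z *\<^sub>C 1 - a) = x" "x * (z *\<^sub>C 1 - a) * ?r = x" for x
      using that by (simp_all add: mult.assoc ainv)
    then show "ainvertible (z *\<^sub>C 1 - right_mult_op a)"
      by (intro ainvertibleI[of _ "right_mult_op ?r" "right_mult_op ?r"] cop_eqI)
        (simp_all add: capp_simps capp_scaleC eq)
  qed
  then show "rho a \<subseteq> rho (left_mult_op a)" "rho a \<subseteq> rho (right_mult_op a)" by (auto simp: rho_def)
qed

subsection \<open>Lipschitz bounds from Bochner integrals\<close>

lemma has_strong_bochner_integral_bound:
  fixes f :: "real \<Rightarrow> 'b::real_normed_vector"
  assumes int: "has_strong_bochner_integral (lebesgue_on {a..b}) f y" and ab: "a \<le> b" and C: "0 \<le> C"
    and bd: "AE t in lebesgue_on {a..b}. norm (f t - c) \<le> C"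
  shows "norm (y - (b - a) *\<^sub>R c) \<le> C * (b - a)"
proof -
  let ?M = "lebesgue_on {a..b}"
  have em: "emeasure ?M (space ?M) = ennreal (b - a)"
    using ab by (simp add: emeasure_restrict_space space_restrict_space)
  have me: "measure ?M (space ?M) = b - a" using ab unfolding measure_def em by simp
  obtain s where s: "\<And>i::nat. Bochner_Integration.simple_bochner_integrable ?M (s i)"
    "(\<lambda>i. \<integral>\<^sup>+x. ennreal (norm (f x - s i x)) \<partial>?M) \<longlonglongrightarrow> 0"
    "(\<lambda>i. Bochner_Integration.simple_bochner_integral ?M (s i)) \<longlonglongrightarrow> y"
    using int unfolding has_strong_bochner_integral_def by blast
  have ci: "Bochner_Integration.simple_bochner_integrable ?M (\<lambda>_. c)"
  proof (rule Bochner_Integration.simple_bochner_integrable.intros)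
    have "emeasure ?M {x \<in> space ?M. c \<noteq> 0} \<le> ennreal (b - a)"
      unfolding em[symmetric] by (rule emeasure_space)
    also have "\<dots> < \<infinity>" by simp
    finally show "emeasure ?M {x \<in> space ?M. c \<noteq> 0} \<noteq> \<infinity>" by simp
  qed simp
  have cI: "Bochner_Integration.simple_bochner_integral ?M (\<lambda>_. c) = (b - a) *\<^sub>R c"
  proof -
    have I: "(\<lambda>_. c) ` space ?M = {c}" using ab by (auto simp: space_restrict_space)
    have J: "{x \<in> space ?M. c = c} = space ?M" by blast
    have "Bochner_Integration.simple_bochner_integral ?M (\<lambda>_. c) = (\<Sum>y\<in>{c}. measure ?M {x \<in> space ?M. c = y} *\<^sub>R y)"
      unfolding Bochner_Integration.simple_bochner_integral_def I ..
    also have "\<dots> = measure ?M {x \<in> space ?M. c = c} *\<^sub>R c" by simp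
    also have "\<dots> = (b - a) *\<^sub>R c" unfolding J me ..
    finally show ?thesis .
  qed
  have le: "ennreal (norm (Bochner_Integration.simple_bochner_integral ?M (s i) - (b - a) *\<^sub>R c))
      \<le> (\<integral>\<^sup>+x. ennreal (norm (f x - s i x)) \<partial>?M) + ennreal (C * (b - a))" for i
  proof -
    have sc: "Bochner_Integration.simple_bochner_integrable ?M (\<lambda>x. s i x - c)"
      by (rule simple_bochner_integrable_compose2[OF _ s(1) ci]) simp
    then have scn: "Bochner_Integration.simple_bochner_integrable ?M (\<lambda>x. norm (s i x - c))"
      using simple_bochner_integrable_compose2[of "\<lambda>x y. norm x", OF _ sc sc] by simp
    then have "simple_function ?M (\<lambda>x. norm (s i x - c))"
      by (auto elim: Bochner_Integration.simple_bochner_integrable.cases)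
    then have [measurable]: "(\<lambda>x. norm (s i x - c)) \<in> borel_measurable ?M"
      by (rule borel_measurable_simple_function)
    have "norm (Bochner_Integration.simple_bochner_integral ?M (s i) - (b - a) *\<^sub>R c)
        = norm (Bochner_Integration.simple_bochner_integral ?M (\<lambda>x. s i x - c))"
      by (simp add: simple_bochner_integral_diff[OF s(1) ci] cI)
    also have "\<dots> \<le> Bochner_Integration.simple_bochner_integral ?M (\<lambda>x. norm (s i x - c))"
      by (rule simple_bochner_integral_norm_bound[OF sc])
    finally have "ennreal (norm (Bochner_Integration.simple_bochner_integral ?M (s i) - (b - a) *\<^sub>R c))
        \<le> (\<integral>\<^sup>+x. ennreal (norm (s i x - c)) \<partial>?M)"
      using simple_bochner_integral_eq_nn_integral[OF scn] by (metis ennreal_leI norm_ge_zero)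
    \<comment> \<open>The bound \<open>C\<close> is known for \<open>f\<close>, not for its
      approximants. What \<open>s i\<close> exceeds it by is at most the distance to
      \<open>f\<close>, whose integral tends to 0.\<close>
    also have "\<dots> \<le> (\<integral>\<^sup>+x. ennreal (max 0 (norm (s i x - c) - C)) + ennreal C \<partial>?M)"
      by (intro nn_integral_mono) (auto simp: C simp flip: ennreal_plus intro!: ennreal_leI)
    also have "\<dots> = (\<integral>\<^sup>+x. ennreal (max 0 (norm (s i x - c) - C)) \<partial>?M) + ennreal C * ennreal (b - a)"
      unfolding em[symmetric] nn_integral_const[symmetric] by (rule nn_integral_add) simp_all
    also have "\<dots> \<le> (\<integral>\<^sup>+x. ennreal (norm (f x - s i x)) \<partial>?M) + ennreal (C * (b - a))"
    proof (intro add_mono)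
      show "(\<integral>\<^sup>+x. ennreal (max 0 (norm (s i x - c) - C)) \<partial>?M) \<le> (\<integral>\<^sup>+x. ennreal (norm (f x - s i x)) \<partial>?M)"
      proof (rule nn_integral_mono_AE, use bd in eventually_elim, rule ennreal_leI)
        fix x assume "norm (f x - c) \<le> C"
        moreover have "norm (s i x - c) \<le> norm (f x - s i x) + norm (f x - c)"
          using norm_triangle_ineq4[of "f x - c" "f x - s i x"] by simp
        ultimately show "max 0 (norm (s i x - c) - C) \<le> norm (f x - s i x)" by simp
      qed
    qed (use C ab in \<open>simp add: ennreal_mult\<close>)
    finally show ?thesis .
  qed
  have "(\<lambda>i. ennreal (norm (Bochner_Integration.simple_bochner_integral ?M (s i) - (b - a) *\<^sub>R c)))
      \<longlonglongrightarrow> ennreal (norm (y - (b - a) *\<^sub>R c))"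
    by (intro tendsto_intros s(3))
  moreover have "(\<lambda>i. (\<integral>\<^sup>+x. ennreal (norm (f x - s i x)) \<partial>?M) + ennreal (C * (b - a))) \<longlonglongrightarrow> 0 + ennreal (C * (b - a))"
    by (intro tendsto_add s(2) tendsto_const)
  ultimately have "ennreal (norm (y - (b - a) *\<^sub>R c)) \<le> 0 + ennreal (C * (b - a))"
    by (rule LIMSEQ_le) (use le in blast)
  then show ?thesis using C ab by (simp add: ennreal_le_iff)
qed

lemma has_oriented_integral_bound:
  fixes f :: "real \<Rightarrow> 'b::real_normed_vector"
  assumes int: "has_oriented_integral f y a b" and C: "0 \<le> C"
    and bd: "AE t in lebesgue_on {min a b..max a b}. norm (f t - c) \<le> C"
  shows "norm (y - (b - a) *\<^sub>R c) \<le> C * \<bar>b - a\<bar>"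
proof (cases "a \<le> b")
  case True
  then show ?thesis
    using has_strong_bochner_integral_bound[of a b f y C c] int bd C
    unfolding has_oriented_integral_def min_absorb1[OF True] max_absorb2[OF True] by simp
next
  case False
  then have ba: "b \<le> a" by simp
  have "norm (- y - (a - b) *\<^sub>R c) \<le> C * (a - b)"
    using has_strong_bochner_integral_bound[of b a f "- y" C c] int bd C False ba
    unfolding has_oriented_integral_def min_absorb2[OF ba] max_absorb1[OF ba] by simp
  also have "- y - (a - b) *\<^sub>R c = - (y - (b - a) *\<^sub>R c)" by (simp add: algebra_simps)
  finally show ?thesis using False by (simp only: norm_minus_cancel) simp
qed

lemma op_norm_bound:
  assumes B: "bounded_op D N B" and N: "\<And>x. 0 \<le> N x" and x: "x \<in> D"
  shows "norm (B x) \<le> op_norm D N B * N x"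
proof -
  let ?S = "{K. 0 \<le> K \<and> (\<forall>x\<in>D. norm (B x) \<le> K * N x)}"
  obtain K where K: "\<And>x. x \<in> D \<Longrightarrow> norm (B x) \<le> K * N x" using B unfolding bounded_op_def by blast
  then have K': "\<bar>K\<bar> \<in> ?S"
    using N by (auto intro: order_trans[OF K mult_right_mono])
  show ?thesis
  proof (cases "N x = 0")
    case True
    then show ?thesis using K[OF x] by simp
  next
    case False
    then have pos: "N x > 0" using N[of x] by simp
    have "norm (B x) / N x \<le> Inf ?S"
    proof (rule cInf_greatest)
      show "?S \<noteq> {}" using K' by blast
    qed (use x pos in \<open>auto simp: divide_le_eq\<close>)
    then show ?thesis using pos by (simp add: op_norm_def divide_le_eq)
  qed
qed

lemma AE_lebesgue_on_subset:
  assumes "AE t in lebesgue_on {c..d}. Q t" "{a..b} \<subseteq> {c..d}"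
  shows "AE t in lebesgue_on {a..b}. Q (t :: real)"
  using assms by (subst (asm) AE_restrict_space_iff, simp, subst AE_restrict_space_iff) auto

text \<open>This estimate is the form in which weak differentiability enters the later arguments:
  operators at two times are compared without any differentiability in norm. The constant refers to
  the norm \<open>N\<close>, hence for \<open>A\<close> to the graph norm of A(0).\<close>

lemma W_deriv_lipschitz:
  assumes W: "W_deriv {c..d} D N A B" and N: "\<And>x. 0 \<le> N x"
  obtains C where "0 \<le> C"
    "\<And>s t x. s \<in> {c..d} \<Longrightarrow> t \<in> {c..d} \<Longrightarrow> x \<in> D \<Longrightarrow> norm (A t x - A s x) \<le> C * \<bar>t - s\<bar> * N x"
proof -
  obtain C where C: "AE t in lebesgue_on {c..d}. op_norm D N (B t) \<le> C"
    using W unfolding W_deriv_def Linf_star_def by blast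
  have "norm (A t x - A s x) \<le> \<bar>C\<bar> * \<bar>t - s\<bar> * N x" if "s \<in> {c..d}" "t \<in> {c..d}" "x \<in> D" for s t x
  proof -
    have "AE \<tau> in lebesgue_on {c..d}. norm (B \<tau> x - 0) \<le> \<bar>C\<bar> * N x"
    proof (use C AE_space in eventually_elim)
      fix \<tau> assume \<tau>: "op_norm D N (B \<tau>) \<le> C" "\<tau> \<in> space (lebesgue_on {c..d})"
      have "bounded_op D N (B \<tau>)" using W \<tau>(2) unfolding W_deriv_def Linf_star_def by simp
      then have "norm (B \<tau> x) \<le> op_norm D N (B \<tau>) * N x" by (rule op_norm_bound) (use N that in auto)
      also have "\<dots> \<le> \<bar>C\<bar> * N x" using \<tau>(1) N by (intro mult_right_mono) auto
      finally show "norm (B \<tau> x - 0) \<le> \<bar>C\<bar> * N x" by simp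
    qed
    then have "AE \<tau> in lebesgue_on {min s t..max s t}. norm (B \<tau> x - 0) \<le> \<bar>C\<bar> * N x"
      by (rule AE_lebesgue_on_subset) (use that in auto)
    moreover have "has_oriented_integral (\<lambda>\<tau>. B \<tau> x) (A t x - A s x) s t"
      using W that unfolding W_deriv_def by blast
    ultimately have "norm (A t x - A s x - (t - s) *\<^sub>R 0) \<le> \<bar>C\<bar> * N x * \<bar>t - s\<bar>"
      by (intro has_oriented_integral_bound[of "\<lambda>\<tau>. B \<tau> x"]) (use N in auto)
    then show ?thesis by (simp add: mult_ac)
  qed
  then show ?thesis by (intro that[of "\<bar>C\<bar>"]) auto
qed

lemma bounded_op_imp_bounded_clinear:
  assumes "bounded_op UNIV norm B" shows "bounded_clinear B"
proof -
  obtain K where lin: "clinear_on UNIV B" and K: "\<And>x. norm (B x) \<le> K * norm x"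
    using assms unfolding bounded_op_def by blast
  have "bounded_linear B"
  proof (rule bounded_linear_intro[where K=K])
    show "B (r *\<^sub>R x) = r *\<^sub>R B x" for r x
      using lin unfolding clinear_on_def by (metis UNIV_I scaleC_of_real)
  qed (use lin K in \<open>auto simp: clinear_on_def mult.commute\<close>)
  with lin show ?thesis by (simp add: bounded_clinear_def clinear_on_def)
qed

lemma graph_norm_nonneg: "0 \<le> graph_norm A x"
  by (simp add: graph_norm_def)

subsection \<open>Bounded Lipschitz families\<close>

text \<open>Boundedness is part of the notion so that products of such families are again such
  families.\<close>

definition lip_family :: "'c::real_normed_vector set \<Rightarrow> ('c \<Rightarrow> 'b::real_normed_vector) \<Rightarrow> bool" where
  "lip_family J f \<longleftrightarrow> (\<exists>K\<ge>0. (\<forall>t\<in>J. norm (f t) \<le> K) \<and> (\<forall>s\<in>J. \<forall>t\<in>J. norm (f t - f s) \<le> K * norm (t - s)))"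

lemma lip_familyI:
  assumes "\<And>t. t \<in> J \<Longrightarrow> norm (f t) \<le> K" "\<And>s t. s \<in> J \<Longrightarrow> t \<in> J \<Longrightarrow> norm (f t - f s) \<le> L * norm (t - s)"
  shows "lip_family J f"
  unfolding lip_family_def
proof (intro exI[of _ "max 0 (max K L)"] conjI ballI)
  fix s t assume "s \<in> J" "t \<in> J"
  then show "norm (f t - f s) \<le> max 0 (max K L) * norm (t - s)"
    by (intro order_trans[OF assms(2)] mult_right_mono) auto
qed (auto intro: order_trans[OF assms(1)])

lemma lip_familyE:
  assumes "lip_family J f"
  obtains K where "K \<ge> 0" "\<And>t. t \<in> J \<Longrightarrow> norm (f t) \<le> K"
    "\<And>s t. s \<in> J \<Longrightarrow> t \<in> J \<Longrightarrow> norm (f t - f s) \<le> K * norm (t - s)"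
  using assms unfolding lip_family_def by blast

lemma lip_family_const: "lip_family J (\<lambda>_. c)"
  by (rule lip_familyI[where K="norm c" and L=0]) auto

lemma lip_family_subset: "lip_family J f \<Longrightarrow> J' \<subseteq> J \<Longrightarrow> lip_family J' f"
  unfolding lip_family_def by blast

lemma lip_family_add:
  assumes "lip_family J f" "lip_family J g" shows "lip_family J (\<lambda>t. f t + g t)"
proof -
  obtain K where K: "K \<ge> 0" "\<And>t. t \<in> J \<Longrightarrow> norm (f t) \<le> K"
    "\<And>s t. s \<in> J \<Longrightarrow> t \<in> J \<Longrightarrow> norm (f t - f s) \<le> K * norm (t - s)" using assms(1) by (rule lip_familyE) blast
  obtain L where L: "L \<ge> 0" "\<And>t. t \<in> J \<Longrightarrow> norm (g t) \<le> L"
    "\<And>s t. s \<in> J \<Longrightarrow> t \<in> J \<Longrightarrow> norm (g t - g s) \<le> L * norm (t - s)" using assms(2) by (rule lip_familyE) blast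
  show ?thesis
  proof (rule lip_familyI)
    show "norm (f t + g t) \<le> K + L" if "t \<in> J" for t
      using norm_triangle_mono[OF K(2) L(2)] that by blast
    show "norm (f t + g t - (f s + g s)) \<le> (K + L) * norm (t - s)" if "s \<in> J" "t \<in> J" for s t
      using norm_triangle_mono[OF K(3)[OF that] L(3)[OF that]] by (simp add: algebra_simps)
  qed
qed

lemma lip_family_bilinear:
  assumes B: "bounded_bilinear pr" and f: "lip_family J f" and g: "lip_family J g"
  shows "lip_family J (\<lambda>t. pr (f t) (g t))"
proof -
  interpret bounded_bilinear pr by (rule B)
  obtain M where M: "M \<ge> 0" "\<And>a b. norm (pr a b) \<le> norm a * norm b * M" using nonneg_bounded by blast
  obtain K where K: "K \<ge> 0" "\<And>t. t \<in> J \<Longrightarrow> norm (f t) \<le> K"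
    "\<And>s t. s \<in> J \<Longrightarrow> t \<in> J \<Longrightarrow> norm (f t - f s) \<le> K * norm (t - s)" using f by (rule lip_familyE) blast
  obtain L where L: "L \<ge> 0" "\<And>t. t \<in> J \<Longrightarrow> norm (g t) \<le> L"
    "\<And>s t. s \<in> J \<Longrightarrow> t \<in> J \<Longrightarrow> norm (g t - g s) \<le> L * norm (t - s)" using g by (rule lip_familyE) blast
  show ?thesis
  proof (rule lip_familyI)
    show "norm (pr (f t) (g t)) \<le> K * L * M" if "t \<in> J" for t
      using that K L M by (intro order_trans[OF M(2)] mult_right_mono mult_mono) auto
    fix s t assume st: "s \<in> J" "t \<in> J"
    have "pr (f t) (g t) - pr (f s) (g s) = pr (f t - f s) (g t) + pr (f s) (g t - g s)"
      by (simp add: diff_left diff_right)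
    also have "norm \<dots> \<le> (K * norm (t - s)) * L * M + K * (L * norm (t - s)) * M"
      using st K L M by (intro norm_triangle_mono order_trans[OF M(2)] mult_right_mono mult_mono) auto
    also have "\<dots> = (2 * K * L * M) * norm (t - s)" by (simp add: algebra_simps)
    finally show "norm (pr (f t) (g t) - pr (f s) (g s)) \<le> (2 * K * L * M) * norm (t - s)" .
  qed
qed

lemmas lip_family_mult = lip_family_bilinear[OF bounded_bilinear_mult]
lemmas lip_family_scaleR_const = lip_family_bilinear[OF bounded_bilinear_scaleR lip_family_const]
lemmas lip_family_scaleC_const = lip_family_bilinear[OF bounded_bilinear_scaleC lip_family_const]

lemma lip_family_diff:
  assumes "lip_family J f" "lip_family J g" shows "lip_family J (\<lambda>t. f t - g t)"
  using lip_family_add[OF assms(1) lip_family_scaleR_const[OF assms(2), of "- 1"]] by simp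

lemma bounded_bilinear_capp: "bounded_bilinear (capp :: 'a::complex_banach cop \<Rightarrow> _)"
proof
  show "\<exists>K. \<forall>f (x::'a). norm (capp f x) \<le> norm f * norm x * K"
    by (intro exI[of _ 1] allI) (simp add: norm_capp)
qed (simp_all add: capp_simps linear_add[OF linear_capp]
    linear_scale[OF linear_capp])

lemma lip_family_mult_op:
  fixes f :: "'c::real_normed_vector \<Rightarrow> 'b::complex_banach_algebra"
  assumes "lip_family J f"
  shows "lip_family J (\<lambda>t. left_mult_op (f t))" "lip_family J (\<lambda>t. right_mult_op (f t))"
proof -
  obtain K where K: "K \<ge> 0" "\<And>t. t \<in> J \<Longrightarrow> norm (f t) \<le> K"
    "\<And>s t. s \<in> J \<Longrightarrow> t \<in> J \<Longrightarrow> norm (f t - f s) \<le> K * norm (t - s)" using assms by (rule lip_familyE) blast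
  have 0: "left_mult_op (0::'b) = 0" "right_mult_op (0::'b) = 0" by (auto intro!: cop_eqI simp: capp_simps)
  show "lip_family J (\<lambda>t. left_mult_op (f t))"
  proof (rule lip_familyI)
    show "norm (left_mult_op (f t)) \<le> K" if "t \<in> J" for t
      using norm_mult_op_diff(1)[of "f t" 0] K(2)[OF that] by (simp add: 0)
    show "norm (left_mult_op (f t) - left_mult_op (f s)) \<le> K * norm (t - s)" if "s \<in> J" "t \<in> J" for s t
      using norm_mult_op_diff(1) K(3)[OF that] order_trans by blast
  qed
  show "lip_family J (\<lambda>t. right_mult_op (f t))"
  proof (rule lip_familyI)
    show "norm (right_mult_op (f t)) \<le> K" if "t \<in> J" for t
      using norm_mult_op_diff(2)[of "f t" 0] K(2)[OF that] by (simp add: 0)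
    show "norm (right_mult_op (f t) - right_mult_op (f s)) \<le> K * norm (t - s)" if "s \<in> J" "t \<in> J" for s t
      using norm_mult_op_diff(2) K(3)[OF that] order_trans by blast
  qed
qed

text \<open>Invertibility is assumed at \<open>t0\<close> only and spreads by perturbation to a
  radius where the inverses have at most twice the norm; the difference identity then turns
  Lipschitz dependence of \<open>T\<close> into that of the inverses.\<close>

lemma lip_family_ainv:
  fixes T :: "'c::real_normed_vector \<Rightarrow> 'b::complex_banach_algebra"
  assumes T: "lip_family J T" and t0: "t0 \<in> J" and inv: "ainvertible (T t0)"
  obtains \<delta> where "\<delta> > 0" "\<And>t. t \<in> J \<Longrightarrow> norm (t - t0) < \<delta> \<Longrightarrow> ainvertible (T t)"
    "lip_family (J \<inter> ball t0 \<delta>) (\<lambda>t. ainv (T t))"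
proof -
  obtain K where K: "K \<ge> 0" "\<And>s t. s \<in> J \<Longrightarrow> t \<in> J \<Longrightarrow> norm (T t - T s) \<le> K * norm (t - s)"
    using T by (rule lip_familyE) blast
  obtain d where d: "d > 0" "\<And>h::'b. norm h < d \<Longrightarrow> norm h * norm (ainv (T t0)) \<le> 1/2"
    using ainv_perturb_radius[of "T t0"] by blast
  define \<delta> where "\<delta> = d / (K + 1)"
  have \<delta>: "\<delta> > 0" using d K by (simp add: \<delta>_def add_nonneg_pos)
  let ?N = "norm (ainv (T t0))"
  have near: "ainvertible (T t) \<and> norm (ainv (T t)) \<le> 2 * ?N" if t: "t \<in> J" "norm (t - t0) < \<delta>" for t
  proof -
    have "norm (T t - T t0) \<le> K * norm (t - t0)" by (rule K(2)[OF t0 t(1)])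
    also have "\<dots> \<le> (K + 1) * norm (t - t0)" by (intro mult_right_mono) auto
    also have "\<dots> < d" using t(2) K(1) by (simp add: \<delta>_def pos_less_divide_eq mult.commute add_nonneg_pos)
    finally have "norm (T t - T t0) * ?N \<le> 1/2" by (rule d(2))
    from ainv_perturb(1,2)[OF inv this] show ?thesis by simp
  qed
  have "lip_family (J \<inter> ball t0 \<delta>) (\<lambda>t. ainv (T t))"
  proof (rule lip_familyI)
    show "norm (ainv (T t)) \<le> 2 * ?N" if "t \<in> J \<inter> ball t0 \<delta>" for t
      using near[of t] that by (auto simp: dist_norm norm_minus_commute)
    fix s t assume st: "s \<in> J \<inter> ball t0 \<delta>" "t \<in> J \<inter> ball t0 \<delta>"
    then have s: "ainvertible (T s)" "norm (ainv (T s)) \<le> 2 * ?N"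
      and t: "ainvertible (T t)" "norm (ainv (T t)) \<le> 2 * ?N"
      using near[of s] near[of t] by (auto simp: dist_norm norm_minus_commute)
    have "ainv (T t) * (T s - T t) * ainv (T s) = ainv (T t) * (T s * ainv (T s)) - (ainv (T t) * T t) * ainv (T s)"
      by (simp add: algebra_simps)
    also have "\<dots> = ainv (T t) - ainv (T s)" by (simp add: ainv s t)
    finally have "norm (ainv (T t) - ainv (T s)) \<le> norm (ainv (T t)) * norm (T s - T t) * norm (ainv (T s))"
      using norm_mult3_le by metis
    also have "\<dots> \<le> (2 * ?N) * (K * norm (t - s)) * (2 * ?N)"
      using s t st K(2)[of t s] K(1) by (intro mult_mono) (auto simp: norm_minus_commute)
    finally show "norm (ainv (T t) - ainv (T s)) \<le> (4 * ?N * K * ?N) * norm (t - s)"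
      by (simp add: mult_ac)
  qed
  with \<delta> near show ?thesis by (intro that[of \<delta>]) auto
qed

subsection \<open>The commutator equation\<close>

text \<open>The off-diagonal blocks of the commutator equation are Sylvester equations with coefficients
  \<open>g p + \<alpha> (1 - p)\<close> and \<open>g (1 - p)\<close>, whose spectra are disjoint.\<close>

lemma commutator_equation_lipschitz:
  fixes g p z :: "'c::real_normed_vector \<Rightarrow> 'b::complex_banach_algebra"
  assumes lip: "lip_family J g" "lip_family J p" "lip_family J z" and t0: "t0 \<in> J"
    and idem: "\<And>t. t \<in> J \<Longrightarrow> p t * p t = p t" and comm: "\<And>t. t \<in> J \<Longrightarrow> g t * p t = p t * g t"
    and off: "\<And>t. t \<in> J \<Longrightarrow> p t * z t * p t = 0" "\<And>t. t \<in> J \<Longrightarrow> (1 - p t) * z t * (1 - p t) = 0"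
    and disj: "rho (g t0 * p t0 + \<alpha> *\<^sub>C (1 - p t0)) \<union> rho (g t0 * (1 - p t0)) = UNIV"
  obtains \<delta> B where "\<delta> > 0" "lip_family (J \<inter> ball t0 \<delta>) B"
    "\<And>t. t \<in> J \<inter> ball t0 \<delta> \<Longrightarrow> g t * B t - B t * g t = z t"
proof -
  define q where "q t = 1 - p t" for t
  define g1 where "g1 t = g t * p t + \<alpha> *\<^sub>C q t" for t
  define g2 where "g2 t = g t * q t" for t
  define S where "S t = left_mult_op (g2 t) - right_mult_op (g1 t)" for t
  define T where "T t = left_mult_op (g1 t) - right_mult_op (g2 t)" for t
  have lq: "lip_family J q" unfolding q_def by (intro lip_family_diff lip_family_const lip)
  have l1: "lip_family J g1" unfolding g1_def by (intro lip_family_add lip_family_mult lip_family_scaleC_const lip lq)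
  have l2: "lip_family J g2" unfolding g2_def by (intro lip_family_mult lip lq)
  have lS: "lip_family J S" unfolding S_def by (intro lip_family_diff lip_family_mult_op l1 l2)
  have lT: "lip_family J T" unfolding T_def by (intro lip_family_diff lip_family_mult_op l1 l2)
  have disj': "rho (g1 t0) \<union> rho (g2 t0) = UNIV" using disj by (simp add: g1_def g2_def q_def)
  have commops: "left_mult_op a * right_mult_op b = right_mult_op b * left_mult_op a" for a b :: 'b
    by (rule cop_eqI) (simp add: capp_simps mult.assoc)
  \<comment> \<open>Rosenblum's theorem is used at the single time \<open>t0\<close>; nearby times
    are reached by perturbation of \<open>S\<close> and \<open>T\<close>.\<close>
  have iS: "ainvertible (S t0)"
    unfolding S_def using rho_mult_op[of "g1 t0"] rho_mult_op[of "g2 t0"] disj'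
    by (intro ainvertible_diff_of_disjoint_spectra commops) blast
  have iT: "ainvertible (T t0)"
    unfolding T_def using rho_mult_op[of "g1 t0"] rho_mult_op[of "g2 t0"] disj'
    by (intro ainvertible_diff_of_disjoint_spectra commops) blast
  obtain \<delta>1 where \<delta>1: "\<delta>1 > 0" "\<And>t. t \<in> J \<Longrightarrow> norm (t - t0) < \<delta>1 \<Longrightarrow> ainvertible (S t)"
    "lip_family (J \<inter> ball t0 \<delta>1) (\<lambda>t. ainv (S t))" using lip_family_ainv[OF lS t0 iS] by blast
  obtain \<delta>2 where \<delta>2: "\<delta>2 > 0" "\<And>t. t \<in> J \<Longrightarrow> norm (t - t0) < \<delta>2 \<Longrightarrow> ainvertible (T t)"
    "lip_family (J \<inter> ball t0 \<delta>2) (\<lambda>t. ainv (T t))" using lip_family_ainv[OF lT t0 iT] by blast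
  define \<delta> where "\<delta> = min \<delta>1 \<delta>2"
  let ?J = "J \<inter> ball t0 \<delta>"
  have sub: "?J \<subseteq> J" "?J \<subseteq> J \<inter> ball t0 \<delta>1" "?J \<subseteq> J \<inter> ball t0 \<delta>2" by (auto simp: \<delta>_def)
  define x where "x t = capp (ainv (S t)) (q t * z t * p t)" for t
  define y where "y t = capp (ainv (T t)) (p t * z t * q t)" for t
  \<comment> \<open>Only the two off-diagonal corners are kept; there the padding \<alpha> (1 - p)
    of \<open>g1\<close> drops out, as q p = p q = 0.\<close>
  define B where "B t = q t * x t * p t + p t * y t * q t" for t
  note lJ = lip_family_subset[OF _ sub(1)]
  have "lip_family ?J x" unfolding x_def
    by (intro lip_family_bilinear[OF bounded_bilinear_capp] lip_family_subset[OF \<delta>1(3) sub(2)] lip_family_mult lJ lip lq)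
  moreover have "lip_family ?J y" unfolding y_def
    by (intro lip_family_bilinear[OF bounded_bilinear_capp] lip_family_subset[OF \<delta>2(3) sub(3)] lip_family_mult lJ lip lq)
  ultimately have lB: "lip_family ?J B"
    unfolding B_def by (intro lip_family_add lip_family_mult lJ[OF lip(2)] lJ[OF lq])
  have "g t * B t - B t * g t = z t" if t: "t \<in> ?J" for t
  proof -
    have tJ: "t \<in> J" and inv: "ainvertible (S t)" "ainvertible (T t)"
      using t \<delta>1(2) \<delta>2(2) by (auto simp: \<delta>_def dist_norm norm_minus_commute)
    have "capp (S t) (x t) = capp (S t * ainv (S t)) (q t * z t * p t)"
      by (simp add: x_def capp_simps)
    also have "\<dots> = q t * z t * p t" unfolding ainv(1)[OF inv(1)] by (simp add: capp_simps)
    finally have X: "g2 t * x t - x t * g1 t = q t * z t * p t"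
      by (simp add: capp_simps S_def)
    have "capp (T t) (y t) = capp (T t * ainv (T t)) (p t * z t * q t)"
      by (simp add: y_def capp_simps)
    also have "\<dots> = p t * z t * q t" unfolding ainv(1)[OF inv(2)] by (simp add: capp_simps)
    finally have Y: "g1 t * y t - y t * g2 t = p t * z t * q t"
      by (simp add: capp_simps T_def)
    have pp: "p t * p t = p t" and gp: "g t * p t = p t * g t" by (auto intro: idem comm tJ)
    have qq: "q t * q t = q t" "q t * p t = 0" "p t * q t = 0" "g t * q t = q t * g t"
      by (simp_all add: q_def algebra_simps pp gp)
    have e1: "q t * g2 t = g t * q t" "g1 t * p t = p t * g t" "p t * g1 t = g t * p t" "g2 t * q t = q t * g t"
    proof -
      have "q t * g2 t = q t * g t * q t" by (simp add: g2_def mult.assoc)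
      also have "\<dots> = g t * (q t * q t)" unfolding qq(4)[symmetric] by (rule mult.assoc)
      finally show "q t * g2 t = g t * q t" by (simp add: qq)
      have "g1 t * p t = g t * (p t * p t) + \<alpha> *\<^sub>C (q t * p t)"
        by (simp add: g1_def distrib_right mult.assoc scaleC_mult_left)
      then show "g1 t * p t = p t * g t" by (simp add: pp qq gp)
      have "p t * g1 t = p t * g t * p t + \<alpha> *\<^sub>C (p t * q t)"
        by (simp add: g1_def distrib_left mult.assoc scaleC_mult_right)
      also have "p t * g t * p t = g t * (p t * p t)" unfolding gp[symmetric] by (rule mult.assoc)
      finally show "p t * g1 t = g t * p t" by (simp add: pp qq)
      show "g2 t * q t = q t * g t" by (simp add: g2_def mult.assoc qq(1)) (rule qq(4))
    qed
    have "g t * (q t * x t * p t) - (q t * x t * p t) * g t = (g t * q t) * x t * p t - q t * x t * (p t * g t)"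
      by (simp add: mult.assoc)
    also have "\<dots> = q t * (g2 t * x t - x t * g1 t) * p t"
      unfolding e1[symmetric] by (simp add: algebra_simps)
    also have "\<dots> = (q t * q t) * z t * (p t * p t)" unfolding X by (simp add: mult.assoc)
    finally have 1: "g t * (q t * x t * p t) - (q t * x t * p t) * g t = q t * z t * p t" by (simp add: qq pp)
    have "g t * (p t * y t * q t) - (p t * y t * q t) * g t = (g t * p t) * y t * q t - p t * y t * (q t * g t)"
      by (simp add: mult.assoc)
    also have "\<dots> = p t * (g1 t * y t - y t * g2 t) * q t"
      unfolding e1(3,4)[symmetric] by (simp add: algebra_simps)
    also have "\<dots> = (p t * p t) * z t * (q t * q t)" unfolding Y by (simp add: mult.assoc)
    finally have 2: "g t * (p t * y t * q t) - (p t * y t * q t) * g t = p t * z t * q t" by (simp add: qq pp)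
    have "g t * B t - B t * g t = q t * z t * p t + p t * z t * q t"
      unfolding 1[symmetric] 2[symmetric] B_def by (simp add: algebra_simps)
    \<comment> \<open>As q + p = 1 and the diagonal corners of \<open>z\<close> vanish by
      \<open>off\<close>, the two corners make up all of \<open>z\<close>.\<close>
    also have "\<dots> = (q t + p t) * z t * (q t + p t) - p t * z t * p t - q t * z t * q t"
      by (simp add: algebra_simps)
    also have "\<dots> = z t" using off[OF tJ] by (simp add: q_def)
    finally show ?thesis .
  qed
  moreover have "\<delta> > 0" using \<delta>1 \<delta>2 by (simp add: \<delta>_def)
  ultimately show ?thesis using lB that by blast
qed

subsection \<open>Resolvents and associated projections\<close>

lemma clinear_on_D:
  assumes "clinear_on D A"
  shows "x \<in> D \<Longrightarrow> y \<in> D \<Longrightarrow> x + y \<in> D" "x \<in> D \<Longrightarrow> c *\<^sub>C x \<in> D"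
    "x \<in> D \<Longrightarrow> y \<in> D \<Longrightarrow> A (x + y) = A x + A y" "x \<in> D \<Longrightarrow> A (c *\<^sub>C x) = c *\<^sub>C A x"
    "x \<in> D \<Longrightarrow> y \<in> D \<Longrightarrow> x - y \<in> D" "x \<in> D \<Longrightarrow> y \<in> D \<Longrightarrow> A (x - y) = A x - A y"
    "x \<in> D \<Longrightarrow> r *\<^sub>R x \<in> D" "x \<in> D \<Longrightarrow> A (r *\<^sub>R x) = r *\<^sub>R A x" "0 \<in> D" "A 0 = 0"
proof -
  show 1: "x \<in> D \<Longrightarrow> y \<in> D \<Longrightarrow> x + y \<in> D" "x \<in> D \<Longrightarrow> c *\<^sub>C x \<in> D"
    "x \<in> D \<Longrightarrow> y \<in> D \<Longrightarrow> A (x + y) = A x + A y" "x \<in> D \<Longrightarrow> A (c *\<^sub>C x) = c *\<^sub>C A x"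
    and 0: "0 \<in> D" for x y c
    using assms unfolding clinear_on_def csubspace_def by blast+
  show "x \<in> D \<Longrightarrow> r *\<^sub>R x \<in> D" "x \<in> D \<Longrightarrow> A (r *\<^sub>R x) = r *\<^sub>R A x"
    using 1(2,4)[of x "of_real r"] by (simp_all add: scaleC_of_real)
  have m: "- 1 *\<^sub>C y = - y" for y :: 'a by (simp add: scaleC.minus_left)
  show "x \<in> D \<Longrightarrow> y \<in> D \<Longrightarrow> x - y \<in> D" "x \<in> D \<Longrightarrow> y \<in> D \<Longrightarrow> A (x - y) = A x - A y"
    using 1(1,3)[of x "- 1 *\<^sub>C y"] 1(2,4)[of y "- 1"] by (simp_all add: m)
  show "A 0 = 0" using 1(4)[OF 0, of 0] by simp
qed

text \<open>A closed operator after a bounded one with values in \<open>D\<close> is everywhere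
  defined with closed graph, hence bounded; this turns products such as \<open>A P\<close> into
  elements of the algebra.\<close>

lemma closed_comp_cop:
  assumes A: "clinear_on D A" "closed {(x, A x) |x. x \<in> D}" and S: "\<And>x. capp S x \<in> D"
  obtains W where "\<And>x. capp W x = A (capp S x)"
proof -
  note linS = bounded_linear.linear[OF bounded_linear_capp[of S]]
  have "bounded_linear (\<lambda>x. A (capp S x))"
  proof (rule closed_graph)
    show "linear (\<lambda>x. A (capp S x))"
      by (rule linearI) (simp_all add: linear_add[OF linS] linear_scale[OF linS] clinear_on_D[OF A(1)] S)
    fix x l y assume x: "x \<longlonglongrightarrow> l" and y: "(\<lambda>n::nat. A (capp S (x n))) \<longlonglongrightarrow> y"
    have "(\<lambda>n. (capp S (x n), A (capp S (x n)))) \<longlonglongrightarrow> (capp S l, y)"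
      by (intro tendsto_Pair y bounded_linear.tendsto[OF bounded_linear_capp x])
    then have "(capp S l, y) \<in> {(x, A x) |x. x \<in> D}"
      by (rule closed_sequentially[OF A(2), rotated]) (use S in auto)
    then show "A (capp S l) = y" by auto
  qed
  then have "bounded_clinear (\<lambda>x. A (capp S x))"
    by (simp add: bounded_clinear_def capp_scaleC_right clinear_on_D[OF A(1)] S)
  then show ?thesis by (intro that[of "cop_of (\<lambda>x. A (capp S x))"]) (simp add: capp_cop_of)
qed

text \<open>The sign convention is (A - \<mu>)^-1, whereas \<open>res a z\<close> inverts z - a; a
  point \<zeta> of the spectrum of \<open>A\<close> thus corresponds to 1/(\<zeta> - \<mu>) for
  \<open>G\<close>.\<close>

definition is_resolvent :: "'a::complex_banach set \<Rightarrow> ('a \<Rightarrow> 'a) \<Rightarrow> complex \<Rightarrow> 'a cop \<Rightarrow> bool" where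
  "is_resolvent D A \<mu> G \<longleftrightarrow> (\<forall>x. capp G x \<in> D \<and> A (capp G x) - \<mu> *\<^sub>C capp G x = x) \<and>
     (\<forall>x\<in>D. capp G (A x - \<mu> *\<^sub>C x) = x)"

text \<open>The inverse of A - \<zeta> acts only on the range of \<open>Q\<close>; preceding it by
  \<open>Q\<close> makes it an operator on the whole space, hence an element of the algebra. With Q
  = 1 this is the ordinary resolvent.\<close>

lemma corner_resolvent:
  assumes A: "clinear_on D A" and Q: "\<And>x. x \<in> D \<Longrightarrow> capp Q x \<in> D"
    and \<zeta>: "\<zeta> \<in> resolvent_set (range (capp Q)) (capp Q ` D) A"
  obtains r where "\<And>x. capp r x \<in> capp Q ` D" "\<And>x. A (capp r x) - \<zeta> *\<^sub>C capp r x = capp Q x"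
    "\<And>v u. v \<in> capp Q ` D \<Longrightarrow> A v - \<zeta> *\<^sub>C v = capp Q u \<Longrightarrow> capp r u = v"
proof -
  let ?E = "capp Q ` D" and ?L = "\<lambda>x. A x - \<zeta> *\<^sub>C x"
  note linQ = bounded_linear.linear[OF bounded_linear_capp[of Q]]
  obtain K where bij: "bij_betw ?L ?E (range (capp Q))" and K: "\<And>x. x \<in> ?E \<Longrightarrow> norm x \<le> K * norm (?L x)"
    using \<zeta> unfolding resolvent_set_def by blast
  define R where "R x = inv_into ?E ?L (capp Q x)" for x
  have RE: "R x \<in> ?E" and LR: "?L (R x) = capp Q x" for x
    unfolding R_def using bij by (auto intro!: inv_into_into f_inv_into_f simp: bij_betw_def)
  have uniq: "R u = v" if "v \<in> ?E" "?L v = capp Q u" for u v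
    unfolding R_def that(2)[symmetric] using bij that(1) by (intro inv_into_f_f) (auto simp: bij_betw_def)
  have sub: "?E \<subseteq> D" using Q by auto
  have Eadd: "x + y \<in> ?E" "c *\<^sub>C x \<in> ?E" if xy: "x \<in> ?E" "y \<in> ?E" for x y c
  proof -
    from xy obtain x' y' where "x = capp Q x'" "x' \<in> D" "y = capp Q y'" "y' \<in> D" by auto
    then show "x + y \<in> ?E" "c *\<^sub>C x \<in> ?E"
      using clinear_on_D(1)[OF A, of x' y'] clinear_on_D(2)[OF A, of x' c]
      by (auto simp flip: linear_add[OF linQ] capp_scaleC_right)
  qed
  have Radd: "R (x + y) = R x + R y" for x y
  proof (rule uniq[OF Eadd(1)[OF RE RE]])
    have "?L (R x + R y) = ?L (R x) + ?L (R y)"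
      using clinear_on_D(3)[OF A subsetD[OF sub RE[of x]] subsetD[OF sub RE[of y]]] by (simp add: scaleC_add_right)
    then show "?L (R x + R y) = capp Q (x + y)" by (simp only: LR linear_add[OF linQ])
  qed
  have Rsc: "R (c *\<^sub>C x) = c *\<^sub>C R x" for x c
  proof (rule uniq[OF Eadd(2)[OF RE RE]])
    have "?L (c *\<^sub>C R x) = c *\<^sub>C ?L (R x)"
      using subsetD[OF sub RE] by (simp add: clinear_on_D[OF A] scaleC.diff_right scaleC_scaleC mult.commute)
    then show "?L (c *\<^sub>C R x) = capp Q (c *\<^sub>C x)" by (simp add: LR capp_scaleC_right)
  qed
  have "bounded_linear R"
  proof (rule bounded_linear_intro[where K="\<bar>K\<bar> * norm Q"])
    show "R (r *\<^sub>R x) = r *\<^sub>R R x" for r x using Rsc[of "of_real r" x] by (simp add: scaleC_of_real)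
    show "norm (R x) \<le> norm x * (\<bar>K\<bar> * norm Q)" for x
    proof -
      have "norm (R x) \<le> K * norm (capp Q x)" using K[OF RE[of x]] by (simp add: LR)
      also have "\<dots> \<le> \<bar>K\<bar> * (norm Q * norm x)" by (intro mult_mono norm_capp) auto
      finally show ?thesis by (simp add: mult_ac)
    qed
  qed (rule Radd)
  then have "bounded_clinear R" by (simp add: bounded_clinear_def Rsc)
  then have "capp (cop_of R) = R" by (rule capp_cop_of)
  with RE LR uniq show ?thesis by (intro that[of "cop_of R"]) auto
qed

lemma resolvent_exists:
  assumes "clinear_on D A" "\<mu> \<in> resolvent_set UNIV D A"
  obtains G where "is_resolvent D A \<mu> G"
proof -
  have "range (capp (1::'a cop)) = UNIV" "capp (1::'a cop) ` D = D" by (auto simp: capp_simps)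
  then obtain r where r: "\<And>x. capp r x \<in> D" "\<And>x. A (capp r x) - \<mu> *\<^sub>C capp r x = x"
    "\<And>v u. v \<in> D \<Longrightarrow> A v - \<mu> *\<^sub>C v = u \<Longrightarrow> capp r u = v"
    using corner_resolvent[OF assms(1), of 1 \<mu>] assms(2) by (auto simp: capp_simps)
  show ?thesis by (rule that[of r]) (auto simp: is_resolvent_def r)
qed

lemma is_resolvent_commute:
  assumes G: "is_resolvent D A \<mu> G" and Q: "\<And>x. x \<in> D \<Longrightarrow> capp Q x \<in> D \<and> capp Q (A x) = A (capp Q x)"
  shows "G * Q = Q * G"
proof (rule cop_eqI)
  fix x
  have Gx: "capp G x \<in> D" "A (capp G x) - \<mu> *\<^sub>C capp G x = x" using G by (auto simp: is_resolvent_def)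
  have "capp Q x = capp Q (A (capp G x) - \<mu> *\<^sub>C capp G x)" by (simp only: Gx)
  also have "\<dots> = A (capp Q (capp G x)) - \<mu> *\<^sub>C capp Q (capp G x)"
    using Q[OF Gx(1)] by (simp add: linear_diff[OF linear_capp] capp_scaleC_right)
  finally show "capp (G * Q) x = capp (Q * G) x"
    using G Q[OF Gx(1)] by (simp add: capp_simps is_resolvent_def)
qed

text \<open>The spectral mapping \<zeta> = \<mu> + 1/z inside one corner: regularity of \<zeta> for
  the part of \<open>A\<close> there makes z - G invertible relative to the unit \<open>Q\<close> of
  the corner.\<close>

lemma corner_inverse:
  assumes A: "clinear_on D A" and G: "is_resolvent D A \<mu> G"
    and Q: "\<And>x. x \<in> D \<Longrightarrow> capp Q x \<in> D \<and> capp Q (A x) = A (capp Q x)" and QQ: "Q * Q = Q"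
    and z: "z \<noteq> 0" and \<zeta>: "\<mu> + 1 / z \<in> resolvent_set (range (capp Q)) (capp Q ` D) A"
  obtains w where "(z *\<^sub>C 1 - G) * w = Q" "w * (z *\<^sub>C 1 - G) = Q" "w * Q = w" "Q * w = w"
proof -
  obtain r where r: "\<And>x. capp r x \<in> capp Q ` D" "\<And>x. A (capp r x) - (\<mu> + 1 / z) *\<^sub>C capp r x = capp Q x"
    "\<And>v u. v \<in> capp Q ` D \<Longrightarrow> A v - (\<mu> + 1 / z) *\<^sub>C v = capp Q u \<Longrightarrow> capp r u = v"
    using corner_resolvent[OF A, of Q "\<mu> + 1 / z"] Q \<zeta> by blast
  have GQ: "G * Q = Q * G" by (rule is_resolvent_commute[OF G Q])
  have capQQ: "capp Q (capp Q x) = capp Q x" for x using QQ by (metis capp_simps(3))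
  have rD: "capp r x \<in> D" for x using r(1)[of x] Q by auto
  have Gr: "capp r x = capp G (capp Q x) + (1 / z) *\<^sub>C capp G (capp r x)" for x
  proof -
    have "capp r x = capp G (A (capp r x) - \<mu> *\<^sub>C capp r x)" using G rD by (simp add: is_resolvent_def)
    also have "A (capp r x) - \<mu> *\<^sub>C capp r x = capp Q x + (1 / z) *\<^sub>C capp r x"
      using r(2)[of x] by (simp add: scaleC_add_left algebra_simps)
    finally show ?thesis
      by (simp add: linear_add[OF linear_capp] capp_scaleC_right)
  qed
  have e1: "r = G * Q + (1 / z) *\<^sub>C (G * r)"
    by (rule cop_eqI) (subst Gr, simp add: capp_simps capp_scaleC)
  have e2: "r * G = G * r"
  proof (rule cop_eqI)
    fix x
    let ?v = "capp G (capp r x)"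
    obtain d where d: "d \<in> D" "capp r x = capp Q d" using r(1)[of x] by auto
    have "?v = capp Q (capp G d)" unfolding d(2) using GQ by (metis capp_simps(3))
    moreover have "capp G d \<in> D" using G by (simp add: is_resolvent_def)
    ultimately have vE: "?v \<in> capp Q ` D" by blast
    have "A ?v - \<mu> *\<^sub>C ?v = capp r x" using G by (simp add: is_resolvent_def)
    then have "A ?v - (\<mu> + 1 / z) *\<^sub>C ?v = capp r x - (1 / z) *\<^sub>C ?v"
      by (simp add: scaleC_add_left algebra_simps)
    also have "\<dots> = capp G (capp Q x)" by (subst Gr) simp
    also have "\<dots> = capp Q (capp G x)" using GQ by (metis capp_simps(3))
    finally have "capp r (capp G x) = ?v" by (rule r(3)[OF vE])
    then show "capp (r * G) x = capp (G * r) x" by (simp add: capp_simps)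
  qed
  have e3: "Q * r = r"
  proof (rule cop_eqI)
    fix x
    obtain d where d: "capp r x = capp Q d" using r(1)[of x] by auto
    then show "capp (Q * r) x = capp r x" by (simp add: capp_simps capQQ)
  qed
  have e4: "r * Q = r"
  proof (rule cop_eqI)
    show "capp (r * Q) x = capp r x" for x
      using r(3)[OF r(1)[of x], of "capp Q x"] r(2)[of x] by (simp add: capp_simps capQQ)
  qed
  \<comment> \<open>From 1/(z - 1/x) = 1/z + (1/z^2) / (x - 1/z) with x = A - \<mu>.\<close>
  define w where "w = (1 / z) *\<^sub>C Q + (1 / z\<^sup>2) *\<^sub>C r"
  have "(1 / z) *\<^sub>C r = (1 / z) *\<^sub>C (G * Q) + (1 / z\<^sup>2) *\<^sub>C (G * r)"
    by (subst e1) (simp add: scaleC_add_right scaleC_scaleC power2_eq_square)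
  moreover have "z *\<^sub>C w = Q + (1 / z) *\<^sub>C r"
    using z by (simp add: w_def scaleC_add_right scaleC_scaleC power2_eq_square)
  moreover have "G * w = (1 / z) *\<^sub>C (G * Q) + (1 / z\<^sup>2) *\<^sub>C (G * r)"
    by (simp add: w_def distrib_left scaleC_mult_right)
  ultimately have 1: "z *\<^sub>C w - G * w = Q" by simp
  have "w * G = G * w" by (simp add: w_def distrib_left distrib_right scaleC_mult_left scaleC_mult_right e2 GQ)
  with 1 have 2: "z *\<^sub>C w - w * G = Q" by simp
  show ?thesis
  proof (rule that[of w])
    show "(z *\<^sub>C 1 - G) * w = Q" using 1 by (simp add: left_diff_distrib scaleC_mult_left)
    show "w * (z *\<^sub>C 1 - G) = Q" using 2 by (simp add: right_diff_distrib scaleC_mult_right)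
  qed (simp_all add: w_def distrib_left distrib_right scaleC_mult_left scaleC_mult_right QQ e3 e4)
qed

text \<open>The element is block diagonal, with \<open>G\<close> on the range of \<open>Q\<close>
  and the scalar \<beta> on the complement, so it is inverted block by block. The padding by \<beta>
  makes a corner an element of the full algebra at the price of the single exceptional point z =
  \<beta>.\<close>

lemma rho_of_corner:
  fixes G Q w :: "'b::complex_banach_algebra"
  assumes w: "(z *\<^sub>C 1 - G) * w = Q" "w * (z *\<^sub>C 1 - G) = Q" "w * Q = w" "Q * w = w"
    and Q: "Q * Q = Q" "G * Q = Q * G" and \<beta>: "\<beta> \<noteq> z"
  shows "z \<in> rho (G * Q + \<beta> *\<^sub>C (1 - Q))"
proof -
  let ?g = "z *\<^sub>C 1 - (G * Q + \<beta> *\<^sub>C (1 - Q))" and ?v = "w + (1 / (z - \<beta>)) *\<^sub>C (1 - Q)"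
  have g: "?g = (z *\<^sub>C 1 - G) * Q + (z - \<beta>) *\<^sub>C (1 - Q)" "?g = Q * (z *\<^sub>C 1 - G) + (z - \<beta>) *\<^sub>C (1 - Q)"
    by (simp_all add: algebra_simps scaleC_mult_left scaleC_mult_right scaleC.diff_left scaleC.diff_right Q(2))
  have qQ: "(1 - Q) * w = 0" "w * (1 - Q) = 0" "Q * (1 - Q) = 0" "(1 - Q) * Q = 0" "(1 - Q) * (1 - Q) = 1 - Q"
    using w Q by (simp_all add: algebra_simps)
  let ?c = "1 / (z - \<beta>)"
  have "(z *\<^sub>C 1 - G) * Q * w = Q" "(z *\<^sub>C 1 - G) * Q * (?c *\<^sub>C (1 - Q)) = 0"
    "(z - \<beta>) *\<^sub>C (1 - Q) * w = 0" "(z - \<beta>) *\<^sub>C (1 - Q) * (?c *\<^sub>C (1 - Q)) = 1 - Q"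
    using \<beta> by (simp_all only: mult.assoc w qQ scaleC_mult_left scaleC_mult_right scaleC_scaleC) simp_all
  then have 1: "?g * ?v = 1" unfolding g(1) by (simp only: distrib_left distrib_right) simp
  have "w * (Q * (z *\<^sub>C 1 - G)) = (w * Q) * (z *\<^sub>C 1 - G)" "(1 - Q) * (Q * (z *\<^sub>C 1 - G)) = ((1 - Q) * Q) * (z *\<^sub>C 1 - G)"
    by (simp_all only: mult.assoc)
  then have "w * (Q * (z *\<^sub>C 1 - G)) = Q" "(?c *\<^sub>C (1 - Q)) * (Q * (z *\<^sub>C 1 - G)) = 0"
    "w * ((z - \<beta>) *\<^sub>C (1 - Q)) = 0" "(?c *\<^sub>C (1 - Q)) * ((z - \<beta>) *\<^sub>C (1 - Q)) = 1 - Q"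
    using \<beta> by (simp_all only: w qQ scaleC_mult_left scaleC_mult_right scaleC_scaleC) simp_all
  then have 2: "?v * ?g = 1" unfolding g(2) by (simp only: distrib_left distrib_right) simp
  show ?thesis unfolding rho_def using ainvertibleI[OF 1 2] by simp
qed

text \<open>For nonzero \<open>z\<close>, the point \<mu> + 1/z is regular for the complementary
  part of \<open>A\<close> if it lies in \<sigma>, and for the part in the range of \<open>p\<close>
  otherwise. The remaining z = 0 corresponds to infinity and is regular for the \<open>p\<close>
  block, on which \<open>A\<close> is bounded. Zero padding would spoil this, hence \<alpha> on one
  side and 0 on the other.\<close>

lemma associated_projection_disjoint:
  assumes P: "associated_projection D A \<sigma> (capp p)" and G: "is_resolvent D A \<mu> G"
    and \<mu>: "\<mu> \<in> resolvent_set UNIV D A"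
  obtains \<alpha> where "rho (G * p + \<alpha> *\<^sub>C (1 - p)) \<union> rho (G * (1 - p)) = UNIV"
proof -
  have A: "clinear_on D A" "closed {(x, A x) |x. x \<in> D}" and \<sigma>: "\<sigma> \<noteq> {}" "\<sigma> \<subseteq> spectrum UNIV D A"
    and pp: "capp p \<circ> capp p = capp p" and pA: "\<And>x. x \<in> D \<Longrightarrow> capp p x \<in> D \<and> capp p (A x) = A (capp p x)"
    and pD: "capp p ` D = range (capp p)"
    and s1: "spectrum (range (capp p)) (capp p ` D) A = \<sigma>"
    and s2: "spectrum (range (\<lambda>x. x - capp p x)) ((\<lambda>x. x - capp p x) ` D) A = spectrum UNIV D A - \<sigma>"
    using P unfolding associated_projection_def densely_defined_closed_def isolated_part_def by auto
  define q where "q = 1 - p"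
  have cq: "capp q x = x - capp p x" for x by (simp add: q_def capp_simps)
  have cq': "capp q = (\<lambda>x. x - capp p x)" by (rule ext) (rule cq)
  have idem: "p * p = p" by (rule cop_eqI) (use pp in \<open>simp add: capp_simps fun_eq_iff\<close>)
  have idemq: "q * q = q" by (simp add: q_def algebra_simps idem)
  have qA: "capp q x \<in> D \<and> capp q (A x) = A (capp q x)" if "x \<in> D" for x
    using pA[OF that] that by (simp add: cq clinear_on_D[OF A(1)])
  have Gp: "G * p = p * G" by (rule is_resolvent_commute[OF G pA])
  have Gq: "G * q = q * G" by (rule is_resolvent_commute[OF G qA])
  obtain \<zeta>1 where \<zeta>1: "\<zeta>1 \<in> \<sigma>" using \<sigma> by blast
  have "\<mu> \<notin> \<sigma>" using \<sigma>(2) \<mu> by (auto simp: spectrum_def)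
  then have \<zeta>\<mu>: "\<zeta>1 - \<mu> \<noteq> 0" using \<zeta>1 by auto
  \<comment> \<open>The padding must be nonzero and must differ from every \<open>z\<close> with
    \<mu> + 1/z outside \<sigma>; the image of a point of \<sigma> has both properties.\<close>
  define \<alpha> where "\<alpha> = 1 / (\<zeta>1 - \<mu>)"
  have \<alpha>: "\<alpha> \<noteq> 0" "\<mu> + 1 / \<alpha> = \<zeta>1" using \<zeta>\<mu> by (auto simp: \<alpha>_def)
  have "z \<in> rho (G * p + \<alpha> *\<^sub>C (1 - p)) \<union> rho (G * q)" for z
  proof (cases "z = 0")
    case True
    \<comment> \<open>As the range of \<open>p\<close> is contained in \<open>D\<close>,
      \<open>A p\<close> is everywhere defined and bounded by the closed graph theorem;
      \<open>S\<close> below is A - \<mu> on this range and inverts \<open>G\<close> there.\<close>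
    have "capp p x \<in> D" for x using pD pA by (metis imageE rangeI)
    then obtain W where W: "\<And>x. capp W x = A (capp p x)" using closed_comp_cop[OF A] by blast
    define S where "S = W - \<mu> *\<^sub>C p"
    have cS: "capp S x = A (capp p x) - \<mu> *\<^sub>C capp p x" for x by (simp add: S_def capp_simps capp_scaleC W)
    have pD': "capp p x \<in> D" for x by fact
    have cpp: "capp p (capp p x) = capp p x" for x using pp by (metis comp_apply)
    have GS: "G * S = p" by (rule cop_eqI) (use G pD' in \<open>simp add: capp_simps cS is_resolvent_def\<close>)
    have SG: "S * G = p"
    proof (rule cop_eqI)
      fix x
      have "capp p (capp G x) = capp G (capp p x)" using Gp by (metis capp_simps(3))
      then show "capp (S * G) x = capp p x" using G by (simp add: capp_simps cS is_resolvent_def)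
    qed
    have Sp: "S * p = S" by (rule cop_eqI) (simp add: capp_simps cS cpp)
    have pS: "p * S = S"
    proof (rule cop_eqI)
      fix x
      have "capp p (A (capp p x)) = A (capp p x)" using pA[OF pD'[of x]] by (simp add: cpp)
      then show "capp (p * S) x = capp S x"
        by (simp add: capp_simps cS linear_diff[OF linear_capp] capp_scaleC_right cpp)
    qed
    have "z \<in> rho (G * p + \<alpha> *\<^sub>C (1 - p))"
      by (rule rho_of_corner[of _ _ "- S"]) (use True \<alpha> in \<open>simp_all add: GS SG Sp pS idem Gp\<close>)
    then show ?thesis by blast
  next
    case False
    show ?thesis
    proof (cases "\<mu> + 1 / z \<in> \<sigma>")
      case True
      then have "\<mu> + 1 / z \<in> resolvent_set (range (capp q)) (capp q ` D) A"
        using s2 unfolding cq'[symmetric] spectrum_def by blast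
      then obtain w where w: "(z *\<^sub>C 1 - G) * w = q" "w * (z *\<^sub>C 1 - G) = q" "w * q = w" "q * w = w"
        using corner_inverse[OF A(1) G qA idemq False] by blast
      have "z \<in> rho (G * q + 0 *\<^sub>C (1 - q))"
        by (rule rho_of_corner[OF w idemq Gq]) (use False in simp)
      then show ?thesis by simp
    next
      case notin: False
      then have "\<mu> + 1 / z \<in> resolvent_set (range (capp p)) (capp p ` D) A"
        using s1 unfolding spectrum_def by blast
      then obtain w where w: "(z *\<^sub>C 1 - G) * w = p" "w * (z *\<^sub>C 1 - G) = p" "w * p = w" "p * w = w"
        using corner_inverse[OF A(1) G pA idem False] by blast
      have "\<alpha> \<noteq> z" using \<alpha> \<zeta>1 notin by auto
      then show ?thesis using rho_of_corner[OF w idem Gp] by blast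
    qed
  qed
  then show ?thesis by (intro that[of \<alpha>]) (auto simp: q_def)
qed

subsection \<open>Local solutions of the commutator equation\<close>

text \<open>The resolvent and the graph norm may belong to different operators: boundedness of
  \<open>G\<close> into \<open>D\<close> with this norm comes from the common domain and the
  closedness of \<open>A\<^sub>0\<close>.\<close>

lemma graph_norm_resolvent:
  assumes A0: "clinear_on D A\<^sub>0" "closed {(x, A\<^sub>0 x) |x. x \<in> D}" and G: "is_resolvent D A \<mu> G"
  obtains \<kappa> where "\<kappa> \<ge> 0" "\<And>x. graph_norm A\<^sub>0 (capp G x) \<le> \<kappa> * norm x"
proof -
  have GD: "capp G x \<in> D" for x using G by (simp add: is_resolvent_def)
  obtain W where W: "\<And>x. capp W x = A\<^sub>0 (capp G x)" using closed_comp_cop[OF A0 GD] by blast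
  show ?thesis
  proof (rule that[of "norm G + norm W"])
    show "graph_norm A\<^sub>0 (capp G x) \<le> (norm G + norm W) * norm x" for x
      using norm_capp[of G x] norm_capp[of W x] by (simp add: graph_norm_def W algebra_simps)
  qed simp
qed

text \<open>T(t) = (A(t) - \<mu>) \<open>G\<^sub>0\<close> is a perturbation of 1. It is Lipschitz,
  because the increments of \<open>A\<close> are bounded with respect to the graph norm and
  \<open>G\<^sub>0\<close> maps boundedly into it. Hence G(t) = \<open>G\<^sub>0\<close> T(t)^-1,
  with the same \<mu> for all \<open>t\<close> near \<open>t0\<close>.\<close>

lemma resolvent_family:
  fixes A :: "real \<Rightarrow> 'a::complex_banach \<Rightarrow> 'a"
  assumes A: "\<And>t. t \<in> {0..1} \<Longrightarrow> clinear_on D (A t)"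
    and A0: "clinear_on D A\<^sub>0" "closed {(x, A\<^sub>0 x) |x. x \<in> D}"
    and lip: "\<And>s t x. s \<in> {0..1} \<Longrightarrow> t \<in> {0..1} \<Longrightarrow> x \<in> D \<Longrightarrow> norm (A t x - A s x) \<le> C * \<bar>t - s\<bar> * graph_norm A\<^sub>0 x"
    and C: "C \<ge> 0" and t0: "t0 \<in> {0..1}" and G0: "is_resolvent D (A t0) \<mu> G\<^sub>0"
  obtains \<delta> G where "\<delta> > 0" "lip_family ({0..1} \<inter> ball t0 \<delta>) G"
    "\<And>t. t \<in> {0..1} \<inter> ball t0 \<delta> \<Longrightarrow> is_resolvent D (A t) \<mu> (G t)"
proof -
  have GD: "capp G\<^sub>0 x \<in> D" for x using G0 by (simp add: is_resolvent_def)
  obtain \<kappa> where \<kappa>: "\<kappa> \<ge> 0" "\<And>x. graph_norm A\<^sub>0 (capp G\<^sub>0 x) \<le> \<kappa> * norm x"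
    using graph_norm_resolvent[OF A0 G0] by blast
  have lipG: "norm (A t (capp G\<^sub>0 x) - A s (capp G\<^sub>0 x)) \<le> (C * \<kappa>) * \<bar>t - s\<bar> * norm x"
    if "s \<in> {0..1}" "t \<in> {0..1}" for s t x
  proof -
    have "norm (A t (capp G\<^sub>0 x) - A s (capp G\<^sub>0 x)) \<le> C * \<bar>t - s\<bar> * graph_norm A\<^sub>0 (capp G\<^sub>0 x)"
      by (rule lip[OF that GD])
    also have "\<dots> \<le> C * \<bar>t - s\<bar> * (\<kappa> * norm x)" using C \<kappa> by (intro mult_left_mono) auto
    finally show ?thesis by (simp add: mult_ac)
  qed
  define T where "T t = 1 + cop_of (\<lambda>x. A t (capp G\<^sub>0 x) - A t0 (capp G\<^sub>0 x))" for t
  note linG = bounded_linear.linear[OF bounded_linear_capp[of G\<^sub>0]]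
  have cT: "capp (T t) x = x + (A t (capp G\<^sub>0 x) - A t0 (capp G\<^sub>0 x))" if t: "t \<in> {0..1}" for t x
  proof -
    have "bounded_linear (\<lambda>x. A t (capp G\<^sub>0 x) - A t0 (capp G\<^sub>0 x))"
    proof (rule bounded_linear_intro[where K="C * \<kappa> * \<bar>t - t0\<bar>"])
      show "norm (A t (capp G\<^sub>0 x) - A t0 (capp G\<^sub>0 x)) \<le> norm x * (C * \<kappa> * \<bar>t - t0\<bar>)" for x
        using lipG[OF t0 t, of x] by (simp add: mult_ac)
    qed (simp_all add: linear_add[OF linG] linear_scale[OF linG] clinear_on_D[OF A[OF t]] clinear_on_D[OF A[OF t0]] GD algebra_simps)
    then have "bounded_clinear (\<lambda>x. A t (capp G\<^sub>0 x) - A t0 (capp G\<^sub>0 x))"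
      by (simp add: bounded_clinear_def capp_scaleC_right clinear_on_D[OF A[OF t]] clinear_on_D[OF A[OF t0]] GD scaleC.diff_right)
    then show ?thesis by (simp add: T_def capp_simps capp_cop_of)
  qed
  have TA: "A t (capp G\<^sub>0 x) - \<mu> *\<^sub>C capp G\<^sub>0 x = capp (T t) x" if t: "t \<in> {0..1}" for t x
  proof -
    have "A t0 (capp G\<^sub>0 x) - \<mu> *\<^sub>C capp G\<^sub>0 x = x" using G0 by (simp add: is_resolvent_def)
    then show ?thesis unfolding cT[OF t] by (simp add: algebra_simps)
  qed
  have "lip_family {0..1} T"
  proof (rule lip_familyI)
    show "norm (T t - T s) \<le> (C * \<kappa>) * norm (t - s)" if st: "s \<in> {0..1}" "t \<in> {0..1}" for s t
      by (rule norm_cop_le) (use C \<kappa> lipG[OF st] in \<open>simp_all add: capp_simps cT[OF st(1)] cT[OF st(2)]\<close>)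
    show "norm (T t) \<le> 1 + C * \<kappa>" if t: "t \<in> {0..1}" for t
    proof (rule norm_cop_le)
      fix x
      have "norm (capp (T t) x) \<le> norm x + (C * \<kappa>) * \<bar>t - t0\<bar> * norm x"
        unfolding cT[OF t] by (intro norm_triangle_mono lipG t t0) simp
      also have "(C * \<kappa>) * \<bar>t - t0\<bar> * norm x \<le> (C * \<kappa>) * 1 * norm x"
        using C \<kappa> t t0 by (intro mult_right_mono mult_left_mono) auto
      finally show "norm (capp (T t) x) \<le> (1 + C * \<kappa>) * norm x" by (simp add: algebra_simps)
    qed (use C \<kappa> in simp)
  qed
  moreover have "T t0 = 1" by (rule cop_eqI) (simp add: cT[OF t0] capp_simps)
  then have "ainvertible (T t0)" by (simp add: ainvertibleI[of 1 1 1])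
  ultimately obtain \<delta> where \<delta>: "\<delta> > 0" "\<And>t. t \<in> {0..1} \<Longrightarrow> norm (t - t0) < \<delta> \<Longrightarrow> ainvertible (T t)"
    "lip_family ({0..1} \<inter> ball t0 \<delta>) (\<lambda>t. ainv (T t))"
    using lip_family_ainv[OF _ t0] by blast
  show ?thesis
  proof (rule that[OF \<delta>(1)])
    show "lip_family ({0..1} \<inter> ball t0 \<delta>) (\<lambda>t. G\<^sub>0 * ainv (T t))"
      by (intro lip_family_mult lip_family_const \<delta>(3))
    fix t assume "t \<in> {0..1} \<inter> ball t0 \<delta>"
    then have t: "t \<in> {0..1}" and inv: "ainvertible (T t)"
      using \<delta>(2)[of t] by (auto simp: dist_norm norm_minus_commute)
    show "is_resolvent D (A t) \<mu> (G\<^sub>0 * ainv (T t))"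
      unfolding is_resolvent_def
    proof (intro conjI allI ballI)
      fix x
      show "capp (G\<^sub>0 * ainv (T t)) x \<in> D" by (simp add: capp_simps GD)
      have "capp (T t) (capp (ainv (T t)) x) = x"
        using ainv(1)[OF inv] by (metis capp_simps(3,4))
      then show "A t (capp (G\<^sub>0 * ainv (T t)) x) - \<mu> *\<^sub>C capp (G\<^sub>0 * ainv (T t)) x = x"
        by (simp add: capp_simps TA[OF t])
    next
      fix x assume x: "x \<in> D"
      define u where "u = A t0 x - \<mu> *\<^sub>C x"
      have xu: "x = capp G\<^sub>0 u" using G0 x by (simp add: u_def is_resolvent_def)
      have "capp (ainv (T t)) (capp (T t) u) = u"
        using ainv(2)[OF inv] by (metis capp_simps(3,4))
      then show "capp (G\<^sub>0 * ainv (T t)) (A t x - \<mu> *\<^sub>C x) = x"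
        unfolding xu TA[OF t] by (simp add: capp_simps)
    qed
  qed
qed

lemma local_commutator_equation:
  fixes A :: "real \<Rightarrow> 'a::complex_banach \<Rightarrow> 'a"
  assumes A: "\<And>t. t \<in> {0..1} \<Longrightarrow> densely_defined_closed D (A t)"
    and lip: "\<And>s t x. s \<in> {0..1} \<Longrightarrow> t \<in> {0..1} \<Longrightarrow> x \<in> D \<Longrightarrow> norm (A t x - A s x) \<le> C * \<bar>t - s\<bar> * graph_norm (A 0) x"
    and C: "C \<ge> 0" and t0: "t0 \<in> {0..1}"
    and P: "\<And>t. t \<in> {0..1} \<Longrightarrow> associated_projection D (A t) (\<sigma> t) (capp (p t))"
    and lp: "lip_family {0..1} p" "lip_family {0..1} p'"
  obtains \<delta> B where "\<delta> > 0" "lip_family ({0..1} \<inter> ball t0 \<delta>) B"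
    "\<And>t v. t \<in> {0..1} \<inter> ball t0 \<delta> \<Longrightarrow> v \<in> D \<Longrightarrow> capp (B t) v \<in> D \<and>
       capp (B t) (A t v) - A t (capp (B t) v) = commutator (capp (p' t)) (capp (p t)) v"
proof -
  have cl: "clinear_on D (A t)" "closed {(x, A t x) |x. x \<in> D}" if "t \<in> {0..1}" for t
    using A[OF that] by (auto simp: densely_defined_closed_def)
  obtain \<mu> where \<mu>: "\<mu> \<in> resolvent_set UNIV D (A t0)"
    using P[OF t0] unfolding associated_projection_def by blast
  obtain G\<^sub>0 where G0: "is_resolvent D (A t0) \<mu> G\<^sub>0" using resolvent_exists[OF cl(1)[OF t0] \<mu>] by blast
  have zero: "(0::real) \<in> {0..1}" by simp
  obtain \<delta>1 G where \<delta>1: "\<delta>1 > 0" "lip_family ({0..1} \<inter> ball t0 \<delta>1) G"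
    "\<And>t. t \<in> {0..1} \<inter> ball t0 \<delta>1 \<Longrightarrow> is_resolvent D (A t) \<mu> (G t)"
    using resolvent_family[OF cl(1) cl[OF zero] lip C t0 G0] by blast
  let ?J = "{0..1} \<inter> ball t0 \<delta>1"
  have t0J: "t0 \<in> ?J" using t0 \<delta>1 by simp
  define Y where "Y t = p' t * p t - p t * p' t" for t
  have cY: "capp (Y t) v = commutator (capp (p' t)) (capp (p t)) v" for t v
    by (simp add: Y_def capp_simps commutator_def)
  have pA: "x \<in> D \<Longrightarrow> capp (p t) x \<in> D \<and> capp (p t) (A t x) = A t (capp (p t) x)" if "t \<in> {0..1}" for t x
    using P[OF that] unfolding associated_projection_def by blast
  have idem: "p t * p t = p t" if "t \<in> {0..1}" for t
    by (rule cop_eqI) (use P[OF that] in \<open>simp add: capp_simps associated_projection_def fun_eq_iff\<close>)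
  have Gp: "G t * p t = p t * G t" if "t \<in> ?J" for t
    by (rule is_resolvent_commute[OF \<delta>1(3)[OF that]]) (use pA that in blast)
  obtain \<alpha> where \<alpha>: "rho (G t0 * p t0 + \<alpha> *\<^sub>C (1 - p t0)) \<union> rho (G t0 * (1 - p t0)) = UNIV"
    using associated_projection_disjoint[OF P[OF t0] \<delta>1(3)[OF t0J] \<mu>] by blast
  have lJ: "lip_family ?J p" "lip_family ?J p'" using lp by (auto intro: lip_family_subset)
  have lY: "lip_family ?J Y" unfolding Y_def by (intro lip_family_diff lip_family_mult lJ)
  \<comment> \<open>A commutator with an idempotent \<open>p\<close> has zero diagonal corners,
    whatever \<open>p'\<close> is; \<open>G\<close> commutes with \<open>p\<close> and keeps them
    zero.\<close>
  have off: "p t * (G t * Y t * G t) * p t = 0" "(1 - p t) * (G t * Y t * G t) * (1 - p t) = 0" if t: "t \<in> ?J" for t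
  proof -
    have i: "p t * p t = p t" using idem t by blast
    have ii: "p t * (p t * x) = p t * x" for x by (simp add: i flip: mult.assoc)
    have g: "G t * p t = p t * G t" by (rule Gp[OF t])
    have q: "G t * (1 - p t) = (1 - p t) * G t" by (simp add: algebra_simps g)
    have "p t * (G t * Y t * G t) * p t = (p t * G t) * Y t * (G t * p t)" by (simp add: mult.assoc)
    also have "\<dots> = (G t * p t) * Y t * (p t * G t)" by (simp only: g)
    also have "\<dots> = G t * (p t * Y t * p t) * G t" by (simp add: mult.assoc)
    also have "p t * Y t * p t = 0" by (simp add: Y_def algebra_simps i ii)
    finally show "p t * (G t * Y t * G t) * p t = 0" by simp
    have "(1 - p t) * (G t * Y t * G t) * (1 - p t) = ((1 - p t) * G t) * Y t * (G t * (1 - p t))" by (simp add: mult.assoc)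
    also have "\<dots> = (G t * (1 - p t)) * Y t * ((1 - p t) * G t)" by (simp only: q)
    also have "\<dots> = G t * ((1 - p t) * Y t * (1 - p t)) * G t" by (simp add: mult.assoc)
    also have "(1 - p t) * Y t * (1 - p t) = 0" by (simp add: Y_def algebra_simps i ii)
    finally show "(1 - p t) * (G t * Y t * G t) * (1 - p t) = 0" by simp
  qed
  obtain \<delta>2 B where \<delta>2: "\<delta>2 > 0" "lip_family (?J \<inter> ball t0 \<delta>2) B"
    "\<And>t. t \<in> ?J \<inter> ball t0 \<delta>2 \<Longrightarrow> G t * B t - B t * G t = G t * Y t * G t"
    using commutator_equation_lipschitz[OF \<delta>1(2) lJ(1) lip_family_mult[OF lip_family_mult[OF \<delta>1(2) lY] \<delta>1(2)] t0J _ Gp off \<alpha>]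
      idem by blast
  have sub: "{0..1} \<inter> ball t0 (min \<delta>1 \<delta>2) \<subseteq> ?J \<inter> ball t0 \<delta>2" by auto
  show ?thesis
  proof (rule that[of "min \<delta>1 \<delta>2"])
    show "lip_family ({0..1} \<inter> ball t0 (min \<delta>1 \<delta>2)) B" by (rule lip_family_subset[OF \<delta>2(2) sub])
    fix t v assume t': "t \<in> {0..1} \<inter> ball t0 (min \<delta>1 \<delta>2)" and v: "v \<in> D"
    then have t: "t \<in> ?J \<inter> ball t0 \<delta>2" using sub by blast
    have G: "is_resolvent D (A t) \<mu> (G t)" using \<delta>1(3) t by blast
    define w where "w = A t v - \<mu> *\<^sub>C v"
    have vw: "capp (G t) w = v" using G v by (simp add: w_def is_resolvent_def)
    have "capp (G t * B t - B t * G t) w = capp (G t * Y t * G t) w" using \<delta>2(3)[OF t] by simp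
    \<comment> \<open>Evaluating G B - B G = G Y G at w = (A - \<mu>) v exhibits B v as a value of
      \<open>G\<close>; this gives both B v in \<open>D\<close> and, after applying A - \<mu>, the
      unbounded commutator equation.\<close>
    then have Bv: "capp (B t) v = capp (G t) (capp (B t) w - capp (Y t) v)"
      by (simp add: capp_simps vw linear_diff[OF linear_capp] algebra_simps)
    have "A t (capp (B t) v) - \<mu> *\<^sub>C capp (B t) v = capp (B t) w - capp (Y t) v"
      using G unfolding Bv by (simp add: is_resolvent_def)
    moreover have "capp (B t) w = capp (B t) (A t v) - \<mu> *\<^sub>C capp (B t) v"
      by (simp add: w_def linear_diff[OF linear_capp] capp_scaleC_right)
    ultimately have "capp (B t) (A t v) - A t (capp (B t) v) = capp (Y t) v" by (simp add: algebra_simps)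
    moreover have "capp (B t) v \<in> D" unfolding Bv using G by (simp add: is_resolvent_def)
    ultimately show "capp (B t) v \<in> D \<and> capp (B t) (A t v) - A t (capp (B t) v) = commutator (capp (p' t)) (capp (p t)) v"
      by (simp add: cY)
  qed (use \<delta>1 \<delta>2 in simp)
qed

text \<open>Converts the control of A(t) along a solution, which an evolution system provides, into
  the graph norm in which the Lipschitz estimate is stated. The resolvent at \<open>t0\<close>
  compares the norms at \<open>t0\<close>; nearby, a Lipschitz error of factor at most 1/2 is
  absorbed, and \<open>Bolzano\<close> combines finitely many such intervals.\<close>

lemma graph_norms_equivalent:
  fixes A :: "real \<Rightarrow> 'a::complex_banach \<Rightarrow> 'a"
  assumes A: "\<And>t. t \<in> {0..1} \<Longrightarrow> densely_defined_closed D (A t)"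
    and lip: "\<And>s t x. s \<in> {0..1} \<Longrightarrow> t \<in> {0..1} \<Longrightarrow> x \<in> D \<Longrightarrow> norm (A t x - A s x) \<le> C * \<bar>t - s\<bar> * graph_norm (A 0) x"
    and C: "C \<ge> 0" and rs: "\<And>t. t \<in> {0..1} \<Longrightarrow> resolvent_set UNIV D (A t) \<noteq> {}"
  obtains \<kappa> where "\<And>t x. t \<in> {0..1} \<Longrightarrow> x \<in> D \<Longrightarrow> graph_norm (A 0) x \<le> \<kappa> * graph_norm (A t) x"
proof -
  define Q where "Q a b \<longleftrightarrow> (\<exists>\<kappa>. \<forall>t\<in>{0..1} \<inter> {a..b}. \<forall>x\<in>D. graph_norm (A 0) x \<le> \<kappa> * graph_norm (A t) x)" for a b
  have cl: "clinear_on D (A t)" "closed {(x, A t x) |x. x \<in> D}" if "t \<in> {0..1}" for t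
    using A[OF that] by (auto simp: densely_defined_closed_def)
  have "(0::real) \<le> 1" by simp
  then have "Q 0 1"
  proof (induction rule: Bolzano)
    case (trans a b c)
    then obtain \<kappa> \<kappa>' where \<kappa>: "\<And>t x. t \<in> {0..1} \<inter> {a..b} \<Longrightarrow> x \<in> D \<Longrightarrow> graph_norm (A 0) x \<le> \<kappa> * graph_norm (A t) x"
      "\<And>t x. t \<in> {0..1} \<inter> {b..c} \<Longrightarrow> x \<in> D \<Longrightarrow> graph_norm (A 0) x \<le> \<kappa>' * graph_norm (A t) x"
      unfolding Q_def by meson
    have "graph_norm (A 0) x \<le> max \<kappa> \<kappa>' * graph_norm (A t) x" if "t \<in> {0..1} \<inter> {a..c}" "x \<in> D" for t x
    proof (cases "t \<le> b")
      case True
      then have "graph_norm (A 0) x \<le> \<kappa> * graph_norm (A t) x" using \<kappa>(1)[of t x] that by simp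
      also have "\<dots> \<le> max \<kappa> \<kappa>' * graph_norm (A t) x" by (intro mult_right_mono graph_norm_nonneg) simp
      finally show ?thesis .
    next
      case False
      then have "graph_norm (A 0) x \<le> \<kappa>' * graph_norm (A t) x" using \<kappa>(2)[of t x] that by simp
      also have "\<dots> \<le> max \<kappa> \<kappa>' * graph_norm (A t) x" by (intro mult_right_mono graph_norm_nonneg) simp
      finally show ?thesis .
    qed
    then show ?case unfolding Q_def by blast
  next
    case (local t0)
    then have t0: "t0 \<in> {0..1}" by simp
    obtain \<mu> where \<mu>: "\<mu> \<in> resolvent_set UNIV D (A t0)" using rs[OF t0] by blast
    obtain G where G: "is_resolvent D (A t0) \<mu> G" using resolvent_exists[OF cl(1)[OF t0] \<mu>] by blast
    have 0: "(0::real) \<in> {0..1}" by simp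
    obtain k where k: "k \<ge> 0" "\<And>x. graph_norm (A 0) (capp G x) \<le> k * norm x"
      using graph_norm_resolvent[OF cl[OF 0] G] by blast
    define c where "c = k * (1 + cmod \<mu>)"
    have c: "c \<ge> 0" using k by (simp add: c_def)
    have base: "graph_norm (A 0) x \<le> c * graph_norm (A t0) x" if x: "x \<in> D" for x
    proof -
      have "graph_norm (A 0) x \<le> k * norm (A t0 x - \<mu> *\<^sub>C x)"
        using k(2)[of "A t0 x - \<mu> *\<^sub>C x"] G x by (simp add: is_resolvent_def)
      also have "norm (A t0 x - \<mu> *\<^sub>C x) \<le> (1 + cmod \<mu>) * graph_norm (A t0) x"
      proof -
        have "norm (A t0 x - \<mu> *\<^sub>C x) \<le> norm (A t0 x) + cmod \<mu> * norm x"
          using norm_triangle_ineq4[of "A t0 x" "\<mu> *\<^sub>C x"] by (simp add: norm_scaleC)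
        also have "\<dots> \<le> (1 + cmod \<mu>) * graph_norm (A t0) x"
          by (simp add: graph_norm_def algebra_simps)
        finally show ?thesis .
      qed
      finally show ?thesis using k by (simp add: c_def mult.assoc mult_left_mono)
    qed
    define d where "d = 1 / (2 * (c * C + 1))"
    have d: "d > 0" using c C by (simp add: d_def add_nonneg_pos)
    have "Q a b" if ab: "a \<le> t0" "t0 \<le> b" "b - a < d" for a b
      unfolding Q_def
    proof (intro exI[of _ "2 * c"] ballI)
      fix t x assume t: "t \<in> {0..1} \<inter> {a..b}" and x: "x \<in> D"
      let ?N = "graph_norm (A 0) x"
      have "norm (A t0 x) \<le> norm (A t x) + C * \<bar>t - t0\<bar> * ?N"
        using lip[OF t0, of t x] t x norm_triangle_ineq3[of "A t x" "A t0 x"] by simp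
      then have "graph_norm (A t0) x \<le> graph_norm (A t) x + C * \<bar>t - t0\<bar> * ?N" by (simp add: graph_norm_def)
      then have "c * graph_norm (A t0) x \<le> c * (graph_norm (A t) x + C * \<bar>t - t0\<bar> * ?N)"
        using c by (rule mult_left_mono)
      with base[OF x] have "?N \<le> c * graph_norm (A t) x + (c * C * \<bar>t - t0\<bar>) * ?N" by (simp add: algebra_simps)
      moreover have "c * C * \<bar>t - t0\<bar> \<le> 1 / 2"
      proof -
        have "c * C * \<bar>t - t0\<bar> \<le> (c * C + 1) * d"
          using t ab c C by (intro mult_mono) auto
        also have "\<dots> = 1 / 2" using c C by (simp add: d_def field_simps add_nonneg_eq_0_iff)
        finally show ?thesis .
      qed
      then have "(c * C * \<bar>t - t0\<bar>) * ?N \<le> 1 / 2 * ?N" by (rule mult_right_mono) (rule graph_norm_nonneg)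
      ultimately show "?N \<le> 2 * c * graph_norm (A t) x" by simp
    qed
    with d show ?case by blast
  qed
  then show ?thesis unfolding Q_def Int_absorb by (blast intro: that)
qed

subsection \<open>Evolution systems\<close>

text \<open>Brings the comparison of two curves with common starting point \<open>x\<close> into the
  form that \<open>right_increment_bound\<close> asks for.\<close>

lemma right_increment_gap:
  fixes \<phi> \<psi> :: "real \<Rightarrow> 'b::real_normed_vector"
  assumes "((\<lambda>h. (\<phi> h - x) /\<^sub>R h) \<longlongrightarrow> d\<^sub>1) (at_right 0)" "((\<lambda>h. (\<psi> h - x) /\<^sub>R h) \<longlongrightarrow> d\<^sub>2) (at_right 0)"
    and e: "e > 0"
  shows "\<forall>\<^sub>F h in at_right 0. norm (\<phi> h - \<psi> h) \<le> h * (norm (d\<^sub>1 - d\<^sub>2) + e)"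
proof -
  have "((\<lambda>h. norm ((\<phi> h - x) /\<^sub>R h - (\<psi> h - x) /\<^sub>R h)) \<longlongrightarrow> norm (d\<^sub>1 - d\<^sub>2)) (at_right 0)"
    by (intro tendsto_intros assms)
  then have "\<forall>\<^sub>F h in at_right 0. norm ((\<phi> h - x) /\<^sub>R h - (\<psi> h - x) /\<^sub>R h) < norm (d\<^sub>1 - d\<^sub>2) + e"
    by (rule order_tendstoD) (use e in simp)
  then show ?thesis
    using eventually_at_right_less[of 0]
  proof eventually_elim
    fix h :: real assume h: "norm ((\<phi> h - x) /\<^sub>R h - (\<psi> h - x) /\<^sub>R h) < norm (d\<^sub>1 - d\<^sub>2) + e" "0 < h"
    have "(\<phi> h - x) /\<^sub>R h - (\<psi> h - x) /\<^sub>R h = (\<phi> h - \<psi> h) /\<^sub>R h"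
      by (simp flip: scaleR_diff_right)
    then have "norm (\<phi> h - \<psi> h) / h < norm (d\<^sub>1 - d\<^sub>2) + e"
      using h by (simp add: divide_inverse mult.commute)
    then show "norm (\<phi> h - \<psi> h) \<le> h * (norm (d\<^sub>1 - d\<^sub>2) + e)"
      using h(2) by (simp add: pos_divide_less_eq mult.commute)
  qed
qed

lemma has_vector_derivative_right_quotient:
  fixes u :: "real \<Rightarrow> 'b::real_normed_vector"
  assumes "(u has_vector_derivative d) (at \<tau> within {a..b})" "a \<le> \<tau>" "\<tau> < b"
  shows "((\<lambda>h. (u (\<tau> + h) - u \<tau>) /\<^sub>R h) \<longlongrightarrow> d) (at_right 0)"
proof -
  have "(u has_vector_derivative d) (at \<tau> within {\<tau>..b})"
    by (rule has_vector_derivative_within_subset[OF assms(1)]) (use assms in auto)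
  then have "((\<lambda>y. (1 / norm (y - \<tau>)) *\<^sub>R (u y - (u \<tau> + (y - \<tau>) *\<^sub>R d))) \<longlongrightarrow> 0) (at \<tau> within {\<tau>..b})"
    by (simp add: has_vector_derivative_def has_derivative_within)
  moreover have "(1 / norm (y - \<tau>)) *\<^sub>R (u y - (u \<tau> + (y - \<tau>) *\<^sub>R d)) = (u y - u \<tau>) /\<^sub>R (y - \<tau>) - d"
    if "y \<in> {\<tau>..b}" "y \<noteq> \<tau>" for y
    using that by (simp add: divide_inverse diff_diff_eq[symmetric] scaleR_diff_right)
  ultimately have "((\<lambda>y. (u y - u \<tau>) /\<^sub>R (y - \<tau>) - d) \<longlongrightarrow> 0) (at \<tau> within {\<tau>..b})"
    by (rule Lim_transform_within[OF _ zero_less_one]) auto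
  then have "((\<lambda>y. (u y - u \<tau>) /\<^sub>R (y - \<tau>)) \<longlongrightarrow> d) (at \<tau> within {\<tau>..b})"
    by (rule LIM_zero_cancel)
  then have "((\<lambda>y. (u y - u \<tau>) /\<^sub>R (y - \<tau>)) \<longlongrightarrow> d) (at_right \<tau>)"
    using at_within_Icc_at_right[OF assms(3)] by simp
  then show ?thesis
    unfolding filterlim_at_right_to_0[of _ _ \<tau>] by (simp add: add.commute)
qed

lemma continuous_on_strong_apply:
  fixes W :: "real \<Rightarrow> 'b::real_normed_vector \<Rightarrow> 'b"
  assumes W: "\<And>x. continuous_on S (\<lambda>\<tau>. W \<tau> x)" and lin: "\<And>\<tau>. \<tau> \<in> S \<Longrightarrow> linear (W \<tau>)"
    and bd: "\<And>\<tau> x. \<tau> \<in> S \<Longrightarrow> norm (W \<tau> x) \<le> M * norm x" and v: "continuous_on S v"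
  shows "continuous_on S (\<lambda>\<tau>. W \<tau> (v \<tau>))"
  unfolding continuous_on_def
proof
  fix \<tau>0 assume \<tau>0: "\<tau>0 \<in> S"
  have "((\<lambda>\<tau>. W \<tau> (v \<tau> - v \<tau>0)) \<longlongrightarrow> 0) (at \<tau>0 within S)"
  proof (rule Lim_null_comparison)
    show "\<forall>\<^sub>F \<tau> in at \<tau>0 within S. norm (W \<tau> (v \<tau> - v \<tau>0)) \<le> M * norm (v \<tau> - v \<tau>0)"
      using bd by (auto simp: eventually_at_filter)
    have "((\<lambda>\<tau>. M * norm (v \<tau> - v \<tau>0)) \<longlongrightarrow> M * norm (v \<tau>0 - v \<tau>0)) (at \<tau>0 within S)"
      using v \<tau>0 by (intro tendsto_intros) (simp add: continuous_on_def)
    then show "((\<lambda>\<tau>. M * norm (v \<tau> - v \<tau>0)) \<longlongrightarrow> 0) (at \<tau>0 within S)" by simp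
  qed
  moreover have "((\<lambda>\<tau>. W \<tau> (v \<tau>0)) \<longlongrightarrow> W \<tau>0 (v \<tau>0)) (at \<tau>0 within S)"
    using W \<tau>0 by (simp add: continuous_on_def)
  ultimately have "((\<lambda>\<tau>. W \<tau> (v \<tau> - v \<tau>0) + W \<tau> (v \<tau>0)) \<longlongrightarrow> 0 + W \<tau>0 (v \<tau>0)) (at \<tau>0 within S)"
    by (rule tendsto_add)
  moreover have "\<forall>\<^sub>F \<tau> in at \<tau>0 within S. W \<tau> (v \<tau> - v \<tau>0) + W \<tau> (v \<tau>0) = W \<tau> (v \<tau>)"
    using lin by (auto simp: eventually_at_filter linear_diff)
  ultimately show "((\<lambda>\<tau>. W \<tau> (v \<tau>)) \<longlongrightarrow> W \<tau>0 (v \<tau>0)) (at \<tau>0 within S)"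
    by (simp add: filterlim_cong[OF refl refl])
qed

lemma evolution_systemD:
  assumes "evolution_system (\<lambda>_. D) A U"
  shows "0 \<le> s \<Longrightarrow> s \<le> t \<Longrightarrow> t \<le> 1 \<Longrightarrow> bounded_linear (U t s)"
    "0 \<le> s \<Longrightarrow> s < 1 \<Longrightarrow> y \<in> D \<Longrightarrow> s \<le> t \<Longrightarrow> t \<le> 1 \<Longrightarrow> U t s y \<in> D"
    "0 \<le> s \<Longrightarrow> s < 1 \<Longrightarrow> y \<in> D \<Longrightarrow> s \<le> t \<Longrightarrow> t \<le> 1 \<Longrightarrow>
      ((\<lambda>t. U t s y) has_vector_derivative A t (U t s y)) (at t within {s..1})"
    "0 \<le> s \<Longrightarrow> s < 1 \<Longrightarrow> y \<in> D \<Longrightarrow> continuous_on {s..1} (\<lambda>t. A t (U t s y))"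
    "0 \<le> r \<Longrightarrow> r \<le> s \<Longrightarrow> s \<le> t \<Longrightarrow> t \<le> 1 \<Longrightarrow> U t s (U s r x) = U t r x"
    "continuous_on {(s, t). 0 \<le> s \<and> s \<le> t \<and> t \<le> 1} (\<lambda>(s, t). U t s x)"
  using assms unfolding evolution_system_def bounded_clinear_def by (auto simp: fun_eq_iff)

lemma evolution_system_continuous:
  assumes "evolution_system (\<lambda>_. D) A U"
  shows "0 \<le> s \<Longrightarrow> continuous_on {s..1} (\<lambda>t. U t s x)" "0 \<le> a \<Longrightarrow> t \<le> 1 \<Longrightarrow> continuous_on {a..t} (\<lambda>s. U t s x)"
proof -
  show "continuous_on {s..1} (\<lambda>t. U t s x)" if "0 \<le> s"
    using continuous_on_compose2[OF evolution_systemD(6)[OF assms, of x]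
        continuous_on_Pair[OF continuous_on_const[of "{s..1}" s] continuous_on_id]] that
    by fastforce
  show "continuous_on {a..t} (\<lambda>s. U t s x)" if "0 \<le> a" "t \<le> 1"
    using continuous_on_compose2[OF evolution_systemD(6)[OF assms, of x]
        continuous_on_Pair[OF continuous_on_id[of "{a..t}"] continuous_on_const[of _ t]]] that
    by fastforce
qed

text \<open>For times below 1 and vectors of \<open>D\<close> this is part of the definition;
  density and boundedness extend it to all vectors, strong continuity to time 1.\<close>

lemma evolution_system_refl:
  fixes D :: "'a::complex_banach set"
  assumes U: "evolution_system (\<lambda>_. D) A U" and D: "closure D = UNIV" and s: "0 \<le> s" "s \<le> 1"
  shows "U s s x = x"
proof -
  have lt: "U s s x = x" if s: "0 \<le> s" "s < 1" for s x
  proof -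
    have "bounded_linear (U s s)" using evolution_systemD(1)[OF U] s by simp
    then have "continuous_on UNIV (U s s)" by (rule linear_continuous_on)
    then have "closed {x. U s s x = x}" by (intro closed_Collect_eq continuous_intros) auto
    moreover have "D \<subseteq> {x. U s s x = x}" using U s unfolding evolution_system_def by auto
    ultimately have "closure D \<subseteq> {x. U s s x = x}" by (intro closure_minimal)
    then show ?thesis using D by auto
  qed
  show ?thesis
  proof (cases "s < 1")
    case True then show ?thesis using lt s by simp
  next
    case False
    then have s1: "s = 1" using s by simp
    have "continuous_on {0..1} (\<lambda>r. U r r x)"
      using continuous_on_compose2[OF evolution_systemD(6)[OF U, of x]
          continuous_on_Pair[OF continuous_on_id[of "{0..1}"] continuous_on_id]]
      by fastforce
    then have "((\<lambda>r. U r r x) \<longlongrightarrow> U 1 1 x) (at 1 within {0..1})" by (simp add: continuous_on_def)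
    then have "((\<lambda>r. U r r x) \<longlongrightarrow> U 1 1 x) (at_left 1)"
      by (simp add: at_within_Icc_at_left)
    moreover have "\<forall>\<^sub>F r in at_left 1. U r r x = x"
      using eventually_at_left_real[of 0 1] by (auto elim!: eventually_mono simp: lt)
    ultimately have "((\<lambda>r. x) \<longlongrightarrow> U 1 1 x) (at_left (1::real))"
      by (rule Lim_transform_eventually)
    then show ?thesis
      using tendsto_unique[OF trivial_limit_at_left_real _ tendsto_const] s1 by metis
  qed
qed

lemma bounded_by_density:
  fixes F G :: "'a::complex_banach \<Rightarrow> 'a"
  assumes "bounded_linear F" "closure D = UNIV" "\<And>y. y \<in> D \<Longrightarrow> norm (F y) \<le> K * norm y"
  shows "norm (F x) \<le> K * norm x"
proof -
  have "closed {x. norm (F x) \<le> K * norm x}"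
    by (intro closed_Collect_le continuous_intros linear_continuous_on assms(1))
  then have "closure D \<subseteq> {x. norm (F x) \<le> K * norm x}"
    by (intro closure_minimal) (use assms(3) in auto)
  then show ?thesis using assms(2) by auto
qed

section \<open>Stability of evolution systems from products of frozen semigroups\<close>

lemma op_prod_Suc_right: "op_prod F (Suc n) = op_prod (\<lambda>i. F (Suc i)) n \<circ> F 0"
proof (induction n)
  case (Suc n)
  show ?case by (simp only: op_prod.simps(2)[of F "Suc n"] Suc.IH) (simp add: comp_assoc)
qed simp

text \<open>Each local error is carried to the end by the product of the remaining factors. These
  products are bounded by \<open>M\<close> as a whole, so the \<open>n\<close> errors add up without
  exponential growth.\<close>

lemma op_prod_telescope:
  fixes F :: "nat \<Rightarrow> 'a::complex_banach \<Rightarrow> 'a"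
  assumes lin: "\<And>i. i < n \<Longrightarrow> bounded_linear (F i)"
    and stab: "\<And>k m x. k + m \<le> n \<Longrightarrow> norm (op_prod (\<lambda>i. F (k + i)) m x) \<le> M * norm x"
    and err: "\<And>i. i < n \<Longrightarrow> norm (u (Suc i) - F i (u i)) \<le> e" and M: "0 \<le> M"
  shows "norm (u n - op_prod F n (u 0)) \<le> real n * (M * e)"
  using lin stab err
proof (induction n arbitrary: F u)
  case (Suc n)
  note blF = Suc.prems(1)
  have bl: "bounded_linear (op_prod (\<lambda>i. F (Suc i)) m)" if "m \<le> n" for m
    using that
  proof (induction m)
    case (Suc m)
    have "bounded_linear (F (Suc m))" using blF Suc.prems by simp
    then show ?case using Suc by (simp add: comp_def bounded_linear_compose[of "F (Suc m)"])
  qed (simp add: id_def)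
  note lin = bounded_linear.linear[OF bl[OF order_refl]]
  have IH: "norm (u (Suc n) - op_prod (\<lambda>i. F (Suc i)) n (u (Suc 0))) \<le> real n * (M * e)"
  proof (rule Suc.IH)
    show "norm (op_prod (\<lambda>i. F (Suc (k + i))) m x) \<le> M * norm x" if "k + m \<le> n" for k m x
      using Suc.prems(2)[of "Suc k" m x] that by simp
  qed (use Suc.prems in auto)
  have "norm (op_prod (\<lambda>i. F (Suc i)) n (u (Suc 0) - F 0 (u 0))) \<le> M * norm (u (Suc 0) - F 0 (u 0))"
    using Suc.prems(2)[of 1 n] by simp
  also have "\<dots> \<le> M * e" using Suc.prems(3)[of 0] M by (intro mult_left_mono) auto
  finally have "norm (op_prod (\<lambda>i. F (Suc i)) n (u (Suc 0) - F 0 (u 0))) \<le> M * e" .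
  with IH have "norm ((u (Suc n) - op_prod (\<lambda>i. F (Suc i)) n (u (Suc 0))) + op_prod (\<lambda>i. F (Suc i)) n (u (Suc 0) - F 0 (u 0)))
      \<le> real n * (M * e) + M * e"
    by (rule norm_triangle_mono)
  then show ?case unfolding op_prod_Suc_right by (simp add: linear_diff[OF lin] algebra_simps)
qed simp

text \<open>Along f(\<tau>) = S(c (r - \<tau>)) U(\<tau>, s) y the generators c A(\<tau>) and c A(a)
  act against each other, leaving only their gap on the solution, at most c E. The factor
  \<open>c\<close> in the time of \<open>S\<close> turns the semigroup of A(a) into that of c
  A(a).\<close>

lemma frozen_generator_error:
  fixes D :: "'a::complex_banach set"
  assumes U: "evolution_system (\<lambda>_. D) (\<lambda>t x. c *\<^sub>R A t x) U" and c: "c > 0"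
    and s: "0 \<le> s" "s < 1" and y: "y \<in> D" and ar: "s \<le> a" "a \<le> r" "r \<le> 1"
    and gen: "generates D (A a) S" and S: "\<And>\<tau> x. 0 \<le> \<tau> \<Longrightarrow> norm (S \<tau> x) \<le> M * norm x" and M: "M > 0"
    and gap: "\<And>\<tau>. a \<le> \<tau> \<Longrightarrow> \<tau> \<le> r \<Longrightarrow> norm (A \<tau> (U \<tau> s y) - A a (U \<tau> s y)) \<le> E"
  shows "norm (U r s y - S (c * (r - a)) (U a s y)) \<le> M * (c * E) * (r - a)"
proof -
  let ?u = "\<lambda>\<tau>. U \<tau> s y"
  have sg: "C0_semigroup S" using gen by (simp add: generates_def)
  have Slin: "bounded_linear (S \<tau>)" if "0 \<le> \<tau>" for \<tau>
    using sg that by (simp add: C0_semigroup_def bounded_clinear_def)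
  have Sadd: "S (p + q) x = S p (S q x)" if "0 \<le> p" "0 \<le> q" for p q x
    using sg that by (simp add: C0_semigroup_def fun_eq_iff)
  have S0: "S 0 x = x" for x using sg by (simp add: C0_semigroup_def)
  define f where "f \<tau> = S (c * (r - \<tau>)) (?u \<tau>)" for \<tau>
  have "norm (f r - f a) \<le> (M * (c * E)) * (r - a)"
  proof (rule right_increment_bound[OF ar(2)])
    show "continuous_on {a..r} f"
      unfolding f_def
    proof (rule continuous_on_strong_apply[where M=M and W="\<lambda>\<tau>. S (c * (r - \<tau>))" and v="?u"])
      have cS: "continuous_on {0..} (\<lambda>s. S s x)" for x using sg by (simp add: C0_semigroup_def)
      show "continuous_on {a..r} (\<lambda>\<tau>. S (c * (r - \<tau>)) x)" for x
        by (rule continuous_on_compose2[OF cS]) (use c in \<open>auto intro!: continuous_intros\<close>)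
      show "continuous_on {a..r} ?u"
        by (rule continuous_on_subset[OF evolution_system_continuous(1)[OF U s(1)]]) (use ar in auto)
    qed (use c in \<open>auto intro!: S bounded_linear.linear[OF Slin]\<close>)
    fix \<tau> e :: real assume \<tau>: "a \<le> \<tau>" "\<tau> < r" and e: "e > 0"
    have \<tau>': "s \<le> \<tau>" "\<tau> < 1" using \<tau> ar by auto
    have uD: "?u \<tau> \<in> D" using evolution_systemD(2)[OF U s y] \<tau>' by simp
    have 1: "((\<lambda>h. (?u (\<tau> + h) - ?u \<tau>) /\<^sub>R h) \<longlongrightarrow> c *\<^sub>R A \<tau> (?u \<tau>)) (at_right 0)"
      by (rule has_vector_derivative_right_quotient[OF evolution_systemD(3)[OF U s y]]) (use \<tau>' in auto)
    have "((\<lambda>h. (S h (?u \<tau>) - ?u \<tau>) /\<^sub>R h) \<longlongrightarrow> A a (?u \<tau>)) (at_right 0)"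
      using gen uD unfolding generates_def by blast
    moreover have "filterlim (\<lambda>h. c * h) (at_right 0) (at_right 0)"
      using filterlim_times_pos[of "\<lambda>h. h" 0 "at_right 0" c 0] c by (simp add: filterlim_ident)
    ultimately have "((\<lambda>h. (S (c * h) (?u \<tau>) - ?u \<tau>) /\<^sub>R (c * h)) \<longlongrightarrow> A a (?u \<tau>)) (at_right 0)"
      by (rule filterlim_compose)
    then have "((\<lambda>h. c *\<^sub>R ((S (c * h) (?u \<tau>) - ?u \<tau>) /\<^sub>R (c * h))) \<longlongrightarrow> c *\<^sub>R A a (?u \<tau>)) (at_right 0)"
      by (intro tendsto_intros)
    then have 2: "((\<lambda>h. (S (c * h) (?u \<tau>) - ?u \<tau>) /\<^sub>R h) \<longlongrightarrow> c *\<^sub>R A a (?u \<tau>)) (at_right 0)"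
      using c by (simp flip: mult.assoc)
    have gap': "norm (c *\<^sub>R A \<tau> (?u \<tau>) - c *\<^sub>R A a (?u \<tau>)) \<le> c * E"
      using gap[of \<tau>] \<tau> c by (simp flip: scaleR_diff_right)
    have "\<forall>\<^sub>F h in at_right 0. norm (?u (\<tau> + h) - S (c * h) (?u \<tau>)) \<le> h * (norm (c *\<^sub>R A \<tau> (?u \<tau>) - c *\<^sub>R A a (?u \<tau>)) + e / M)"
      by (rule right_increment_gap[OF 1 2]) (use e M in simp)
    moreover have "\<forall>\<^sub>F h in at_right 0. 0 < h \<and> h < r - \<tau>"
      using eventually_at_right_real[of 0 "r - \<tau>"] \<tau> by simp
    ultimately show "\<forall>\<^sub>F h in at_right 0. norm (f (\<tau> + h) - f \<tau>) \<le> h * (M * (c * E) + e)"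
    proof eventually_elim
      fix h assume h: "norm (?u (\<tau> + h) - S (c * h) (?u \<tau>)) \<le> h * (norm (c *\<^sub>R A \<tau> (?u \<tau>) - c *\<^sub>R A a (?u \<tau>)) + e / M)"
        "0 < h \<and> h < r - \<tau>"
      let ?q = "c * (r - (\<tau> + h))"
      have q: "0 \<le> ?q" using c h by auto
      have "c * (r - \<tau>) = ?q + c * h" by (simp add: algebra_simps)
      then have "f \<tau> = S ?q (S (c * h) (?u \<tau>))" using Sadd[OF q, of "c * h"] c h by (simp add: f_def)
      then have "f (\<tau> + h) - f \<tau> = S ?q (?u (\<tau> + h) - S (c * h) (?u \<tau>))"
        using linear_diff[OF bounded_linear.linear[OF Slin[OF q]]] by (simp add: f_def)
      then have "norm (f (\<tau> + h) - f \<tau>) \<le> M * norm (?u (\<tau> + h) - S (c * h) (?u \<tau>))" using S[OF q] by simp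
      also have "\<dots> \<le> M * (h * (c * E + e / M))"
        using M h gap' by (intro mult_left_mono order_trans[OF h(1)]) auto
      also have "\<dots> = h * (M * (c * E) + e)" using M by (simp add: field_simps)
      finally show "norm (f (\<tau> + h) - f \<tau>) \<le> h * (M * (c * E) + e)" .
    qed
  qed
  then show ?thesis by (simp add: f_def S0)
qed

text \<open>The bound \<open>M\<close> is independent of \<open>c\<close>, that is, of \<epsilon>.
  On n equal steps \<open>U\<close> differs from a product of frozen semigroups by n local errors of
  order 1/n^2. The constant there depends on \<open>c\<close> and \<open>y\<close>, but the error
  disappears as n grows, and the product obeys (M, 0)-stability.\<close>

lemma evolution_system_bound:
  fixes D :: "'a::complex_banach set"
  assumes U: "evolution_system (\<lambda>_. D) (\<lambda>t x. c *\<^sub>R A t x) U" and c: "c > 0" and D: "closure D = UNIV"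
    and stab: "stable_family {0..1} (\<lambda>_. D) A M 0" and M: "1 \<le> M"
    and lip: "\<And>s t x. s \<in> {0..1} \<Longrightarrow> t \<in> {0..1} \<Longrightarrow> x \<in> D \<Longrightarrow> norm (A t x - A s x) \<le> C * \<bar>t - s\<bar> * graph_norm (A 0) x"
    and C: "C \<ge> 0"
    and equiv: "\<And>t x. t \<in> {0..1} \<Longrightarrow> x \<in> D \<Longrightarrow> graph_norm (A 0) x \<le> \<kappa> * graph_norm (A t) x"
    and st: "0 \<le> s" "s \<le> t" "t \<le> 1"
  shows "norm (U t s x) \<le> M * norm x"
proof (cases "s = t")
  case True
  then show ?thesis using evolution_system_refl[OF U D, of s x] st M mult_right_mono[of 1 M "norm x"] by simp
next
  case False
  then have s: "0 \<le> s" "s < 1" and lt: "s < t" using st by auto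
  obtain T where T: "\<And>t. t \<in> {0..1} \<Longrightarrow> generates D (A t) (T t)"
    and TM: "\<And>n t s. (\<forall>i<n. t i \<in> {0..1} \<and> 0 \<le> s i) \<Longrightarrow> mono_on {..<n} t \<Longrightarrow>
        onorm (op_prod (\<lambda>i. T (t i) (s i)) n) \<le> M"
    using stab unfolding stable_family_def by force
  have Tlin: "bounded_linear (T t s)" if "t \<in> {0..1}" "0 \<le> s" for t s
    using T[OF that(1)] that(2) by (simp add: generates_def C0_semigroup_def bounded_clinear_def)
  have prod_bound: "norm (op_prod (\<lambda>i. T (t i) (s i)) n x) \<le> M * norm x"
    if ts: "\<forall>i<n. t i \<in> {0..1} \<and> 0 \<le> s i" and "mono_on {..<n} t" for n t s x
  proof -
    have "bounded_linear (op_prod (\<lambda>i. T (t i) (s i)) m)" if "m \<le> n" for m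
      using that
    proof (induction m)
      case (Suc m)
      have "bounded_linear (T (t m) (s m))" using ts Suc.prems by (simp add: Tlin)
      then show ?case using Suc by (simp add: comp_def bounded_linear_compose[of "T (t m) (s m)"])
    qed (simp add: id_def)
    then have "norm (op_prod (\<lambda>i. T (t i) (s i)) n x) \<le> onorm (op_prod (\<lambda>i. T (t i) (s i)) n) * norm x"
      by (intro onorm) simp
    also have "\<dots> \<le> M * norm x" by (intro mult_right_mono TM that) simp
    finally show ?thesis .
  qed
  have T1: "norm (T t s x) \<le> M * norm x" if "t \<in> {0..1}" "0 \<le> s" for t s x
    using prod_bound[of 1 "\<lambda>_. t" "\<lambda>_. s" x] that by (simp add: mono_on_def)
  show ?thesis
  proof (rule bounded_by_density[OF _ D])
    show "bounded_linear (U t s)" using evolution_systemD(1)[OF U] st by blast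
    fix y assume y: "y \<in> D"
    have uD: "U \<tau> s y \<in> D" if "\<tau> \<in> {s..1}" for \<tau> using evolution_systemD(2)[OF U s y] that by simp
    have "continuous_on {s..1} (\<lambda>\<tau>. norm (U \<tau> s y) + norm (c *\<^sub>R A \<tau> (U \<tau> s y)) / c)"
      by (intro continuous_on_add continuous_on_divide continuous_on_norm continuous_on_const
          evolution_system_continuous(1)[OF U s(1)] evolution_systemD(4)[OF U s y]) (use c in auto)
    then have "bounded ((\<lambda>\<tau>. norm (U \<tau> s y) + norm (c *\<^sub>R A \<tau> (U \<tau> s y)) / c) ` {s..1})"
      by (intro compact_imp_bounded compact_continuous_image compact_Icc)
    then obtain R where "\<forall>\<tau>\<in>{s..1}. norm (norm (U \<tau> s y) + norm (c *\<^sub>R A \<tau> (U \<tau> s y)) / c) \<le> R"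
      unfolding bounded_iff by auto
    then have R: "norm (U \<tau> s y) + norm (c *\<^sub>R A \<tau> (U \<tau> s y)) / c \<le> R" if "\<tau> \<in> {s..1}" for \<tau>
      using that abs_ge_self order_trans unfolding real_norm_def by blast
    \<comment> \<open>Bounds the graph norm of A(0) along the whole solution: \<open>R\<close> comes
      from continuity on a compact interval, \<kappa> from the comparison of graph norms.\<close>
    define R' where "R' = \<bar>\<kappa>\<bar> * R"
    have R': "graph_norm (A 0) (U \<tau> s y) \<le> R'" if \<tau>: "\<tau> \<in> {s..1}" for \<tau>
    proof -
      have "graph_norm (A 0) (U \<tau> s y) \<le> \<kappa> * graph_norm (A \<tau>) (U \<tau> s y)"
        using \<tau> s by (intro equiv uD) auto
      also have "\<dots> \<le> \<bar>\<kappa>\<bar> * R"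
        using R[OF \<tau>] c by (intro mult_mono graph_norm_nonneg) (auto simp: graph_norm_def)
      finally show ?thesis by (simp add: R'_def)
    qed
    have R'0: "0 \<le> R'" using R'[of s] s graph_norm_nonneg[of "A 0" "U s s y"] by auto
    \<comment> \<open>This is n^2 M e for the step size h = (t - s)/n and the local error
      \<open>e\<close> below, which carries two factors \<open>h\<close>.\<close>
    define E where "E = M * M * c * C * R' * (t - s)\<^sup>2"
    have step: "norm (U t s y) \<le> M * norm y + E / real n" if n: "n > 0" for n :: nat
    proof -
      define h where "h = (t - s) / real n"
      define p where "p i = s + real i * h" for i
      have h: "h > 0" using lt n by (simp add: h_def)
      have nh: "real n * h = t - s" using n by (simp add: h_def)
      have pmono: "p i \<le> p j" if "i \<le> j" for i j using that h by (simp add: p_def mult_right_mono)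
      have pn: "p n = t" "p 0 = s" by (simp_all add: p_def nh)
      have pI: "p i \<in> {s..t}" if "i \<le> n" for i using pmono[of 0 i] pmono[OF that] by (simp add: pn)
      have pI1: "p i \<in> {0..1}" if "i \<le> n" for i using pI[OF that] st by auto
      define F where "F i = T (p i) (c * h)" for i
      define e where "e = M * (c * (C * h * R')) * h"
      have "norm (U (p n) s y - op_prod F n (U (p 0) s y)) \<le> real n * (M * e)"
      proof (rule op_prod_telescope[where u = "\<lambda>i. U (p i) s y"])
        show "bounded_linear (F i)" if "i < n" for i
          unfolding F_def using pI1[of i] that c h by (intro Tlin) auto
        show "norm (op_prod (\<lambda>i. F (k + i)) m x) \<le> M * norm x" if "k + m \<le> n" for k m x
          unfolding F_def using pI1 that c h by (intro prod_bound) (auto simp: mono_on_def intro!: pmono)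
        show "norm (U (p (Suc i)) s y - F i (U (p i) s y)) \<le> e" if i: "i < n" for i
        proof -
          have hp: "p (Suc i) - p i = h" by (simp add: p_def algebra_simps)
          have "norm (U (p (Suc i)) s y - T (p i) (c * (p (Suc i) - p i)) (U (p i) s y)) \<le> M * (c * (C * h * R')) * (p (Suc i) - p i)"
          proof (rule frozen_generator_error[OF U c s y])
            show "s \<le> p i" "p i \<le> p (Suc i)" "p (Suc i) \<le> 1" using pI[of i] pI[of "Suc i"] i pmono[of i "Suc i"] st by auto
            show "generates D (A (p i)) (T (p i))" using T pI1 i by simp
            show "norm (T (p i) \<tau> x) \<le> M * norm x" if "0 \<le> \<tau>" for \<tau> x using T1 pI1 i that by simp
            fix \<tau> assume \<tau>: "p i \<le> \<tau>" "\<tau> \<le> p (Suc i)"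
            then have \<tau>s: "\<tau> \<in> {s..1}" using pI[of i] pI[of "Suc i"] i st by auto
            have "norm (A \<tau> (U \<tau> s y) - A (p i) (U \<tau> s y)) \<le> C * \<bar>\<tau> - p i\<bar> * graph_norm (A 0) (U \<tau> s y)"
              using \<tau>s s pI1[of i] i by (intro lip uD) auto
            also have "\<dots> \<le> C * h * R'"
              using \<tau> hp C h R'[OF \<tau>s] by (intro mult_mono graph_norm_nonneg) auto
            finally show "norm (A \<tau> (U \<tau> s y) - A (p i) (U \<tau> s y)) \<le> C * h * R'" .
          qed (use M in simp)
          then show ?thesis by (simp add: hp F_def e_def)
        qed
      qed (use M in simp)
      moreover have "real n * (M * e) = E / real n"
        using n by (simp add: e_def E_def h_def field_simps power2_eq_square)
      moreover have "norm (op_prod F n (U (p 0) s y)) \<le> M * norm y"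
      proof -
        have "U (p 0) s y = y" using evolution_system_refl[OF U D, of s y] s by (simp add: pn)
        then show ?thesis
          unfolding F_def using pI1 c h prod_bound[of n p "\<lambda>_. c * h" y] by (auto simp: mono_on_def intro!: pmono)
      qed
      ultimately show ?thesis
        using norm_triangle_sub[of "U t s y" "op_prod F n (U (p 0) s y)"] by (simp add: pn)
    qed
    have "(\<lambda>n. M * norm y + E / real n) \<longlonglongrightarrow> M * norm y + 0"
      by (intro tendsto_intros lim_const_over_n)
    then show "norm (U t s y) \<le> M * norm y"
      by (intro tendsto_lowerbound[of _ _ sequentially])
        (auto intro!: eventually_sequentiallyI[of 1] step)
  qed
qed

text \<open>The cases of interest are \<open>B = 0\<close> (boundedness of \<open>V\<close>) and an exact solution \<open>B\<close> of the
  commutator equation.\<close>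

lemma duhamel_increment:
  fixes D :: "'a::complex_banach set" and Y :: "real \<Rightarrow> 'a \<Rightarrow> 'a" and B :: "real \<Rightarrow> 'a cop"
  assumes \<epsilon>: "\<epsilon> > 0"
    and U: "evolution_system (\<lambda>_. D) (\<lambda>t x. (1 / \<epsilon>) *\<^sub>R A t x) U"
    and V: "evolution_system (\<lambda>_. D) (\<lambda>t x. (1 / \<epsilon>) *\<^sub>R A t x + Y t x) V"
    and D: "closure D = UNIV" and A: "\<And>t. t \<in> {0..1} \<Longrightarrow> clinear_on D (A t)"
    and UM: "\<And>s t x. 0 \<le> s \<Longrightarrow> s \<le> t \<Longrightarrow> t \<le> 1 \<Longrightarrow> norm (U t s x) \<le> M * norm x" and M: "M > 0"
    and st: "0 \<le> s" "s < t" "t \<le> 1" and y: "y \<in> D"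
    and B: "\<And>\<tau> x. \<tau> \<in> {s..t} \<Longrightarrow> x \<in> D \<Longrightarrow> capp (B \<tau>) x \<in> D"
    and BL: "\<And>\<tau> \<tau>'. \<tau> \<in> {s..t} \<Longrightarrow> \<tau>' \<in> {s..t} \<Longrightarrow> norm (B \<tau>' - B \<tau>) \<le> L * norm (\<tau>' - \<tau>)"
    and L: "L \<ge> 0" and r: "r \<ge> 0"
    and residual: "\<And>\<tau> x. \<tau> \<in> {s..t} \<Longrightarrow> x \<in> D \<Longrightarrow>
      norm (Y \<tau> x - (capp (B \<tau>) (A \<tau> x) - A \<tau> (capp (B \<tau>) x)) - \<epsilon> *\<^sub>R capp (B \<tau>) (Y \<tau> x)) \<le> r * norm x"
    and m: "\<And>\<tau>. \<tau> \<in> {s..t} \<Longrightarrow> norm (V \<tau> s y) \<le> m"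
  shows "norm ((V t s y - \<epsilon> *\<^sub>R capp (B t) (V t s y)) - U t s (y - \<epsilon> *\<^sub>R capp (B s) y)) \<le> M * (r + \<epsilon> * L) * m * (t - s)"
proof -
  define v where "v \<tau> = V \<tau> s y" for \<tau>
  have s1: "s < 1" using st by simp
  have vD: "v \<tau> \<in> D" if "s \<le> \<tau>" "\<tau> \<le> 1" for \<tau> using evolution_systemD(2)[OF V st(1) s1 y that] by (simp add: v_def)
  have vc: "continuous_on {s..t} v"
    unfolding v_def by (rule continuous_on_subset[OF evolution_system_continuous(1)[OF V st(1)]]) (use st in auto)
  \<comment> \<open>The corrected curve v - \<epsilon> B v is carried to the final time by
    \<open>U\<close>; the values of \<open>f\<close> at \<open>t\<close> and \<open>s\<close> are
    the two terms compared in the claim.\<close>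
  define f where "f \<tau> = U t \<tau> (v \<tau> - \<epsilon> *\<^sub>R capp (B \<tau>) (v \<tau>))" for \<tau>
  have Bc: "continuous_on {s..t} B"
    by (rule lipschitz_on_continuous_on[OF lipschitz_onI[OF _ L]]) (use BL in \<open>auto simp: dist_norm\<close>)
  have "norm (f t - f s) \<le> M * (r + \<epsilon> * L) * m * (t - s)"
  proof (rule right_increment_bound)
    show "continuous_on {s..t} f"
      unfolding f_def
    proof (rule continuous_on_strong_apply[where M=M and W="U t"])
      show "continuous_on {s..t} (\<lambda>\<tau>. U t \<tau> x)" for x
        by (rule evolution_system_continuous(2)[OF U st(1,3)])
      show "linear (U t \<tau>)" if "\<tau> \<in> {s..t}" for \<tau>
        using evolution_systemD(1)[OF U, of \<tau> t] that st by (auto intro: bounded_linear.linear)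
      show "continuous_on {s..t} (\<lambda>\<tau>. v \<tau> - \<epsilon> *\<^sub>R capp (B \<tau>) (v \<tau>))"
        by (intro continuous_intros vc bounded_bilinear.continuous_on[OF bounded_bilinear_capp] Bc)
    qed (use UM st in auto)
    fix \<tau> e :: real assume \<tau>: "s \<le> \<tau>" "\<tau> < t" and e: "e > 0"
    have \<tau>0: "0 \<le> \<tau>" "\<tau> < 1" "\<tau> \<le> 1" "\<tau> \<in> {s..t}" "\<tau> \<in> {0..1}" using \<tau> st by auto
    let ?x = "v \<tau>"
    have xD: "?x \<in> D" using vD \<tau> \<tau>0 by simp
    define d where "d = (1 / \<epsilon>) *\<^sub>R A \<tau> ?x + Y \<tau> ?x"
    define g where "g = ?x - \<epsilon> *\<^sub>R capp (B \<tau>) ?x"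
    have BD: "capp (B \<tau>) ?x \<in> D" by (rule B[OF \<tau>0(4) xD])
    have gD: "g \<in> D" unfolding g_def using xD BD clinear_on_D(5,7)[OF A[OF \<tau>0(5)]] by blast
    have "((\<lambda>h. (v (\<tau> + h) - ?x) /\<^sub>R h) \<longlongrightarrow> d) (at_right 0)"
      unfolding d_def v_def
      by (rule has_vector_derivative_right_quotient[OF evolution_systemD(3)[OF V st(1) s1 y]]) (use \<tau> \<tau>0 in auto)
    then have "((\<lambda>h. (v (\<tau> + h) - ?x) /\<^sub>R h - \<epsilon> *\<^sub>R capp (B \<tau>) ((v (\<tau> + h) - ?x) /\<^sub>R h)) \<longlongrightarrow> d - \<epsilon> *\<^sub>R capp (B \<tau>) d) (at_right 0)"
      by (intro tendsto_intros bounded_linear.tendsto[OF bounded_linear_capp])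
    then have 1: "((\<lambda>h. ((v (\<tau> + h) - \<epsilon> *\<^sub>R capp (B \<tau>) (v (\<tau> + h))) - g) /\<^sub>R h) \<longlongrightarrow> d - \<epsilon> *\<^sub>R capp (B \<tau>) d) (at_right 0)"
      by (rule tendsto_cong[THEN iffD1, rotated])
        (auto simp: g_def linear_scale[OF linear_capp] linear_diff[OF linear_capp] algebra_simps intro!: always_eventually)
    have 2: "((\<lambda>h. (U (\<tau> + h) \<tau> g - g) /\<^sub>R h) \<longlongrightarrow> (1 / \<epsilon>) *\<^sub>R A \<tau> g) (at_right 0)"
    proof -
      have "U \<tau> \<tau> g = g" by (rule evolution_system_refl[OF U D \<tau>0(1,3)])
      then show ?thesis
        using has_vector_derivative_right_quotient[OF evolution_systemD(3)[OF U \<tau>0(1,2) gD, of \<tau>]] \<tau>0 by simp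
    qed
    have "A \<tau> g = A \<tau> ?x - \<epsilon> *\<^sub>R A \<tau> (capp (B \<tau>) ?x)"
      unfolding g_def using xD BD by (simp add: clinear_on_D[OF A[OF \<tau>0(5)]])
    \<comment> \<open>The terms (1/\<epsilon>) A v cancel; \<epsilon> B applied to (1/\<epsilon>) A
      v combines with A B v to a commutator of order 1, which is to match \<open>Y\<close>.\<close>
    then have "d - \<epsilon> *\<^sub>R capp (B \<tau>) d - (1 / \<epsilon>) *\<^sub>R A \<tau> g
        = Y \<tau> ?x - (capp (B \<tau>) (A \<tau> ?x) - A \<tau> (capp (B \<tau>) ?x)) - \<epsilon> *\<^sub>R capp (B \<tau>) (Y \<tau> ?x)"
      using \<epsilon> by (simp add: d_def linear_add[OF linear_capp] linear_scale[OF linear_capp] scaleR_add_right scaleR_diff_right)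
    then have res: "norm (d - \<epsilon> *\<^sub>R capp (B \<tau>) d - (1 / \<epsilon>) *\<^sub>R A \<tau> g) \<le> r * m"
      using residual[OF \<tau>0(4) xD] m[OF \<tau>0(4)] r by (simp add: v_def) (meson mult_left_mono order_trans)
    have "\<forall>\<^sub>F h in at_right 0. norm ((v (\<tau> + h) - \<epsilon> *\<^sub>R capp (B \<tau>) (v (\<tau> + h))) - U (\<tau> + h) \<tau> g)
        \<le> h * (norm (d - \<epsilon> *\<^sub>R capp (B \<tau>) d - (1 / \<epsilon>) *\<^sub>R A \<tau> g) + e / M)"
      by (rule right_increment_gap[OF 1 2]) (use e M in simp)
    moreover have "\<forall>\<^sub>F h in at_right 0. 0 < h \<and> h < t - \<tau>"
      using eventually_at_right_real[of 0 "t - \<tau>"] \<tau> by simp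
    ultimately show "\<forall>\<^sub>F h in at_right 0. norm (f (\<tau> + h) - f \<tau>) \<le> h * (M * (r + \<epsilon> * L) * m + e)"
    proof eventually_elim
      fix h assume h: "norm ((v (\<tau> + h) - \<epsilon> *\<^sub>R capp (B \<tau>) (v (\<tau> + h))) - U (\<tau> + h) \<tau> g)
        \<le> h * (norm (d - \<epsilon> *\<^sub>R capp (B \<tau>) d - (1 / \<epsilon>) *\<^sub>R A \<tau> g) + e / M)" "0 < h \<and> h < t - \<tau>"
      let ?z = "v (\<tau> + h)"
      let ?\<phi> = "?z - \<epsilon> *\<^sub>R capp (B (\<tau> + h)) ?z"
      have th: "\<tau> + h \<in> {s..t}" "0 \<le> \<tau> + h" "\<tau> \<le> \<tau> + h" "\<tau> + h \<le> t" using h \<tau> \<tau>0 by auto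
      \<comment> \<open>Splitting \<open>U\<close> at \<tau> + h leaves only the forward evolution
        of \<open>g\<close> from \<tau>, whose right derivative is available since \<open>g\<close>
        lies in \<open>D\<close>.\<close>
      have "f \<tau> = U t (\<tau> + h) (U (\<tau> + h) \<tau> g)"
        using evolution_systemD(5)[OF U \<tau>0(1) th(3,4) st(3)] by (simp add: f_def g_def)
      then have "f (\<tau> + h) - f \<tau> = U t (\<tau> + h) (?\<phi> - U (\<tau> + h) \<tau> g)"
        using linear_diff[OF bounded_linear.linear[OF evolution_systemD(1)[OF U th(2,4) st(3)]]] by (simp add: f_def)
      then have "norm (f (\<tau> + h) - f \<tau>) \<le> M * norm (?\<phi> - U (\<tau> + h) \<tau> g)"
        using UM[OF th(2,4) st(3)] by simp
      \<comment> \<open>\<open>B\<close> was frozen at \<tau> so that the difference quotient has a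
        limit; its own increment is of size L h and carries the factor \<epsilon>.\<close>
      also have "?\<phi> - U (\<tau> + h) \<tau> g = ((?z - \<epsilon> *\<^sub>R capp (B \<tau>) ?z) - U (\<tau> + h) \<tau> g) - \<epsilon> *\<^sub>R capp (B (\<tau> + h) - B \<tau>) ?z"
        by (simp add: capp_simps algebra_simps)
      also have "norm \<dots> \<le> h * (r * m + e / M) + \<epsilon> * (L * h * m)"
      proof (rule order_trans[OF norm_triangle_ineq4 add_mono])
        show "norm ((?z - \<epsilon> *\<^sub>R capp (B \<tau>) ?z) - U (\<tau> + h) \<tau> g) \<le> h * (r * m + e / M)"
          using res h by (intro order_trans[OF h(1)] mult_left_mono) auto
        have "norm (capp (B (\<tau> + h) - B \<tau>) ?z) \<le> norm (B (\<tau> + h) - B \<tau>) * norm ?z" by (rule norm_capp)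
        also have "\<dots> \<le> (L * h) * m"
          using BL[OF \<tau>0(4) th(1)] m[OF th(1)] h L by (intro mult_mono) (auto simp: v_def)
        finally show "norm (\<epsilon> *\<^sub>R capp (B (\<tau> + h) - B \<tau>) ?z) \<le> \<epsilon> * (L * h * m)"
          using \<epsilon> by simp
      qed
      finally have "norm (f (\<tau> + h) - f \<tau>) \<le> M * (h * (r * m + e / M) + \<epsilon> * (L * h * m))"
        using M by simp
      also have "\<dots> = h * (M * (r + \<epsilon> * L) * m + e)" using M by (simp add: field_simps)
      finally show "norm (f (\<tau> + h) - f \<tau>) \<le> h * (M * (r + \<epsilon> * L) * m + e)" .
    qed
  qed (use st in simp)
  moreover have "f t = v t - \<epsilon> *\<^sub>R capp (B t) (v t)"
    using evolution_system_refl[OF U D, of t] st by (simp add: f_def)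
  moreover have "f s = U t s (y - \<epsilon> *\<^sub>R capp (B s) y)"
    using evolution_system_refl[OF V D, of s] st by (simp add: f_def v_def)
  ultimately show ?thesis by (simp add: v_def)
qed

text \<open>\<open>Y\<close> is bounded independently of \<epsilon>, so the comparison with
  \<open>U\<close> (the case B = 0) costs at most M K (t - s) times the maximum of the solution. On
  intervals shorter than \<open>d\<close> this is at most half the maximum and is absorbed;
  \<open>d\<close> does not depend on \<epsilon>, so neither does the number of intervals.\<close>

lemma perturbed_evolution_bound:
  fixes D :: "'a::complex_banach set" and Y :: "real \<Rightarrow> 'a \<Rightarrow> 'a" and U V :: "real \<Rightarrow> real \<Rightarrow> real \<Rightarrow> 'a \<Rightarrow> 'a"
  assumes U: "\<And>\<epsilon>. \<epsilon> > 0 \<Longrightarrow> evolution_system (\<lambda>_. D) (\<lambda>t x. (1 / \<epsilon>) *\<^sub>R A t x) (U \<epsilon>)"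
    and V: "\<And>\<epsilon>. \<epsilon> > 0 \<Longrightarrow> evolution_system (\<lambda>_. D) (\<lambda>t x. (1 / \<epsilon>) *\<^sub>R A t x + Y t x) (V \<epsilon>)"
    and D: "closure D = UNIV" and A: "\<And>t. t \<in> {0..1} \<Longrightarrow> clinear_on D (A t)"
    and UM: "\<And>\<epsilon> s t x. \<epsilon> > 0 \<Longrightarrow> 0 \<le> s \<Longrightarrow> s \<le> t \<Longrightarrow> t \<le> 1 \<Longrightarrow> norm (U \<epsilon> t s x) \<le> M * norm x" and M: "M > 0"
    and K: "K \<ge> 0" and Y: "\<And>t x. t \<in> {0..1} \<Longrightarrow> norm (Y t x) \<le> K * norm x"
  obtains N where "N \<ge> 0" "\<And>\<epsilon> s t x. \<epsilon> > 0 \<Longrightarrow> 0 \<le> s \<Longrightarrow> s \<le> t \<Longrightarrow> t \<le> 1 \<Longrightarrow> norm (V \<epsilon> t s x) \<le> N * norm x"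
proof -
  define Q where "Q a b \<longleftrightarrow> (\<exists>N\<ge>0. \<forall>\<epsilon>>0. \<forall>s t x. 0 \<le> s \<and> a \<le> s \<and> s \<le> t \<and> t \<le> b \<and> t \<le> 1 \<longrightarrow> norm (V \<epsilon> t s x) \<le> N * norm x)" for a b
  have "(0::real) \<le> 1" by simp
  then have "Q 0 1"
  proof (induction rule: Bolzano)
    case (trans a b c)
    obtain N where N: "N \<ge> 0" "\<And>\<epsilon> s t x. \<epsilon> > 0 \<Longrightarrow> 0 \<le> s \<and> a \<le> s \<and> s \<le> t \<and> t \<le> b \<and> t \<le> 1 \<Longrightarrow> norm (V \<epsilon> t s x) \<le> N * norm x"
      using trans(1) unfolding Q_def by blast
    obtain N' where N': "N' \<ge> 0" "\<And>\<epsilon> s t x. \<epsilon> > 0 \<Longrightarrow> 0 \<le> s \<and> b \<le> s \<and> s \<le> t \<and> t \<le> c \<and> t \<le> 1 \<Longrightarrow> norm (V \<epsilon> t s x) \<le> N' * norm x"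
      using trans(2) unfolding Q_def by blast
    have "norm (V \<epsilon> t s x) \<le> (N + N' + N' * N) * norm x"
      if \<epsilon>: "\<epsilon> > 0" and st: "0 \<le> s" "a \<le> s" "s \<le> t" "t \<le> c" "t \<le> 1" for \<epsilon> s t x
    proof -
      consider "t \<le> b" | "b \<le> s" | "s < b" "b < t" by linarith
      then have "norm (V \<epsilon> t s x) \<le> N * norm x \<or> norm (V \<epsilon> t s x) \<le> N' * norm x \<or> norm (V \<epsilon> t s x) \<le> N' * N * norm x"
      proof cases
        case 3
        have "V \<epsilon> t s x = V \<epsilon> t b (V \<epsilon> b s x)" using evolution_systemD(5)[OF V[OF \<epsilon>], of s b t x] 3 st by simp
        then have "norm (V \<epsilon> t s x) \<le> N' * norm (V \<epsilon> b s x)" using N'(2)[OF \<epsilon>, of b t] 3 st by simp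
        also have "\<dots> \<le> N' * (N * norm x)" using N(2)[OF \<epsilon>, of s b x] 3 st N'(1) by (intro mult_left_mono) auto
        finally show ?thesis by (simp add: mult.assoc)
      qed (use N(2)[OF \<epsilon>, of s t x] N'(2)[OF \<epsilon>, of s t x] st in auto)
      moreover have "0 \<le> N * norm x" "0 \<le> N' * norm x" "0 \<le> N' * N * norm x" using N(1) N'(1) by auto
      ultimately show ?thesis by (auto simp: distrib_right)
    qed
    then show ?case unfolding Q_def using N(1) N'(1) by (intro exI[of _ "N + N' + N' * N"]) auto
  next
    case (local t0)
    define d where "d = 1 / (2 * (M * K + 1))"
    have MK: "M * K \<ge> 0" using M K by simp
    have d: "d > 0" using MK by (simp add: d_def add_nonneg_pos)
    have "norm (V \<epsilon> t s x) \<le> 2 * (M + 1) * norm x"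
      if \<epsilon>: "\<epsilon> > 0" and st: "0 \<le> s" "s \<le> t" "t \<le> 1" "t - s < d" for \<epsilon> s t x
    proof (cases "s = t")
      case True
      then show ?thesis using evolution_system_refl[OF V[OF \<epsilon>] D, of s x] st M mult_right_mono[of 1 "2 * (M + 1)" "norm x"] by simp
    next
      case False
      then have lt: "s < t" "s < 1" using st by auto
      show ?thesis
      proof (rule bounded_by_density[OF _ D])
        show "bounded_linear (V \<epsilon> t s)" using evolution_systemD(1)[OF V[OF \<epsilon>]] st by blast
        fix y assume y: "y \<in> D"
        have "continuous_on {s..t} (\<lambda>\<tau>. norm (V \<epsilon> \<tau> s y))"
          by (intro continuous_on_norm continuous_on_subset[OF evolution_system_continuous(1)[OF V[OF \<epsilon>] st(1)]]) (use st in auto)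
        \<comment> \<open>The maximum is attained, so the comparison can be made at the maximising
          time itself, with the same quantity on both sides.\<close>
        then obtain \<tau>0 where \<tau>0: "\<tau>0 \<in> {s..t}" "\<And>\<tau>. \<tau> \<in> {s..t} \<Longrightarrow> norm (V \<epsilon> \<tau> s y) \<le> norm (V \<epsilon> \<tau>0 s y)"
          using continuous_attains_sup[of "{s..t}" "\<lambda>\<tau>. norm (V \<epsilon> \<tau> s y)"] lt by auto
        let ?m = "norm (V \<epsilon> \<tau>0 s y)"
        \<comment> \<open>The extra \<open>norm y\<close> covers a maximum at the initial
          time.\<close>
        have "?m \<le> M * norm y + norm y + 1 / 2 * ?m"
        proof (cases "s = \<tau>0")
          case True
          then have eq: "V \<epsilon> \<tau>0 s y = y" using evolution_system_refl[OF V[OF \<epsilon>] D, of s y] st by simp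
          have "0 \<le> M * norm y" using M by simp
          then show ?thesis unfolding eq using norm_ge_zero[of y] by linarith
        next
          case False
          then have s\<tau>: "s < \<tau>0" "\<tau>0 \<le> 1" using \<tau>0(1) st by auto
          have "norm ((V \<epsilon> \<tau>0 s y - \<epsilon> *\<^sub>R capp 0 (V \<epsilon> \<tau>0 s y)) - U \<epsilon> \<tau>0 s (y - \<epsilon> *\<^sub>R capp 0 y)) \<le> M * (K + \<epsilon> * 0) * ?m * (\<tau>0 - s)"
            by (rule duhamel_increment[OF \<epsilon> U[OF \<epsilon>] V[OF \<epsilon>] D A UM[OF \<epsilon>] M st(1) s\<tau> y, where B="\<lambda>_. 0"])
              (use \<tau>0 Y K st s\<tau> clinear_on_D(9)[OF A[of 0]] clinear_on_D(10)[OF A] in \<open>auto simp: capp_simps\<close>)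
          then have "norm (V \<epsilon> \<tau>0 s y - U \<epsilon> \<tau>0 s y) \<le> (M * K) * (\<tau>0 - s) * ?m"
            by (simp add: capp_simps mult_ac)
          also have "\<dots> \<le> 1 / 2 * ?m"
          proof (rule mult_right_mono)
            have "(M * K) * (\<tau>0 - s) \<le> (M * K + 1) * d"
              using MK \<tau>0(1) st s\<tau> by (intro mult_mono) auto
            also have "\<dots> = 1 / 2" using MK by (simp add: d_def field_simps add_nonneg_eq_0_iff)
            finally show "(M * K) * (\<tau>0 - s) \<le> 1 / 2" .
          qed simp
          finally have "norm (V \<epsilon> \<tau>0 s y - U \<epsilon> \<tau>0 s y) \<le> 1 / 2 * ?m" .
          moreover have "norm (U \<epsilon> \<tau>0 s y) \<le> M * norm y" using UM[OF \<epsilon> st(1), of \<tau>0 y] s\<tau> by simp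
          moreover have "?m \<le> norm (U \<epsilon> \<tau>0 s y) + norm (V \<epsilon> \<tau>0 s y - U \<epsilon> \<tau>0 s y)" by (rule norm_triangle_sub)
          moreover have "0 \<le> norm y" by simp
          ultimately show ?thesis by linarith
        qed
        then have "?m \<le> 2 * (M + 1) * norm y" by (simp add: algebra_simps)
        then show "norm (V \<epsilon> t s y) \<le> 2 * (M + 1) * norm y" using \<tau>0(2)[of t] st by simp
      qed
    qed
    then have "Q a b" if "b - a < d" for a b
      unfolding Q_def using that M by (intro exI[of _ "2 * (M + 1)"]) auto
    with d show ?case by blast
  qed
  then show ?thesis unfolding Q_def by (auto intro: that)
qed

theorem theorem3p1:
  fixes D :: "'a::complex_banach set"
    and A P P' :: "real \<Rightarrow> 'a \<Rightarrow> 'a"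
    and \<sigma> :: "real \<Rightarrow> complex set"
    and M :: real
    and U V :: "real \<Rightarrow> real \<Rightarrow> real \<Rightarrow> 'a \<Rightarrow> 'a"
  assumes "\<And>t. t \<in> {0..1} \<Longrightarrow> densely_defined_closed D (A t)"
    and "1 \<le> M"
    and "stable_family {0..1} (\<lambda>_. D) A M 0"
    and "W_star 1 {0..1} D (graph_norm (A 0)) A"
    and "\<And>t. t \<in> {0..1} \<Longrightarrow> compact (\<sigma> t) \<and> \<sigma> t \<subseteq> spectrum UNIV D (A t)"
    and "\<And>t0. t0 \<in> {0..1} \<Longrightarrow>
           \<not> falls_into_at {0..1} \<sigma> (\<lambda>t. spectrum UNIV D (A t) - \<sigma> t) t0"
    and "set_continuous_on {0..1} \<sigma>"
    and "\<And>t. t \<in> {0..1} \<Longrightarrow> associated_projection D (A t) (\<sigma> t) (P t)"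
    and "W_star 2 {0..1} UNIV norm P"
    and "W_deriv {0..1} UNIV norm P P'" and "W_star 1 {0..1} UNIV norm P'"
    and "\<And>\<epsilon>. 0 < \<epsilon> \<Longrightarrow> evolution_system (\<lambda>_. D) (\<lambda>t x. (1 / \<epsilon>) *\<^sub>R A t x) (U \<epsilon>)"
    and "\<And>\<epsilon>. 0 < \<epsilon> \<Longrightarrow> evolution_system (\<lambda>_. D)
           (\<lambda>t x. (1 / \<epsilon>) *\<^sub>R A t x + commutator (P' t) (P t) x) (V \<epsilon>)"
  shows "(\<lambda>\<epsilon>. SUP t\<in>{0..1}. onorm (\<lambda>x. U \<epsilon> t 0 x - V \<epsilon> t 0 x)) \<in> O[at_right 0](\<lambda>\<epsilon>. \<epsilon>)"
proof -
  note A = assms(1) and P = assms(8) and U = assms(12) and V = assms(13)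
  have zero: "(0::real) \<in> {0..1}" by simp
  have cl: "clinear_on D (A t)" if "t \<in> {0..1}" for t using A[OF that] by (simp add: densely_defined_closed_def)
  have D: "closure D = UNIV" using A[OF zero] by (simp add: densely_defined_closed_def)
  have rs: "resolvent_set UNIV D (A t) \<noteq> {}" if "t \<in> {0..1}" for t
    using P[OF that] by (simp add: associated_projection_def)

  \<comment> \<open>Lipschitz bound for A and \<epsilon>-uniform bound for U\<close>
  obtain A' where "W_deriv {0..1} D (graph_norm (A 0)) A A'" using assms(4) by auto
  from W_deriv_lipschitz[OF this graph_norm_nonneg] obtain C where C: "C \<ge> 0"
    and lip: "\<And>s t x. s \<in> {0..1} \<Longrightarrow> t \<in> {0..1} \<Longrightarrow> x \<in> D \<Longrightarrow> norm (A t x - A s x) \<le> C * \<bar>t - s\<bar> * graph_norm (A 0) x"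
    by metis
  obtain \<kappa> where \<kappa>: "\<And>t x. t \<in> {0..1} \<Longrightarrow> x \<in> D \<Longrightarrow> graph_norm (A 0) x \<le> \<kappa> * graph_norm (A t) x"
    using graph_norms_equivalent[OF A lip C rs] by blast
  have UM: "norm (U \<epsilon> t s x) \<le> M * norm x" if "\<epsilon> > 0" "0 \<le> s" "s \<le> t" "t \<le> 1" for \<epsilon> s t x
    using that by (intro evolution_system_bound[OF U _ D assms(3,2) lip C \<kappa>]) auto

  \<comment> \<open>The projections and their derivatives as Lipschitz families\<close>
  define p where "p t = cop_of (P t)" for t
  define p' where "p' t = cop_of (P' t)" for t
  have Pop: "bounded_op UNIV norm (P t)" "bounded_op UNIV norm (P' t)" if "t \<in> {0..1}" for t
    using assms(9,11) that by (auto simp: numeral_2_eq_2)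
  have cp: "capp (p t) = P t" "capp (p' t) = P' t" if "t \<in> {0..1}" for t
    unfolding p_def p'_def using Pop[OF that] by (auto intro: capp_cop_of bounded_op_imp_bounded_clinear)
  have lip_cop: "lip_family {0..1} q"
    if W: "W_deriv {0..1} UNIV norm R R'" and q: "\<And>t. t \<in> {0..1} \<Longrightarrow> capp (q t) = R t" for q R R'
  proof -
    obtain L where L: "L \<ge> 0" "\<And>s t x. s \<in> {0..1} \<Longrightarrow> t \<in> {0..1} \<Longrightarrow> norm (R t x - R s x) \<le> L * \<bar>t - s\<bar> * norm x"
      using W_deriv_lipschitz[OF W norm_ge_zero] by (metis UNIV_I)
    have diff: "norm (q t - q s) \<le> L * norm (t - s)" if "s \<in> {0..1}" "t \<in> {0..1}" for s t
      by (rule norm_cop_le) (use L that in \<open>auto simp: capp_simps q\<close>)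
    show ?thesis
    proof (rule lip_familyI[OF _ diff])
      fix t :: real assume t: "t \<in> {0..1}"
      have "norm (q t) \<le> norm (q 0) + norm (q t - q 0)" by (rule norm_triangle_sub)
      also have "norm (q t - q 0) \<le> L * 1"
        using diff[OF zero t] t L(1) mult_left_mono[of "norm (t - 0)" 1 L] by simp
      finally show "norm (q t) \<le> norm (q 0) + L * 1" by simp
    qed
  qed
  obtain P'' where P'': "W_deriv {0..1} UNIV norm P' P''" using assms(11) by auto
  have lp: "lip_family {0..1} p" "lip_family {0..1} p'"
    using lip_cop[OF assms(10) cp(1)] lip_cop[OF P'' cp(2)] by blast+

  \<comment> \<open>\<epsilon>-uniform bound for V\<close>
  define Y where "Y t x = commutator (P' t) (P t) x" for t x
  have "lip_family {0..1} (\<lambda>t. p' t * p t - p t * p' t)" by (intro lip_family_diff lip_family_mult lp)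
  then obtain K where K: "K \<ge> 0" "\<And>t. t \<in> {0..1} \<Longrightarrow> norm (p' t * p t - p t * p' t) \<le> K"
    by (rule lip_familyE) blast
  have Yb: "norm (Y t x) \<le> K * norm x" if "t \<in> {0..1}" for t x
  proof -
    have "Y t x = capp (p' t * p t - p t * p' t) x"
      by (simp add: Y_def commutator_def capp_simps cp[OF that])
    then have "norm (Y t x) \<le> norm (p' t * p t - p t * p' t) * norm x" by (simp only: norm_capp)
    also have "\<dots> \<le> K * norm x" using K(2)[OF that] by (rule mult_right_mono) simp
    finally show ?thesis .
  qed
  have V': "evolution_system (\<lambda>_. D) (\<lambda>t x. (1 / \<epsilon>) *\<^sub>R A t x + Y t x) (V \<epsilon>)" if "\<epsilon> > 0" for \<epsilon>
    using V[OF that] by (simp add: Y_def)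
  have M: "M > 0" using assms(2) by simp
  obtain N where N: "N \<ge> 0"
    and VN: "\<And>\<epsilon> s t x. \<epsilon> > 0 \<Longrightarrow> 0 \<le> s \<Longrightarrow> s \<le> t \<Longrightarrow> t \<le> 1 \<Longrightarrow> norm (V \<epsilon> t s x) \<le> N * norm x"
    using perturbed_evolution_bound[OF U V' D cl UM M K(1) Yb] by blast

  \<comment> \<open>Local estimates of order \<epsilon> and their concatenation\<close>
  define Q where "Q a b \<longleftrightarrow> (\<exists>c\<ge>0. \<forall>\<epsilon>>0. \<forall>s t x. 0 \<le> s \<and> a \<le> s \<and> s \<le> t \<and> t \<le> b \<and> t \<le> 1 \<longrightarrow>
    norm (U \<epsilon> t s x - V \<epsilon> t s x) \<le> c * \<epsilon> * norm x)" for a b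
  have "(0::real) \<le> 1" by simp
  then have "Q 0 1"
  proof (induction rule: Bolzano)
    case (trans a b c)
    obtain k where k: "k \<ge> 0" "\<And>\<epsilon> s t x. \<epsilon> > 0 \<Longrightarrow> 0 \<le> s \<and> a \<le> s \<and> s \<le> t \<and> t \<le> b \<and> t \<le> 1 \<Longrightarrow>
        norm (U \<epsilon> t s x - V \<epsilon> t s x) \<le> k * \<epsilon> * norm x"
      using trans(1) unfolding Q_def by blast
    obtain k' where k': "k' \<ge> 0" "\<And>\<epsilon> s t x. \<epsilon> > 0 \<Longrightarrow> 0 \<le> s \<and> b \<le> s \<and> s \<le> t \<and> t \<le> c \<and> t \<le> 1 \<Longrightarrow>
        norm (U \<epsilon> t s x - V \<epsilon> t s x) \<le> k' * \<epsilon> * norm x"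
      using trans(2) unfolding Q_def by blast
    have "norm (U \<epsilon> t s x - V \<epsilon> t s x) \<le> (k + k' + (M * k + k' * N)) * \<epsilon> * norm x"
      if \<epsilon>: "\<epsilon> > 0" and st: "0 \<le> s" "a \<le> s" "s \<le> t" "t \<le> c" "t \<le> 1" for \<epsilon> s t x
    proof -
      consider "t \<le> b" | "b \<le> s" | "s < b" "b < t" by linarith
      then have "norm (U \<epsilon> t s x - V \<epsilon> t s x) \<le> k * \<epsilon> * norm x \<or> norm (U \<epsilon> t s x - V \<epsilon> t s x) \<le> k' * \<epsilon> * norm x
          \<or> norm (U \<epsilon> t s x - V \<epsilon> t s x) \<le> (M * k + k' * N) * \<epsilon> * norm x"
      proof cases
        case 3
        have b: "0 \<le> b" "b \<le> t" "s \<le> b" "b \<le> 1" using 3 st by auto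
        have "U \<epsilon> t s x - V \<epsilon> t s x = U \<epsilon> t b (U \<epsilon> b s x) - V \<epsilon> t b (V \<epsilon> b s x)"
          using evolution_systemD(5)[OF U[OF \<epsilon>] st(1) b(3,2) st(5), of x] evolution_systemD(5)[OF V[OF \<epsilon>] st(1) b(3,2) st(5), of x] by simp
        \<comment> \<open>Telescoping at \<open>b\<close>: the error made before \<open>b\<close> is
          carried on by \<open>U\<close> with factor \<open>M\<close>, the one made after it starts
          from a vector of size at most N norm x. For this reason \<open>Q\<close> admits arbitrary
          starting times.\<close>
        also have "\<dots> = U \<epsilon> t b (U \<epsilon> b s x - V \<epsilon> b s x) + (U \<epsilon> t b (V \<epsilon> b s x) - V \<epsilon> t b (V \<epsilon> b s x))"
          using linear_diff[OF bounded_linear.linear[OF evolution_systemD(1)[OF U[OF \<epsilon>] b(1,2) st(5)]]] by simp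
        also have "norm \<dots> \<le> M * (k * \<epsilon> * norm x) + k' * \<epsilon> * (N * norm x)"
        proof (rule norm_triangle_mono)
          show "norm (U \<epsilon> t b (U \<epsilon> b s x - V \<epsilon> b s x)) \<le> M * (k * \<epsilon> * norm x)"
            using M k(2)[OF \<epsilon>, of s b x] st b by (intro order_trans[OF UM[OF \<epsilon> b(1,2) st(5)]] mult_left_mono) auto
          have "norm (U \<epsilon> t b (V \<epsilon> b s x) - V \<epsilon> t b (V \<epsilon> b s x)) \<le> k' * \<epsilon> * norm (V \<epsilon> b s x)"
            using k'(2)[OF \<epsilon>, of b t] st b by simp
          also have "\<dots> \<le> k' * \<epsilon> * (N * norm x)"
            using VN[OF \<epsilon> st(1) b(3,4)] k'(1) \<epsilon> by (intro mult_left_mono) auto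
          finally show "norm (U \<epsilon> t b (V \<epsilon> b s x) - V \<epsilon> t b (V \<epsilon> b s x)) \<le> k' * \<epsilon> * (N * norm x)" .
        qed
        finally show ?thesis by (simp add: algebra_simps)
      qed (use k(2)[OF \<epsilon>, of s t x] k'(2)[OF \<epsilon>, of s t x] st in auto)
      moreover have "0 \<le> k * \<epsilon> * norm x" "0 \<le> k' * \<epsilon> * norm x" "0 \<le> (M * k + k' * N) * \<epsilon> * norm x"
        using k(1) k'(1) M N \<epsilon> by auto
      ultimately show ?thesis unfolding distrib_right[of _ _ \<epsilon>] distrib_right[of _ _ "norm x"] by linarith
    qed
    then show ?case unfolding Q_def using k(1) k'(1) M N by (intro exI[of _ "k + k' + (M * k + k' * N)"]) auto
  next
    case (local t0)
    then have t0: "t0 \<in> {0..1}" by simp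
    have Pcp: "associated_projection D (A t) (\<sigma> t) (capp (p t))" if "t \<in> {0..1}" for t
      using P[OF that] cp[OF that] by simp
    obtain \<delta> B where \<delta>: "\<delta> > 0" "lip_family ({0..1} \<inter> ball t0 \<delta>) B"
      and comm: "\<And>t v. t \<in> {0..1} \<inter> ball t0 \<delta> \<Longrightarrow> v \<in> D \<Longrightarrow> capp (B t) v \<in> D \<and>
        capp (B t) (A t v) - A t (capp (B t) v) = commutator (capp (p' t)) (capp (p t)) v"
      using local_commutator_equation[OF A lip C t0 Pcp lp] by blast
    obtain L where L: "L \<ge> 0" "\<And>t. t \<in> {0..1} \<inter> ball t0 \<delta> \<Longrightarrow> norm (B t) \<le> L"
      "\<And>s t. s \<in> {0..1} \<inter> ball t0 \<delta> \<Longrightarrow> t \<in> {0..1} \<inter> ball t0 \<delta> \<Longrightarrow> norm (B t - B s) \<le> L * norm (t - s)"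
      using \<delta>(2) by (rule lip_familyE) blast
    \<comment> \<open>Three contributions: the increment estimate (residual L K and Lipschitz
      constant L), the correction \<epsilon> B at time \<open>t\<close>, and the one at time
      \<open>s\<close>.\<close>
    define c where "c = M * (L * K + L) * N + L * N + M * L"
    have c0: "c \<ge> 0" using M L K N by (simp add: c_def)
    have "norm (U \<epsilon> t s x - V \<epsilon> t s x) \<le> c * \<epsilon> * norm x"
      if \<epsilon>: "\<epsilon> > 0" and st: "0 \<le> s" "s \<le> t" "t \<le> 1" "t0 - \<delta> < s" "t < t0 + \<delta>" for \<epsilon> s t x
    proof (cases "s = t")
      case True
      then show ?thesis
        using evolution_system_refl[OF V[OF \<epsilon>] D, of s x] evolution_system_refl[OF U[OF \<epsilon>] D, of s x] st c0 \<epsilon> by simp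
    next
      case False
      then have lt: "s < t" using st by simp
      have J: "\<tau> \<in> {0..1} \<inter> ball t0 \<delta>" if "\<tau> \<in> {s..t}" for \<tau>
        using that st by (auto simp: dist_real_def)
      show ?thesis
      proof (rule bounded_by_density[OF _ D])
        show "bounded_linear (\<lambda>x. U \<epsilon> t s x - V \<epsilon> t s x)"
          using evolution_systemD(1)[OF U[OF \<epsilon>]] evolution_systemD(1)[OF V[OF \<epsilon>]] st by (intro bounded_linear_sub) blast+
        fix y assume y: "y \<in> D"
        have VB: "norm (V \<epsilon> \<tau> s y) \<le> N * norm y" if "\<tau> \<in> {s..t}" for \<tau>
          using VN[OF \<epsilon> st(1), of \<tau> y] that st by simp
        let ?v = "V \<epsilon> t s y"
        \<comment> \<open>With an exact solution of the commutator equation the residual shrinks to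
          \<epsilon> B Y, of norm at most \<epsilon> L K.\<close>
        have "norm ((?v - \<epsilon> *\<^sub>R capp (B t) ?v) - U \<epsilon> t s (y - \<epsilon> *\<^sub>R capp (B s) y)) \<le> M * (\<epsilon> * (L * K) + \<epsilon> * L) * (N * norm y) * (t - s)"
        proof (rule duhamel_increment[OF \<epsilon> U[OF \<epsilon>] V'[OF \<epsilon>] D cl UM[OF \<epsilon>] M st(1) lt st(3) y])
          show "capp (B \<tau>) x \<in> D" if "\<tau> \<in> {s..t}" "x \<in> D" for \<tau> x using comm J that by blast
          show "norm (B \<tau>' - B \<tau>) \<le> L * norm (\<tau>' - \<tau>)" if "\<tau> \<in> {s..t}" "\<tau>' \<in> {s..t}" for \<tau> \<tau>'
            using L(3) J that by blast
          show "norm (Y \<tau> x - (capp (B \<tau>) (A \<tau> x) - A \<tau> (capp (B \<tau>) x)) - \<epsilon> *\<^sub>R capp (B \<tau>) (Y \<tau> x)) \<le> \<epsilon> * (L * K) * norm x"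
            if \<tau>: "\<tau> \<in> {s..t}" and x: "x \<in> D" for \<tau> x
          proof -
            have \<tau>1: "\<tau> \<in> {0..1}" using J[OF \<tau>] by blast
            have "capp (B \<tau>) (A \<tau> x) - A \<tau> (capp (B \<tau>) x) = Y \<tau> x"
              using comm[OF J[OF \<tau>] x] cp[OF \<tau>1] by (simp add: Y_def)
            moreover have "norm (capp (B \<tau>) (Y \<tau> x)) \<le> L * (K * norm x)"
              using L(1) L(2)[OF J[OF \<tau>]] Yb[OF \<tau>1, of x] by (intro order_trans[OF norm_capp] mult_mono) auto
            ultimately show ?thesis using \<epsilon> by (simp add: mult.assoc)
          qed
        qed (use L K \<epsilon> VB in auto)
        also have "\<dots> \<le> M * (\<epsilon> * (L * K) + \<epsilon> * L) * (N * norm y) * 1"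
          using M L K N \<epsilon> st by (intro mult_left_mono) auto
        finally have 1: "norm ((?v - \<epsilon> *\<^sub>R capp (B t) ?v) - U \<epsilon> t s (y - \<epsilon> *\<^sub>R capp (B s) y)) \<le> M * (L * K + L) * N * \<epsilon> * norm y"
          by (simp add: algebra_simps)
        have 2: "norm (\<epsilon> *\<^sub>R capp (B t) ?v) \<le> L * N * \<epsilon> * norm y"
        proof -
          have "norm (capp (B t) ?v) \<le> L * (N * norm y)"
            using L(1) L(2)[OF J, of t] VB[of t] st by (intro order_trans[OF norm_capp] mult_mono) auto
          then show ?thesis using \<epsilon> by (simp add: mult_ac)
        qed
        have 3: "norm (\<epsilon> *\<^sub>R U \<epsilon> t s (capp (B s) y)) \<le> M * L * \<epsilon> * norm y"
        proof -
          have "norm (capp (B s) y) \<le> L * norm y"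
            using L(2)[OF J, of s] st by (intro order_trans[OF norm_capp] mult_right_mono) auto
          then have "M * norm (capp (B s) y) \<le> M * (L * norm y)" using M by simp
          then have "norm (U \<epsilon> t s (capp (B s) y)) \<le> M * (L * norm y)"
            using UM[OF \<epsilon> st(1-3), of "capp (B s) y"] by linarith
          then show ?thesis using \<epsilon> by (simp add: mult_ac)
        qed
        note linU = bounded_linear.linear[OF evolution_systemD(1)[OF U[OF \<epsilon>] st(1-3)]]
        have "U \<epsilon> t s y - ?v = - ((?v - \<epsilon> *\<^sub>R capp (B t) ?v) - U \<epsilon> t s (y - \<epsilon> *\<^sub>R capp (B s) y))
            - \<epsilon> *\<^sub>R capp (B t) ?v + \<epsilon> *\<^sub>R U \<epsilon> t s (capp (B s) y)"
          by (simp add: linear_diff[OF linU] linear_scale[OF linU])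
        also have "norm \<dots> \<le> M * (L * K + L) * N * \<epsilon> * norm y + L * N * \<epsilon> * norm y + M * L * \<epsilon> * norm y"
          by (intro norm_triangle_mono norm_triangle_le_diff add_mono 2 3) (simp only: norm_minus_cancel 1)
        also have "\<dots> = c * \<epsilon> * norm y" by (simp add: c_def algebra_simps)
        finally show "norm (U \<epsilon> t s y - V \<epsilon> t s y) \<le> c * \<epsilon> * norm y" .
      qed
    qed
    then have "Q a b" if "a \<le> t0" "t0 \<le> b" "b - a < \<delta>" for a b
      unfolding Q_def using that c0 by (intro exI[of _ c]) auto
    with \<delta>(1) show ?case by blast
  qed
  then obtain c where c: "c \<ge> 0" "\<And>\<epsilon> t x. \<epsilon> > 0 \<Longrightarrow> t \<in> {0..1} \<Longrightarrow> norm (U \<epsilon> t 0 x - V \<epsilon> t 0 x) \<le> c * \<epsilon> * norm x"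
    unfolding Q_def by auto

  \<comment> \<open>Passage to the supremum over t\<close>
  show ?thesis
  proof (rule bigoI[of _ c])
    show "\<forall>\<^sub>F \<epsilon> in at_right 0. norm (SUP t\<in>{0..1}. onorm (\<lambda>x. U \<epsilon> t 0 x - V \<epsilon> t 0 x)) \<le> c * norm \<epsilon>"
      using eventually_at_right_less[of 0]
    proof eventually_elim
      fix \<epsilon> :: real assume \<epsilon>: "0 < \<epsilon>"
      let ?f = "\<lambda>t. onorm (\<lambda>x. U \<epsilon> t 0 x - V \<epsilon> t 0 x)"
      \<comment> \<open>Besides the estimate this gives boundedness above, without which the
        supremum of reals would be unspecified.\<close>
      have le: "?f t \<le> c * \<epsilon>" if "t \<in> {0..1}" for t
        using c \<epsilon> that by (intro onorm_bound) auto
      have "0 \<le> ?f 0"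
        using evolution_systemD(1)[OF U[OF \<epsilon>], of 0 0] evolution_systemD(1)[OF V[OF \<epsilon>], of 0 0]
        by (intro onorm_pos_le bounded_linear_sub) auto
      also have "?f 0 \<le> (SUP t\<in>{0..1}. ?f t)"
        by (intro cSUP_upper bdd_aboveI2[where M="c * \<epsilon>"] le) auto
      finally have "0 \<le> (SUP t\<in>{0..1}. ?f t)" .
      moreover have "(SUP t\<in>{0..1}. ?f t) \<le> c * \<epsilon>" by (intro cSUP_least le) auto
      ultimately show "norm (SUP t\<in>{0..1}. ?f t) \<le> c * norm \<epsilon>" using \<epsilon> by simp
    qed
  qed
qed

end
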